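(* Assume hypothesis $\hat C$ (stated in full in the context: the conjunction of the Riemann hypothesis RH and the conjectures C1, C3, C4, for some $\alpha\in(0,\tfrac12)$). Then $f(s)=p(s)$ for all $s\in\mathbb{C}\setminus Z^\circ$, i.e. $$\frac{1}{\sin(\pi s/4)\cdot 2\xi(\tfrac12+s)}=\frac{c(0)}{s}+\sum_{w\ge1}c(4w)\Big(\frac1{s-4w}+\frac1{s+4w}\Big)+\sum_{k\ge1}c(i\gamma_k)\Big(\frac1{s-i\gamma_k}+\frac1{s+i\gamma_k}\Big).$$
   Context: Notation. $\zeta$ is the Riemann zeta-function; $a(s)=\pi^{-s/2}s\,\Gamma(s/2)(s-1)$; $\xi(s)=\tfrac12a(s)\zeta(s)$ (entire); $n(s)=\sin(\pi s/4)\cdot2\xi(\tfrac12+s)$ (entire); $f(s)=1/n(s)$ (meromorphic). $c(z)=1/n'(z)$ whenever $n'(z)\ne0$ (this holds at every $z=4w$, $w\in\mathbb{Z}$). $Z_i$ is the set of nonreal zeros of $\zeta(\tfrac12+s)$, and $Z^\circ=4\mathbb{Z}\cup Z_i$. Zeta ordinates. $\gamma_1<\gamma_2<\cdots$ enumerate the distinct imaginary parts of the zeros of $\zeta$ with positive imaginary part; $\gamma_{-n}=-\gamma_n$ for $n\ge1$. For a nonzero integer $k$, $\delta_k$ is the smaller of the distances from $\gamma_k$ to its two neighbours in the ordered set $\{\gamma_j: j\in\mathbb{Z}\setminus\{0\}\}$, and $\delta_k'=\min\{1/\log|\gamma_k|,\delta_k\}$. Partial fractions. $p(s)=p_r(s)+p_i(s)$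 with $p_r(s)=\frac{c(0)}{s}+\sum_{w\ge1}c(4w)\big(\frac1{s-4w}+\frac1{s+4w}\big)$ and $p_i(s)=\sum_{k\ge1}c(i\gamma_k)\big(\frac1{s-i\gamma_k}+\frac1{s+i\gamma_k}\big)$. (Under $\hat C$ all nonreal zeros of $\zeta$ are simple and $\sum_{k\ge 1}|c(i\gamma_k)|<\infty$.) Hypothesis $\hat C$: there is $\alpha$ with $0<\alpha<\tfrac12$ such that all of the following hold. (RH) Every nonreal zero of $\zeta$ has real part $\tfrac12$. (C1) For $t>t(1):=\gamma_1-\alpha\delta_1'$ let $s(t,\alpha)=x(t,\alpha)+it$, where $x(t,\alpha)=\sqrt{(\alpha\delta_k')^2-(t-\gamma_k)^2}$ if $|t-\gamma_k|\le\alpha\delta_k'$ for some $k\ge1$, and $x(t,\alpha)=0$ otherwise. (i) There exist $\varepsilon>0,\lambda>0$ with $|\zeta(\tfrac12+s(t,\alpha))|>\lambda t^{-\varepsilon}$ for all $t>t(1)$; let $\varepsilon_0$ be the infimum of such $\varepsilon$. (ii) $\varepsilon_0<3/4$. (C3) (i′) There is a real $\varepsilon\ge0$ such that for any $\sigma>0$ there is $K>0$ with $|\zeta'(\tfrac12+i\gamma_k)|>K\gamma_k^{-(\varepsilon+\sigma)}$ for all $k\ge1$; let $\varepsilon_1$ be the least such $\varepsilon$. (i) There is $\varepsilon\ge0$ such that for any $\sigma>0$ there is $K>0$ with $\delta_k>K\gamma_k^{-(\varepsilon+\sigma)}$ for all $k\ge1$; let $\varepsilon_2$ be the least such $\varepsilon$.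 (ii) $\varepsilon_1+\varepsilon_2<3/4$. (C4) Let $j_k(\alpha)=\min\{|\zeta(\tfrac12+it)/(t-\gamma_k)|: t\in\mathbb{R},\ |t-\gamma_k|\le\alpha\delta_k'\}$, where at $t=\gamma_k$ the quotient is read as $\zeta'(\tfrac12+i\gamma_k)$. (i) There is $\varepsilon\ge0$ such that for any $\sigma>0$ there is $K>0$ with $j_k(\alpha)>K\gamma_k^{-(\varepsilon+\sigma)}$ for all $k\ge1$; let $\tilde\varepsilon_1$ be the least such $\varepsilon$. (ii) $\tilde\varepsilon_1+\varepsilon_2\le1$. *)

theory Defs
  imports "HOL-Complex_Analysis.Complex_Analysis"
begin

text \<open>
  The Riemann zeta function is the analytic continuation of its Dirichlet series to the plane
  punctured at 1; the value 0 at the pole is a convention and plays no role. Existence and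
  uniqueness are \<open>is_zeta_exists\<close> and \<open>is_zeta_unique\<close>. The continuation is obtained by
  telescoping \<open>(n+1)^(1-s) - n^(1-s)\<close> against its Taylor expansion, which expresses
  \<open>(s-1) zeta(s)\<close> through the values \<open>(s+j) zeta(s+j+1)\<close>, \<open>j \<ge> 0\<close>, further to the right.
\<close>

definition is_zeta :: "(complex \<Rightarrow> complex) \<Rightarrow> bool" where
  "is_zeta F \<longleftrightarrow> F holomorphic_on (- {1})
     \<and> (\<forall>s. Re s > 1 \<longrightarrow> (\<lambda>n. 1 / of_nat (Suc n) powr s) sums F s)
     \<and> F 1 = 0"

definition zeta :: "complex \<Rightarrow> complex" where
  "zeta = (THE F. is_zeta F)"

lemma is_zeta_unique:
  assumes "is_zeta F" "is_zeta G"
  shows "F = G"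
proof
  fix s :: complex
  show "F s = G s"
  proof (cases "s = 1")
    case True
    then show ?thesis using assms by (simp add: is_zeta_def)
  next
    case False
    have eq: "F z = G z" if "Re z > 1" for z
      using assms that sums_unique2[of "\<lambda>n. 1 / of_nat (Suc n) powr z" "F z" "G z"]
      unfolding is_zeta_def by blast
    have ne: "{s::complex. Re s > 1} \<noteq> {}" by (auto intro!: exI[of _ 2])
    have conn: "connected (- {1::complex})"
      by (rule connected_punctured_universe) simp
    have hol: "F holomorphic_on - {1}" "G holomorphic_on - {1}"
      using assms unfolding is_zeta_def by blast+
    show ?thesis
      by (rule analytic_continuation_open[OF open_halfspace_Re_gt _ ne conn _ hol eq])
         (use False in auto)
  qed
qed

abbreviation (input) falling :: "nat \<Rightarrow> complex \<Rightarrow> complex" where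
  "falling k s \<equiv> (\<Prod>j<k. 1 - s - of_nat j)"

definition zeta_rem :: "nat \<Rightarrow> nat \<Rightarrow> complex \<Rightarrow> complex" where
  "zeta_rem N n s = of_nat (Suc (Suc n)) powr (1 - s)
     - (\<Sum>k\<le>N. falling k s / fact k * of_nat (Suc n) powr (1 - s - of_nat k))"

lemma norm_Suc_powr: "cmod (of_nat (Suc n) powr s) = real (Suc n) powr Re s"
  using norm_powr_real_powr[of "of_nat (Suc n)" s] by simp

lemma zeta_rem_bound:
  assumes "Re s + real N \<ge> 0"
  shows "cmod (zeta_rem N n s)
           \<le> cmod (falling (Suc N) s) * real (Suc n) powr (- (Re s + real N)) / fact N"
proof -
  define S where "S = closed_segment (of_nat (Suc n) :: complex) (of_nat (Suc (Suc n)))"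
  define f where "f = (\<lambda>i u. falling i s * u powr (1 - s - of_nat i))"
  have S: "\<exists>r. u = of_real r \<and> r \<ge> real (Suc n)" if "u \<in> S" for u
  proof -
    from that obtain t where t: "0 \<le> t" "t \<le> 1"
      "u = (1 - t) *\<^sub>R of_nat (Suc n) + t *\<^sub>R of_nat (Suc (Suc n))"
      unfolding S_def closed_segment_def by blast
    have "u = of_real (real (Suc n) + t)"
      using t(3) by (simp add: scaleR_conv_of_real algebra_simps)
    then show ?thesis using t(1) by (intro exI[of _ "real (Suc n) + t"]) simp
  qed
  have "cmod (f 0 (of_nat (Suc (Suc n))) - (\<Sum>i\<le>N. f i (of_nat (Suc n))
            * (of_nat (Suc (Suc n)) - of_nat (Suc n)) ^ i / fact i))
        \<le> (cmod (falling (Suc N) s) * real (Suc n) powr (- (Re s + real N)))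
            * cmod (of_nat (Suc (Suc n)) - of_nat (Suc n)) ^ Suc N / fact N"
  proof (rule complex_Taylor)
    show "convex S" by (simp add: S_def)
    show "of_nat (Suc n) \<in> S" "of_nat (Suc (Suc n)) \<in> S" by (simp_all add: S_def)
    show "(f i has_field_derivative f (Suc i) u) (at u within S)" if u: "u \<in> S" for i u
    proof -
      obtain r where r: "u = of_real r" "r \<ge> real (Suc n)" using S[OF u] by blast
      then have "u \<notin> \<real>\<^sub>\<le>\<^sub>0" by (auto simp: complex_nonpos_Reals_iff)
      then have "((\<lambda>u. u powr (1 - s - of_nat i)) has_field_derivative
                   (1 - s - of_nat i) * u powr (1 - s - of_nat i - 1)) (at u within S)"
        by (rule has_field_derivative_at_within[OF has_field_derivative_powr])
      from DERIV_cmult[OF this, of "falling i s"] show ?thesis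
        by (simp add: f_def algebra_simps)
    qed
    show "cmod (f (Suc N) u) \<le> cmod (falling (Suc N) s) * real (Suc n) powr (- (Re s + real N))"
      if u: "u \<in> S" for u
    proof -
      obtain r where r: "u = of_real r" "r \<ge> real (Suc n)" using S[OF u] by blast
      then have "cmod (u powr (1 - s - of_nat (Suc N))) = r powr (- (Re s + real N))"
        using norm_powr_real_powr[of u] by simp
      also have "\<dots> \<le> real (Suc n) powr (- (Re s + real N))"
        using r assms by (intro powr_mono2') auto
      finally show ?thesis
        unfolding f_def norm_mult by (intro mult_left_mono) auto
    qed
  qed
  then show ?thesis by (simp add: zeta_rem_def f_def algebra_simps)
qed

lemma zeta_rem_series:
  obtains R where "R holomorphic_on {s. Re s > - real m}"
    "\<And>s. Re s > - real m \<Longrightarrow> (\<lambda>n. zeta_rem (m + 3) n s) sums R s"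
proof -
  let ?S = "{s. Re s > - real m}"
  have "open ?S" by (rule open_halfspace_Re_gt)
  obtain R where R: "\<forall>s\<in>?S. ((\<lambda>n. zeta_rem (m + 3) n s) sums R s) \<and> R field_differentiable (at s)"
  proof (rule series_differentiable_comparison_complex[OF \<open>open ?S\<close>])
    show "zeta_rem (m + 3) n field_differentiable at s" if "s \<in> ?S" for n s
    proof -
      have "(\<lambda>s. zeta_rem (m + 3) n s) holomorphic_on UNIV"
        unfolding zeta_rem_def by (intro holomorphic_intros) auto
      then show ?thesis by (simp add: holomorphic_on_def)
    qed
    fix s assume s: "s \<in> ?S"
    have "continuous_on (cball s 1) (falling (Suc (m + 3)))"
      by (intro continuous_intros)
    then have "bounded (falling (Suc (m + 3)) ` cball s 1)"
      by (intro compact_imp_bounded compact_continuous_image) auto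
    then obtain B where B: "B > 0" "\<And>y. y \<in> cball s 1 \<Longrightarrow> cmod (falling (Suc (m + 3)) y) \<le> B"
      unfolding bounded_pos by blast
    define h where "h = (\<lambda>n. B * real (Suc n) powr (-2))"
    have "summable (\<lambda>n. real (Suc n) powr (-2))"
      using summable_real_powr_iff[of "-2"] by (subst summable_Suc_iff) simp
    then have "summable h" unfolding h_def by (rule summable_mult)
    have "cmod (zeta_rem (m + 3) n y) \<le> h n" if y: "y \<in> ball s 1" for n y
    proof -
      have "Re s - Re y \<le> cmod (s - y)" using complex_Re_le_cmod[of "s - y"] by simp
      with y s have Re: "Re y + real (m + 3) \<ge> 2" by (simp add: dist_norm)
      have "cmod (zeta_rem (m + 3) n y)
             \<le> cmod (falling (Suc (m + 3)) y) * real (Suc n) powr (- (Re y + real (m + 3))) / fact (m + 3)"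
        using Re by (intro zeta_rem_bound) auto
      also have "\<dots> \<le> cmod (falling (Suc (m + 3)) y) * real (Suc n) powr (- (Re y + real (m + 3))) / 1"
        by (intro divide_left_mono mult_nonneg_nonneg) (auto simp del: prod.lessThan_Suc)
      also have "\<dots> = cmod (falling (Suc (m + 3)) y) * real (Suc n) powr (- (Re y + real (m + 3)))"
        by simp
      also have "\<dots> \<le> B * real (Suc n) powr (-2)"
        using B(2)[of y] B(1) y Re by (intro mult_mono powr_mono) (auto simp del: prod.lessThan_Suc)
      finally show ?thesis by (simp add: h_def)
    qed
    then show "\<exists>d k. 0 < d \<and> summable k \<and> range k \<subseteq> \<real>\<^sub>\<ge>\<^sub>0 \<and>
          (\<forall>\<^sub>F n in sequentially. \<forall>y\<in>ball s d \<inter> ?S. cmod (zeta_rem (m + 3) n y) \<le> cmod (k n))"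
      using \<open>summable h\<close> B(1)
      by (intro exI[of _ 1] exI[of _ "\<lambda>n. of_real (h n)"] conjI)
         (auto simp: h_def nonneg_Reals_of_real_iff norm_mult intro!: summable_of_real always_eventually)
  qed
  show ?thesis
  proof (rule that)
    show "R holomorphic_on ?S"
      using R by (auto simp: holomorphic_on_def intro: field_differentiable_at_within)
  qed (use R in auto)
qed

lemma dirichlet_series:
  obtains D where "D holomorphic_on {s. Re s > 1}"
    "\<And>s. Re s > 1 \<Longrightarrow> (\<lambda>n. of_nat (Suc n) powr (- s)) sums D s"
proof -
  let ?S = "{s. Re s > 1}"
  have "open ?S" by (rule open_halfspace_Re_gt)
  obtain D where D: "\<forall>s\<in>?S. ((\<lambda>n. of_nat (Suc n) powr (- s)) sums D s) \<and> D field_differentiable (at s)"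
  proof (rule series_differentiable_comparison_complex[OF \<open>open ?S\<close>])
    show "(\<lambda>s. of_nat (Suc n) powr (- s)) field_differentiable at s" if "s \<in> ?S" for n and s :: complex
    proof -
      have "(\<lambda>s. of_nat (Suc n) powr (- s) :: complex) holomorphic_on UNIV"
        by (intro holomorphic_intros)
      then show ?thesis by (simp add: holomorphic_on_def)
    qed
    fix s assume s: "s \<in> ?S"
    define d where "d = (Re s - 1) / 2"
    define h where "h = (\<lambda>n. real (Suc n) powr (- (1 + d)))"
    have "d > 0" using s by (simp add: d_def)
    then have "summable h"
      unfolding h_def using summable_real_powr_iff[of "- (1 + d)"] by (subst summable_Suc_iff) simp
    have "cmod (of_nat (Suc n) powr (- y)) \<le> h n" if y: "y \<in> ball s d" for n y
    proof -
      have "Re s - Re y \<le> cmod (s - y)" using complex_Re_le_cmod[of "s - y"] by simp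
      with y s have "Re y \<ge> 1 + d" by (simp add: dist_norm d_def field_simps)
      then show ?thesis unfolding norm_Suc_powr h_def by (intro powr_mono) auto
    qed
    then show "\<exists>d k. 0 < d \<and> summable k \<and> range k \<subseteq> \<real>\<^sub>\<ge>\<^sub>0 \<and>
          (\<forall>\<^sub>F n in sequentially. \<forall>y\<in>ball s d \<inter> ?S. cmod (of_nat (Suc n) powr (- y)) \<le> cmod (k n))"
      using \<open>summable h\<close> \<open>d > 0\<close>
      by (intro exI[of _ d] exI[of _ "\<lambda>n. of_real (h n)"] conjI)
         (auto simp: h_def nonneg_Reals_of_real_iff simp del: of_nat_Suc
               intro!: summable_of_real always_eventually)
  qed
  show ?thesis
  proof (rule that)
    show "D holomorphic_on ?S"
      using D by (auto simp: holomorphic_on_def intro: field_differentiable_at_within)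
  qed (use D in auto)
qed

lemma zeta_rem_recurrence:
  assumes D: "\<And>s. Re s > 1 \<Longrightarrow> (\<lambda>n. of_nat (Suc n) powr (- s)) sums D s"
  assumes s: "Re s > 1"
  shows "(\<lambda>n. zeta_rem (Suc N) n s) sums
    (- 1 + (s - 1) * D s + (\<Sum>k=2..Suc N. falling (k - 1) s / fact k * ((s + of_nat k - 2) * D (s + of_nat k - 1))))"
proof -
  have tele: "(\<lambda>n. of_nat (Suc (Suc n)) powr (1 - s) - of_nat (Suc n) powr (1 - s)) sums (0 - of_nat (Suc 0) powr (1 - s))"
  proof (rule telescope_sums)
    have "(\<lambda>n. of_nat n powr (1 - s)) \<longlonglongrightarrow> 0"
      using s by (intro tendsto_neg_powr_complex_of_nat filterlim_ident) auto
    then show "(\<lambda>n. of_nat (Suc n) powr (1 - s)) \<longlonglongrightarrow> 0" by (rule LIMSEQ_Suc)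
  qed
  have "(\<lambda>n. falling (Suc k) s / fact (Suc k) * of_nat (Suc n) powr (1 - s - of_nat (Suc k)))
          sums (falling (Suc k) s / fact (Suc k) * D (s + of_nat k))" for k
    using D[of "s + of_nat k"] s by (intro sums_mult) (simp add: algebra_simps)
  then have *: "(\<lambda>n. \<Sum>k\<le>N. falling (Suc k) s / fact (Suc k) * of_nat (Suc n) powr (1 - s - of_nat (Suc k)))
          sums (\<Sum>k\<le>N. falling (Suc k) s / fact (Suc k) * D (s + of_nat k))"
    by (intro sums_sum)
  have "(\<lambda>n. zeta_rem (Suc N) n s) = (\<lambda>n. of_nat (Suc (Suc n)) powr (1 - s) - of_nat (Suc n) powr (1 - s)
     - (\<Sum>k\<le>N. falling (Suc k) s / fact (Suc k) * of_nat (Suc n) powr (1 - s - of_nat (Suc k))))"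
    unfolding zeta_rem_def by (subst sum.atMost_Suc_shift) (simp add: algebra_simps)
  also have "\<dots> sums (0 - of_nat (Suc 0) powr (1 - s) - (\<Sum>k\<le>N. falling (Suc k) s / fact (Suc k) * D (s + of_nat k)))"
    by (intro sums_diff tele *)
  also have "(\<Sum>k\<le>N. falling (Suc k) s / fact (Suc k) * D (s + of_nat k))
     = - (\<Sum>k\<le>N. falling k s / fact (Suc k) * ((s + of_nat k - 1) * D (s + of_nat k)))"
    unfolding sum_negf[symmetric]
    by (intro sum.cong refl) (simp add: algebra_simps add_divide_distrib diff_divide_distrib)
  also have "(\<Sum>k\<le>N. falling k s / fact (Suc k) * ((s + of_nat k - 1) * D (s + of_nat k)))
     = (s - 1) * D s + (\<Sum>k\<in>{1..N}. falling k s / fact (Suc k) * ((s + of_nat k - 1) * D (s + of_nat k)))"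
    by (subst atMost_atLeast0, subst sum.atLeast_Suc_atMost) auto
  also have "(\<Sum>k\<in>{1..N}. falling k s / fact (Suc k) * ((s + of_nat k - 1) * D (s + of_nat k)))
     = (\<Sum>k=2..Suc N. falling (k - 1) s / fact k * ((s + of_nat k - 2) * D (s + of_nat k - 1)))"
    by (rule sum.reindex_bij_witness[of _ "\<lambda>k. k - 1" Suc]) (auto simp: algebra_simps)
  finally show ?thesis by (simp add: algebra_simps)
qed

lemma zeta_continuation_halfplane:
  assumes hol: "D holomorphic_on {s. Re s > 1}"
  assumes D: "\<And>s. Re s > 1 \<Longrightarrow> (\<lambda>n. of_nat (Suc n) powr (- s)) sums D s"
  shows "\<exists>G. G holomorphic_on {s. Re s > 1 - real m} \<and> (\<forall>s. Re s > 1 \<longrightarrow> G s = (s - 1) * D s)"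
proof (induction m)
  case 0
  show ?case
    by (intro exI[of _ "\<lambda>s. (s - 1) * D s"]) (auto intro!: holomorphic_intros hol)
next
  case (Suc m)
  then obtain G where G: "G holomorphic_on {s. Re s > 1 - real m}"
    "\<And>s. Re s > 1 \<Longrightarrow> G s = (s - 1) * D s" by blast
  obtain R where R: "R holomorphic_on {s. Re s > - real m}"
    "\<And>s. Re s > - real m \<Longrightarrow> (\<lambda>n. zeta_rem (m + 3) n s) sums R s"
    using zeta_rem_series[of m] by blast
  define T where "T = (\<lambda>s. \<Sum>k=2..m+3. falling (k - 1) s / fact k * G (s + of_nat k - 1))"
  have "(\<lambda>s. G (s + of_nat k - 1)) holomorphic_on {s. Re s > - real m}" if "k \<in> {2..m+3}" for k
  proof -
    have "(\<lambda>s. s + of_nat k - 1) ` {s. Re s > - real m} \<subseteq> {s. Re s > 1 - real m}"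
      using that by auto
    then show ?thesis
      by (intro holomorphic_on_compose_gen[unfolded o_def, OF _ G(1)] holomorphic_intros)
  qed
  then have T: "T holomorphic_on {s. Re s > - real m}"
    unfolding T_def by (intro holomorphic_intros) auto
  have "1 + R s - T s = (s - 1) * D s" if s: "Re s > 1" for s
  proof -
    have "T s = (\<Sum>k=2..m+3. falling (k - 1) s / fact k * ((s + of_nat k - 2) * D (s + of_nat k - 1)))"
      unfolding T_def using s by (intro sum.cong refl) (simp add: G(2))
    moreover have "R s = - 1 + (s - 1) * D s + (\<Sum>k=2..m+3. falling (k - 1) s / fact k * ((s + of_nat k - 2) * D (s + of_nat k - 1)))"
    proof (rule sums_unique2)
      show "(\<lambda>n. zeta_rem (m + 3) n s) sums R s" using R(2) s by simp
      have "m + 3 = Suc (m + 2)" by simp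
      then show "(\<lambda>n. zeta_rem (m + 3) n s) sums (- 1 + (s - 1) * D s
          + (\<Sum>k=2..m+3. falling (k - 1) s / fact k * ((s + of_nat k - 2) * D (s + of_nat k - 1))))"
        using zeta_rem_recurrence[OF D s, of "m + 2"] by (simp only:)
    qed
    ultimately show ?thesis by simp
  qed
  then show ?case
    by (intro exI[of _ "\<lambda>s. 1 + R s - T s"]) (auto intro!: holomorphic_intros R T)
qed

lemma is_zeta_exists: "\<exists>F. is_zeta F"
proof -
  obtain D where D: "D holomorphic_on {s. Re s > 1}"
    "\<And>s. Re s > 1 \<Longrightarrow> (\<lambda>n. of_nat (Suc n) powr (- s)) sums D s"
    using dirichlet_series by blast
  obtain G where G: "\<And>m. G m holomorphic_on {s. Re s > 1 - real m}"
    "\<And>m s. Re s > 1 \<Longrightarrow> G m s = (s - 1) * D s"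
    using zeta_continuation_halfplane[OF D] by metis
  have ne: "{s::complex. Re s > 1} \<noteq> {}" by (auto intro!: exI[of _ 2])
  have cons: "G m s = G k s" if "m \<le> k" "Re s > 1 - real m" for m k s
  proof (rule analytic_continuation_open[of "{s. Re s > 1}" "{s. Re s > 1 - real m}" "G m" "G k" s])
    show "G k holomorphic_on {s. Re s > 1 - real m}"
      by (rule holomorphic_on_subset[OF G(1)]) (use that in auto)
    show "{s::complex. Re s > 1} \<noteq> {}" using ne .
  qed (use that G in \<open>auto simp: open_halfspace_Re_gt convex_halfspace_Re_gt intro!: convex_connected\<close>)
  define H where "H = (\<lambda>s. G (nat \<lceil>2 - Re s\<rceil>) s)"
  have H: "H s = G m s" if "Re s > 1 - real m" for m s
  proof (cases "m \<le> nat \<lceil>2 - Re s\<rceil>")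
    case True
    then show ?thesis using cons[of m _ s] that by (simp add: H_def)
  next
    case False
    have "Re s > 1 - real (nat \<lceil>2 - Re s\<rceil>)" by linarith
    then show ?thesis using cons[of "nat \<lceil>2 - Re s\<rceil>" m s] False by (simp add: H_def)
  qed
  have "H holomorphic_on UNIV"
  proof -
    have "H field_differentiable (at s)" for s
    proof -
      obtain m :: nat where m: "Re s > 1 - real m" using reals_Archimedean2[of "1 - Re s"] by (auto simp: algebra_simps)
      have "H holomorphic_on {s. Re s > 1 - real m}"
        using G(1)[of m] H by (subst holomorphic_cong[of _ _ _ "G m"]) auto
      then show ?thesis
        using m holomorphic_on_imp_differentiable_at open_halfspace_Re_gt by blast
    qed
    then show ?thesis by (simp add: holomorphic_on_def)
  qed
  then have "(\<lambda>s. H s / (s - 1)) holomorphic_on - {1}"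
    by (intro holomorphic_intros) (auto intro: holomorphic_on_subset)
  then have 1: "(\<lambda>s. if s = 1 then 0 else H s / (s - 1)) holomorphic_on - {1}"
    by (rule holomorphic_transform) auto
  have "(\<lambda>n. 1 / of_nat (Suc n) powr s) sums (if s = 1 then 0 else H s / (s - 1))" if "Re s > 1" for s
  proof -
    have "s \<noteq> 1" using that by auto
    then have "(if s = 1 then 0 else H s / (s - 1)) = D s" using that H[of 0 s] G(2)[of s 0] by simp
    then show ?thesis using D(2)[OF that] by (simp add: powr_minus divide_inverse)
  qed
  with 1 show ?thesis unfolding is_zeta_def by (intro exI[of _ "\<lambda>s. if s = 1 then 0 else H s / (s - 1)"]) simp
qed

theorem is_zeta_zeta: "is_zeta zeta"
proof -
  obtain F where F: "is_zeta F" using is_zeta_exists ..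
  then have "zeta = F"
    unfolding zeta_def
    by (intro the_equality[of is_zeta F]) (simp_all add: is_zeta_unique[OF _ F])
  with F show ?thesis by simp
qed


subsection \<open>The functions $\xi$, $n$, $f$, $c$\<close>

definition afac :: "complex \<Rightarrow> complex" where
  "afac s = of_real pi powr (- s / 2) * s * Gamma (s / 2) * (s - 1)"

text \<open>
  The product has removable singularities at 1 and at the poles of \<open>Gamma (s / 2)\<close> (where
  HOL's \<open>Gamma\<close> is 0), so the entire function $\xi$ is obtained by taking limits there.
\<close>
definition xi :: "complex \<Rightarrow> complex" where
  "xi = remove_sings (\<lambda>s. 1 / 2 * afac s * zeta s)"

definition nfun :: "complex \<Rightarrow> complex" where
  "nfun s = sin (of_real pi * s / 4) * (2 * xi (1 / 2 + s))"

definition ffun :: "complex \<Rightarrow> complex" where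
  "ffun s = 1 / nfun s"

definition cfun :: "complex \<Rightarrow> complex" where
  "cfun z = 1 / deriv nfun z"

definition Z_i :: "complex set" where
  "Z_i = {s. zeta (1 / 2 + s) = 0 \<and> s \<notin> \<real>}"

definition Z_circ :: "complex set" where
  "Z_circ = range (\<lambda>w::int. 4 * of_int w) \<union> Z_i"


subsection \<open>Zeta ordinates\<close>

definition pos_ordinates :: "real set" where
  "pos_ordinates = {Im z | z. zeta z = 0 \<and> Im z > 0}"

definition ordinate_enum :: "nat \<Rightarrow> real" where
  "ordinate_enum = (THE g. strict_mono g \<and> range g = pos_ordinates)"

text \<open>Indexed by the nonzero integers; the value at 0 is never used.\<close>
definition gam :: "int \<Rightarrow> real" where
  "gam k = (if k > 0 then ordinate_enum (nat k - 1)
            else if k < 0 then - ordinate_enum (nat (- k) - 1) else 0)"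

text \<open>Neighbouring indices in the ordered set of nonzero integers.\<close>
definition next_index :: "int \<Rightarrow> int" where
  "next_index k = (if k = - 1 then 1 else k + 1)"

definition prev_index :: "int \<Rightarrow> int" where
  "prev_index k = (if k = 1 then - 1 else k - 1)"

definition delta :: "int \<Rightarrow> real" where
  "delta k = min \<bar>gam k - gam (prev_index k)\<bar> \<bar>gam k - gam (next_index k)\<bar>"

definition delta' :: "int \<Rightarrow> real" where
  "delta' k = min (1 / ln \<bar>gam k\<bar>) (delta k)"


subsection \<open>Partial fractions\<close>

definition p_r_term :: "complex \<Rightarrow> nat \<Rightarrow> complex" where
  "p_r_term s w = cfun (4 * of_nat w) * (1 / (s - 4 * of_nat w) + 1 / (s + 4 * of_nat w))"

definition p_i_term :: "complex \<Rightarrow> nat \<Rightarrow> complex" where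
  "p_i_term s k = cfun (\<i> * of_real (gam (int k)))
     * (1 / (s - \<i> * of_real (gam (int k))) + 1 / (s + \<i> * of_real (gam (int k))))"

text \<open>The sums run over indices \<open>\<ge> 1\<close>.\<close>
definition p_r :: "complex \<Rightarrow> complex" where
  "p_r s = cfun 0 / s + (\<Sum>w. p_r_term s (Suc w))"

definition p_i :: "complex \<Rightarrow> complex" where
  "p_i s = (\<Sum>k. p_i_term s (Suc k))"

definition pfun :: "complex \<Rightarrow> complex" where
  "pfun s = p_r s + p_i s"


subsection \<open>The hypothesis\<close>

definition RH :: bool where
  "RH \<longleftrightarrow> (\<forall>z. zeta z = 0 \<and> z \<notin> \<real> \<longrightarrow> Re z = 1 / 2)"

definition t1 :: "real \<Rightarrow> real" where
  "t1 \<alpha> = gam 1 - \<alpha> * delta' 1"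

text \<open>For $\alpha < 1/2$ there is at most one index \<open>k\<close> as in the definition.\<close>
definition x_path :: "real \<Rightarrow> real \<Rightarrow> real" where
  "x_path \<alpha> t =
     (if \<exists>k\<ge>1. \<bar>t - gam k\<bar> \<le> \<alpha> * delta' k
      then let k = (THE k. k \<ge> 1 \<and> \<bar>t - gam k\<bar> \<le> \<alpha> * delta' k)
           in sqrt ((\<alpha> * delta' k)\<^sup>2 - (t - gam k)\<^sup>2)
      else 0)"

definition s_path :: "real \<Rightarrow> real \<Rightarrow> complex" where
  "s_path \<alpha> t = Complex (x_path \<alpha> t) t"

definition C1_exponents :: "real \<Rightarrow> real set" where
  "C1_exponents \<alpha> = {\<epsilon>. \<epsilon> > 0 \<and>
     (\<exists>L>0. \<forall>t>t1 \<alpha>. cmod (zeta (1 / 2 + s_path \<alpha> t)) > L * t powr (- \<epsilon>))}"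

definition eps0 :: "real \<Rightarrow> real" where
  "eps0 \<alpha> = Inf (C1_exponents \<alpha>)"

definition C1 :: "real \<Rightarrow> bool" where
  "C1 \<alpha> \<longleftrightarrow> C1_exponents \<alpha> \<noteq> {} \<and> eps0 \<alpha> < 3 / 4"

text \<open>The shape of condition shared by the hypotheses (C3) and (C4).\<close>
definition admissible_exponent :: "(int \<Rightarrow> real) \<Rightarrow> real \<Rightarrow> bool" where
  "admissible_exponent q \<epsilon> \<longleftrightarrow> \<epsilon> \<ge> 0 \<and>
     (\<forall>\<sigma>>0. \<exists>K>0. \<forall>k\<ge>1. q k > K * gam k powr (- (\<epsilon> + \<sigma>)))"

definition least_exponent :: "(int \<Rightarrow> real) \<Rightarrow> real" where
  "least_exponent q = (LEAST \<epsilon>. admissible_exponent q \<epsilon>)"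

definition zeta_deriv_abs :: "int \<Rightarrow> real" where
  "zeta_deriv_abs k = cmod (deriv zeta (1 / 2 + \<i> * of_real (gam k)))"

definition eps1 :: real where
  "eps1 = least_exponent zeta_deriv_abs"

definition eps2 :: real where
  "eps2 = least_exponent delta"

definition C3 :: bool where
  "C3 \<longleftrightarrow> (\<exists>\<epsilon>. admissible_exponent zeta_deriv_abs \<epsilon>)
     \<and> (\<exists>\<epsilon>. admissible_exponent delta \<epsilon>)
     \<and> eps1 + eps2 < 3 / 4"

definition zeta_quotient :: "int \<Rightarrow> real \<Rightarrow> complex" where
  "zeta_quotient k t =
     (if t = gam k then deriv zeta (1 / 2 + \<i> * of_real (gam k))
      else zeta (1 / 2 + \<i> * of_real t) / of_real (t - gam k))"

text \<open>
  Under RH the modulus of the quotient is continuous on the compact interval, so that the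
  infimum is a minimum.
\<close>
definition j_min :: "real \<Rightarrow> int \<Rightarrow> real" where
  "j_min \<alpha> k = (INF t\<in>{t. \<bar>t - gam k\<bar> \<le> \<alpha> * delta' k}. cmod (zeta_quotient k t))"

definition eps1_tilde :: "real \<Rightarrow> real" where
  "eps1_tilde \<alpha> = least_exponent (j_min \<alpha>)"

definition C4 :: "real \<Rightarrow> bool" where
  "C4 \<alpha> \<longleftrightarrow> (\<exists>\<epsilon>. admissible_exponent (j_min \<alpha>) \<epsilon>) \<and> eps1_tilde \<alpha> + eps2 \<le> 1"

definition hypothesis_C :: bool where
  "hypothesis_C \<longleftrightarrow> (\<exists>\<alpha>. 0 < \<alpha> \<and> \<alpha> < 1 / 2 \<and> RH \<and> C1 \<alpha> \<and> C3 \<and> C4 \<alpha>)"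

end

theory Submission
  imports Defs "HOL-Real_Asymp.Real_Asymp"
begin

text \<open>
  Integrate \<open>ffun z / (z - s)\<close> over rectangles with vertical sides on \<open>Re z = \<plusminus>(4 N + 2)\<close> and horizontal
  sides at heights midway between consecutive ordinates. The residues give the partial sums of the
  expansion, so it suffices that \<open>nfun\<close> tends to infinity uniformly on the contours; this also yields
  convergence of the sum over the ordinates, without absolute convergence.

  The function \<open>xi (1/2 + s)\<close> is an entire function of \<open>s\<^sup>2\<close> of order \<open>1/2\<close>, hence a product of factors
  \<open>1 + s\<^sup>2 / \<gamma>\<^sup>2\<close> under RH. Its modulus therefore increases with \<open>|Re s|\<close>, and it is at least
  \<open>c |s|\<^sup>2\<close> where \<open>Re (s\<^sup>2) \<ge> 0\<close>, which settles the vertical sides. On a horizontal side it is at least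
  its value on the critical line, where (C1) applies because the midpoints lie outside the detours of
  the path; together with \<open>|\<Gamma>(1/4 + i y)| \<ge> c e\<^bsup>-\<pi>y/2\<^esup> / \<surd>(1 + y)\<close> the exponent \<open>3/4\<close> leaves room.

  The functional equation is proved at \<open>s = -a\<close>, \<open>0 < a < 1\<close>: there \<open>-zeta s\<close> is the sum of the errors of the
  trapezoidal rule for \<open>x\<^sup>a\<close>, which by Tonelli's theorem is a Mellin integral of \<open>coth (x/2) / 2 - 1/x\<close>,
  and the partial fractions of the hyperbolic cotangent turn it into \<open>zeta (1 + a)\<close>.
\<close>

subsection \<open>Integrals behind the functional equation\<close>

text \<open>The perimeter of the n-th rectangle and its distance from \<open>s\<close> are of the
  same order, so the remainder vanishes in the limit as soon as the minimum of
  \<open>cmod (nfun z)\<close> over the contour tends to infinity; no rate is required. At height T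
  the exponentials cancel: the sine gives exp(pi T / 4), the Gamma factor at 1/4 + i T/2 gives
  exp(-pi T / 4). There remain T^2 from s (s - 1), T^(-1/2) from the Gamma bound and T^(-3/4) from
  (C1), altogether T^(3/4).

  The functional equation enters through the evenness of \<open>xi (1/2 + s)\<close>. Only an even
  function is a function of s^2, and passing to s^2 brings the order below 1, so that the product
  over the zeros has no exponential factors and moduli can be compared factor by factor.

  Trapezoidal errors of the concave function x^a are non-negative, so sums and integrals are
  exchanged in \<open>ennreal\<close> without any domination. The price is a real parameter a; the
  identity theorem then supplies the complex arguments. Simplicity of the nonreal zeros is read off
  from the lower bound for zeta' in (C3).\<close>

lemma nn_integral_powr_exp:
  fixes b c k :: real
  assumes b: "b > 0" and c: "c > 0" and k: "k > 0"
  shows "(\<integral>\<^sup>+x. ennreal (x powr (b - 1) * exp (- (c * x powr k))) * indicator {0<..} x \<partial>lborel)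
         = ennreal (Gamma (b / k) / k * c powr (- b / k))"
proof -
  define p where "p = b / k"
  have p: "p > 0" using b k by (simp add: p_def)
  \<comment> \<open>The substitution t = c x^k in Euler's integral. The result is stated for
    non-negative integrals so that it can be inserted directly into Tonelli's theorem, with k = 1
    and k = 2.\<close>
  define g where "g = (\<lambda>x::real. c * x powr k)"
  define g' where "g' = (\<lambda>x::real. c * (k * x powr (k - 1)))"
  define f where "f = (\<lambda>t::real. t powr (p - 1) / exp t)"
  have img: "g ` {0<..} = {0<..}"
  proof -
    have "y \<in> g ` {0<..}" if "y > 0" for y
      by (rule image_eqI[of _ _ "(y / c) powr (1 / k)"]) (use that c k in \<open>auto simp: g_def powr_powr\<close>)
    then show ?thesis using c by (auto simp: g_def)
  qed
  have der: "(g has_field_derivative g' x) (at x within {0<..})" if "x \<in> {0<..}" for x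
    unfolding g_def g'_def using that by (auto intro!: derivative_eq_intros)
  have inj: "inj_on g {0<..}"
  proof (rule inj_on_inverseI)
    show "(g x / c) powr (1 / k) = x" if "x \<in> {0<..}" for x
      using that c k by (simp add: g_def powr_powr)
  qed
  have I: "(f has_integral Gamma p) {0<..}"
  proof -
    have "(f has_integral Gamma p) {0..}"
      using Gamma_integral_real[OF p] by (simp add: f_def)
    then show ?thesis
      by (rule has_integral_spike_set_eq[THEN iffD1, rotated -1]) (auto intro: negligible_subset[of "{0}"])
  qed
  have abs: "f absolutely_integrable_on {0<..}"
    using I by (intro nonnegative_absolutely_integrable_1) (auto simp: f_def)
  have "(\<lambda>x. \<bar>g' x\<bar> * f (g x)) absolutely_integrable_on {0<..} \<and>
        integral {0<..} (\<lambda>x. \<bar>g' x\<bar> * f (g x)) = Gamma p"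
    using has_absolute_integral_change_of_variables_1'[OF _ der inj, of f "Gamma p"] abs I img
    by (auto simp: integral_unique)
  then have "((\<lambda>x. \<bar>g' x\<bar> * f (g x)) has_integral Gamma p) {0<..}"
    by (metis integrable_integral set_lebesgue_integral_eq_integral(1))
  then have "((\<lambda>x. k * c powr p * (x powr (b - 1) * exp (- (c * x powr k)))) has_integral Gamma p) {0<..}"
  proof (rule has_integral_eq[rotated])
    fix x :: real assume "x \<in> {0<..}"
    then have x: "x > 0" by simp
    have kp: "k * p = b" using k by (simp add: p_def)
    have "\<bar>g' x\<bar> * f (g x) = c * k * x powr (k - 1) * ((c * x powr k) powr (p - 1)) * exp (- (c * x powr k))"
      using x c k by (simp add: g'_def g_def f_def exp_minus divide_simps)
    also have "(c * x powr k) powr (p - 1) = c powr (p - 1) * x powr (k * (p - 1))"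
      using x c by (simp add: powr_mult powr_powr)
    also have "c * k * x powr (k - 1) * (c powr (p - 1) * x powr (k * (p - 1))) * exp (- (c * x powr k))
       = k * (c * c powr (p - 1)) * (x powr (k - 1) * x powr (k * (p - 1))) * exp (- (c * x powr k))"
      by (simp add: mult_ac)
    also have "c * c powr (p - 1) = c powr p"
      using c by (simp add: powr_diff)
    also have "x powr (k - 1) * x powr (k * (p - 1)) = x powr (b - 1)"
      unfolding powr_add[symmetric] by (simp add: kp algebra_simps)
    finally show "\<bar>g' x\<bar> * f (g x) = k * c powr p * (x powr (b - 1) * exp (- (c * x powr k)))"
      by (simp add: mult_ac)
  qed
  then have "((\<lambda>x. 1 / (k * c powr p) * (k * c powr p * (x powr (b - 1) * exp (- (c * x powr k)))))
      has_integral 1 / (k * c powr p) * Gamma p) {0<..}"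
    by (rule has_integral_mult_right)
  then have *: "((\<lambda>x. x powr (b - 1) * exp (- (c * x powr k)))
      has_integral Gamma p / k * c powr (- p)) {0<..}"
    using c k by (simp add: powr_minus field_simps)
  then show ?thesis
    using nn_integral_has_integral_lebesgue'[OF _ *] by (simp add: p_def)
qed

text \<open>\<open>t (1 - t)\<close> is the Peano kernel of the trapezoidal rule.\<close>
lemma trapezoid_has_integral:
  fixes a x :: real
  assumes a: "0 < a" "a < 1" and x: "x \<ge> 0"
  shows "((\<lambda>t. t * (1 - t) * (x + t) powr (a - 2)) has_integral
           (2 * (((x + 1) powr (a + 1) - x powr (a + 1)) / (a + 1)) - (x powr a + (x + 1) powr a))
             / (a * (1 - a))) {0..1}"
proof -
  \<comment> \<open>Two integrations by parts of \<open>t * (1 - t)\<close> against the second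
    derivative of \<open>(x + t) powr a\<close> lead to this primitive of \<open>a * (a - 1)\<close>
    times the integrand.\<close>
  define P where "P = (\<lambda>t. a * (t * (1 - t)) * (x + t) powr (a - 1) - (1 - 2 * t) * (x + t) powr a
      - 2 * (x + t) powr (a + 1) / (a + 1))"
  have "((\<lambda>t. a * (a - 1) * (t * (1 - t) * (x + t) powr (a - 2))) has_integral (P 1 - P 0)) {0..1}"
  proof (rule fundamental_theorem_of_calculus_interior)
    have cB: "continuous_on {0..1} (\<lambda>t. (x + t) powr b)" if "b > 0" for b
      using that x by (intro continuous_on_powr' continuous_on_add continuous_on_const continuous_on_id) auto
    \<comment> \<open>For \<open>x = 0\<close> the power alone is unbounded near
      \<open>t = 0\<close>; together with the factor \<open>t\<close> it becomes
      \<open>t powr a\<close>. For the same reason the fundamental theorem is used in the form that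
      asks for derivatives only in the open interval.\<close>
    have "continuous_on {0..1} (\<lambda>t. t * (x + t) powr (a - 1))"
    proof (cases "x = 0")
      case True
      have "continuous_on {0..1} (\<lambda>t::real. t powr a)"
        using a by (intro continuous_on_powr' continuous_intros) auto
      then show ?thesis
        by (rule continuous_on_eq) (use True a in \<open>auto simp: powr_diff\<close>)
    next
      case False
      then show ?thesis using x by (intro continuous_intros) auto
    qed
    note cA = this
    have "continuous_on {0..1} (\<lambda>t. a * (1 - t) * (t * (x + t) powr (a - 1)) - (1 - 2 * t) * (x + t) powr a
      - 2 * (x + t) powr (a + 1) / (a + 1))"
      by (intro cA continuous_on_diff continuous_on_mult continuous_on_divide continuous_on_const
           continuous_on_id cB) (use a in auto)
    then show "continuous_on {0..1} P" unfolding P_def by (simp add: mult_ac)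
    fix t :: real assume t: "t \<in> {0<..<1}"
    then have xt: "x + t > 0" using x by auto
    have D: "((\<lambda>t. (x + t) powr b) has_real_derivative b * (x + t) powr (b - 1)) (at t)" for b
      using xt by (auto intro!: derivative_eq_intros)
    have D1: "((\<lambda>t. a * (t * (1 - t))) has_real_derivative a * (1 - 2 * t)) (at t)"
      by (auto intro!: derivative_eq_intros)
    have D2: "((\<lambda>t. 1 - 2 * t) has_real_derivative - 2) (at t)"
      by (auto intro!: derivative_eq_intros)
    have "(P has_real_derivative (a * (t * (1 - t)) * ((a - 1) * (x + t) powr (a - 1 - 1)) + a * (1 - 2 * t) * (x + t) powr (a - 1)
          - ((1 - 2 * t) * (a * (x + t) powr (a - 1)) + - 2 * (x + t) powr a)
          - 2 * ((a + 1) * (x + t) powr (a + 1 - 1)) / (a + 1))) (at t)"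
      unfolding P_def by (intro DERIV_diff DERIV_mult' DERIV_cdivide DERIV_cmult D D1 D2)
    also have "a * (t * (1 - t)) * ((a - 1) * (x + t) powr (a - 1 - 1)) + a * (1 - 2 * t) * (x + t) powr (a - 1)
          - ((1 - 2 * t) * (a * (x + t) powr (a - 1)) + - 2 * (x + t) powr a)
          - 2 * ((a + 1) * (x + t) powr (a + 1 - 1)) / (a + 1) = a * (a - 1) * (t * (1 - t) * (x + t) powr (a - 2))"
      using a by simp
    finally show "(P has_vector_derivative a * (a - 1) * (t * (1 - t) * (x + t) powr (a - 2))) (at t)"
      by (simp add: has_real_derivative_iff_has_vector_derivative)
  qed simp
  then have "((\<lambda>t. 1 / (a * (a - 1)) * (a * (a - 1) * (t * (1 - t) * (x + t) powr (a - 2))))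
      has_integral (1 / (a * (a - 1)) * (P 1 - P 0))) {0..1}"
    by (rule has_integral_mult_right)
  moreover have "1 / (a * (a - 1)) * (P 1 - P 0) = 
      (2 * (((x + 1) powr (a + 1) - x powr (a + 1)) / (a + 1)) - (x powr a + (x + 1) powr a))
             / (a * (1 - a))"
  proof -
    have "P 1 - P 0 = - (2 * (((x + 1) powr (a + 1) - x powr (a + 1)) / (a + 1)) - (x powr a + (x + 1) powr a))"
      using a by (simp add: P_def add_divide_distrib diff_divide_distrib algebra_simps)
    moreover have "a * (a - 1) = - (a * (1 - a))" by (simp add: algebra_simps)
    ultimately show ?thesis by (simp only: minus_divide_divide mult_1 times_divide_eq_left)
  qed
  ultimately show ?thesis using a by simp
qed

text \<open>The Peano kernel against an exponential. The numerator divided by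
  \<open>2 * x * (1 - exp (- x))\<close> is coth(x/2)/2 - 1/x, which is how the hyperbolic cotangent
  enters; being the integral of a non-negative function, the value is also non-negative.\<close>

lemma trapezoid_exp_has_integral:
  fixes x :: real
  assumes x: "x > 0"
  shows "((\<lambda>t. t * (1 - t) * exp (- (t * x))) has_integral
           (x * (1 + exp (- x)) - 2 * (1 - exp (- x))) / x ^ 3) {0..1}"
proof -
  define P where "P = (\<lambda>t. exp (- (t * x)) * (- (t * (1 - t)) / x - (1 - 2 * t) / x\<^sup>2 + 2 / x ^ 3))"
  have "((\<lambda>t. t * (1 - t) * exp (- (t * x))) has_integral (P 1 - P 0)) {0..1}"
  proof (rule fundamental_theorem_of_calculus)
    fix t :: real assume "t \<in> {0..1}"
    have "(P has_real_derivative t * (1 - t) * exp (- (t * x))) (at t within {0..1})"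
      unfolding P_def using x
      by (auto intro!: derivative_eq_intros simp: field_simps power2_eq_square power3_eq_cube)
    then show "(P has_vector_derivative t * (1 - t) * exp (- (t * x))) (at t within {0..1})"
      by (simp add: has_real_derivative_iff_has_vector_derivative)
  qed simp
  moreover have "P 1 - P 0 = (x * (1 + exp (- x)) - 2 * (1 - exp (- x))) / x ^ 3"
    using x by (simp add: P_def field_simps power2_eq_square power3_eq_cube)
  ultimately show ?thesis by simp
qed

text \<open>The logarithmic derivative of the product for sinh(x/2)/(x/2), which is the sine product
  at an imaginary argument. The right-hand side is coth(x/2)/2 - 1/x written in
  exponentials.\<close>

lemma coth_partial_fractions:
  fixes x :: real
  assumes "x > 0"
  shows "(\<lambda>n. 2 * x / (x\<^sup>2 + (2 * pi * real (Suc n))\<^sup>2)) sums ((1 + exp (- x)) / (2 * (1 - exp (- x))) - 1 / x)"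
proof -
  define f where "f = (\<lambda>n x. ln (1 + x\<^sup>2 / (2 * pi * real (Suc n))\<^sup>2))"
  define f' where "f' = (\<lambda>n x. 2 * x / (x\<^sup>2 + (2 * pi * real (Suc n))\<^sup>2))"
  define G where "G = (\<lambda>x::real. ln (sinh (x / 2) / (x / 2)))"
  have sinh_of_real: "sinh (complex_of_real v) = of_real (sinh v)" for v
    by (simp add: sinh_field_def flip: exp_of_real)
  have f_sums: "(\<lambda>n. f n y) sums G y" if y: "y > 0" for y
  proof -
    define P where "P = (\<lambda>n. \<Prod>k<n. 1 + y\<^sup>2 / (2 * pi * real (Suc k))\<^sup>2)"
    \<comment> \<open>With this \<open>z\<close> the factor 1 - z^2/k^2 equals 1 + y^2/(2 pi k)^2,
      and sin(pi z) = i sinh(y/2).\<close>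
    define z where "z = \<i> * of_real (y / (2 * pi))"
    have "(\<lambda>n. of_real pi * z * (\<Prod>k=1..n. 1 - z ^ 2 / of_nat k ^ 2)) \<longlonglongrightarrow> sin (of_real pi * z)"
      by (rule sin_product_formula_complex)
    moreover have "(\<Prod>k=1..n. 1 - z ^ 2 / of_nat k ^ 2) = of_real (P n)" for n
    proof -
      have "(\<Prod>k=1..n. 1 - z ^ 2 / of_nat k ^ 2) = (\<Prod>k<n. 1 - z ^ 2 / of_nat (Suc k) ^ 2)"
        by (rule prod.reindex_bij_witness[of _ Suc "\<lambda>k. k - 1"]) auto
      also have "\<dots> = of_real (P n)"
        by (simp add: P_def z_def power_mult_distrib power_divide del: of_nat_Suc)
      finally show ?thesis .
    qed
    moreover have "of_real pi * z = \<i> * of_real (y / 2)" by (simp add: z_def)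
    ultimately have "(\<lambda>n. \<i> * of_real (y / 2) * of_real (P n)) \<longlonglongrightarrow> sin (\<i> * of_real (y / 2))" by simp
    from tendsto_mult_left[OF this, of "-\<i>"]
    have "(\<lambda>n. complex_of_real (y / 2 * P n)) \<longlonglongrightarrow> sinh (complex_of_real (y / 2))"
      by (simp add: sinh_conv_sin mult.assoc[symmetric])
    then have "(\<lambda>n. complex_of_real (y / 2 * P n)) \<longlonglongrightarrow> of_real (sinh (y / 2))"
      by (simp only: sinh_of_real)
    then have "(\<lambda>n. y / 2 * P n) \<longlonglongrightarrow> sinh (y / 2)" by (subst (asm) tendsto_of_real_iff)
    from tendsto_divide[OF this tendsto_const[of "y / 2"]]
    have "P \<longlonglongrightarrow> sinh (y / 2) / (y / 2)" using y by simp
    then have "(\<lambda>n. ln (P n)) \<longlonglongrightarrow> G y"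
      unfolding G_def using y by (intro tendsto_ln) auto
    moreover have "ln (P n) = (\<Sum>k<n. f k y)" for n
    proof -
      have "1 + y\<^sup>2 / (2 * pi * real (Suc k))\<^sup>2 > 0" for k by (intro add_pos_nonneg) auto
      then show ?thesis unfolding P_def f_def by (intro ln_prod) (simp, metis less_irrefl)
    qed
    ultimately show ?thesis by (simp add: sums_def)
  qed
  \<comment> \<open>The interval is bounded so that the numerator \<open>2 * y\<close> of the
    derivatives has a bound and the Weierstrass test applies.\<close>
  define S where "S = {0<..<x + 1}"
  have "uniformly_convergent_on S (\<lambda>n x. \<Sum>i<n. f' i x)"
  proof (rule Weierstrass_m_test')
    show "norm (f' n y) \<le> 2 * (x + 1) * (1 / real (Suc n) ^ 2)" if "y \<in> S" for n y
    proof -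
      have y: "0 < y" "y < x + 1" using that by (auto simp: S_def)
      have "(1 * real (Suc n))\<^sup>2 \<le> (2 * pi * real (Suc n))\<^sup>2"
        using pi_gt3 by (intro power_mono mult_right_mono) auto
      also have "\<dots> \<le> y\<^sup>2 + (2 * pi * real (Suc n))\<^sup>2" by simp
      finally have "2 * y / (y\<^sup>2 + (2 * pi * real (Suc n))\<^sup>2) \<le> 2 * (x + 1) / (real (Suc n))\<^sup>2"
        using y by (intro frac_le) auto
      then show ?thesis using y by (simp add: f'_def)
    qed
    have "summable (\<lambda>n. 1 / real (Suc n) ^ 2)"
      using inverse_power_summable[of 2, where ?'a = real] 
      by (subst summable_Suc_iff) (simp add: field_simps)
    then show "summable (\<lambda>n. 2 * (x + 1) * (1 / real (Suc n) ^ 2))" by (rule summable_mult)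
  qed
  then have ul: "uniform_limit S (\<lambda>n x. \<Sum>i<n. f' i x) (\<lambda>x. \<Sum>i. f' i x) sequentially"
    by (simp add: uniformly_convergent_uniform_limit_iff suminf_eq_lim)
  have xS: "x \<in> S" using assms by (simp add: S_def)
  obtain g where g: "\<And>y. y \<in> S \<Longrightarrow> (\<lambda>n. f n y) sums g y"
      "\<And>y. y \<in> S \<Longrightarrow> (g has_field_derivative (\<Sum>i. f' i y)) (at y within S)"
  proof -
    have "\<exists>g. \<forall>y\<in>S. (\<lambda>n. f n y) sums g y \<and> (g has_field_derivative (\<Sum>i. f' i y)) (at y within S)"
    proof (rule has_field_derivative_series[OF _ _ ul xS])
      show "convex S" by (simp add: S_def)
      show "(f n has_field_derivative f' n y) (at y within S)" if "y \<in> S" for n y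
      proof -
        define c where "c = (2 * pi * real (Suc n))\<^sup>2"
        have c: "c > 0" by (simp add: c_def)
        then have p: "1 + y\<^sup>2 / c > 0" "y\<^sup>2 + c > 0" by (simp_all add: add_pos_nonneg add_nonneg_pos)
        have "((\<lambda>y. ln (1 + y\<^sup>2 / c)) has_field_derivative (2 * y / c) / (1 + y\<^sup>2 / c)) (at y within S)"
          using p c by (auto intro!: derivative_eq_intros)
        also have "(2 * y / c) / (1 + y\<^sup>2 / c) = 2 * y / (y\<^sup>2 + c)"
          using p c by (simp add: field_simps)
        finally show ?thesis by (simp add: f_def f'_def c_def)
      qed
      show "summable (\<lambda>n. f n x)" using f_sums[OF assms] by (rule sums_summable)
    qed
    then show ?thesis using that by blast
  qed
  have gG: "g y = G y" if "y \<in> S" for y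
    using g(1)[OF that] f_sums[of y] that by (auto simp: S_def intro: sums_unique2)
  have opS: "open S" by (simp add: S_def)
  have "(G has_field_derivative (\<Sum>i. f' i x)) (at x)"
    using g(2)[OF xS] unfolding at_within_open[OF xS opS]
    by (rule has_field_derivative_transform_within_open[OF _ opS xS gG])
  moreover have "(G has_field_derivative (cosh (x / 2) / (2 * sinh (x / 2)) - 1 / x)) (at x)"
  proof -
    have "sinh (x / 2) > 0" using assms by simp
    have "(G has_field_derivative ((cosh (x / 2) / 2 * (x / 2) - sinh (x / 2) * (1 / 2)) / (x / 2 * (x / 2))) /
        (sinh (x / 2) / (x / 2))) (at x)"
      unfolding G_def using assms by (auto intro!: derivative_eq_intros simp: mult_ac)
    also have "((cosh (x / 2) / 2 * (x / 2) - sinh (x / 2) * (1 / 2)) / (x / 2 * (x / 2))) /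
        (sinh (x / 2) / (x / 2)) = cosh (x / 2) / (2 * sinh (x / 2)) - 1 / x"
    proof -
      have "((C / 2 * (x / 2) - S * (1 / 2)) / (x / 2 * (x / 2))) / (S / (x / 2)) = C / (2 * S) - 1 / x"
        if "S > 0" for C S :: real
        using assms that by (simp add: divide_simps)
      then show ?thesis using \<open>sinh (x / 2) > 0\<close> by blast
    qed
    finally show ?thesis .
  qed
  ultimately have "(\<Sum>i. f' i x) = cosh (x / 2) / (2 * sinh (x / 2)) - 1 / x"
    by (rule DERIV_unique)
  also have "cosh (x / 2) / (2 * sinh (x / 2)) = (1 + exp (- x)) / (2 * (1 - exp (- x)))"
  proof -
    define q P where "q = exp (- (x / 2))" and "P = exp (x / 2)"
    have q: "q > 0" and Pq: "q * P = 1" "q * q = exp (- x)"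
      by (simp_all add: q_def P_def flip: exp_add)
    have "cosh (x / 2) = (P + q) / 2" "sinh (x / 2) = (P - q) / 2"
      by (simp_all add: cosh_def sinh_def P_def q_def)
    then have "cosh (x / 2) / (2 * sinh (x / 2)) = ((P + q) / 2) / (2 * ((P - q) / 2))" by (simp only:)
    also have "2 * ((P - q) / 2) = P - q" by simp
    also have "((P + q) / 2) / (P - q) = (P + q) / (2 * (P - q))" by (simp only: divide_divide_eq_left)
    also have "\<dots> = (q * (P + q)) / (q * (2 * (P - q)))" using q by simp
    also have "q * (P + q) = 1 + exp (- x)" using Pq by (simp add: ring_distribs)
    also have "q * (2 * (P - q)) = 2 * (1 - exp (- x))" using Pq by (simp add: right_diff_distrib)
    finally show ?thesis .
  qed
  moreover have "summable (\<lambda>i. f' i x)"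
  proof -
    have "(\<lambda>n. \<Sum>i<n. f' i x) \<longlonglongrightarrow> (\<Sum>i. f' i x)" using tendsto_uniform_limitI[OF ul xS] .
    then show ?thesis by (auto simp: summable_def sums_def)
  qed
  ultimately show ?thesis unfolding f'_def by (simp add: sums_iff)
qed

text \<open>Replacing 1/(x^2 + c^2) by the integral of exp(-u (x^2 + c^2)) over u > 0 and exchanging
  the integrals leaves a Gamma integral in x followed by one in u.\<close>

lemma nn_integral_powr_over_square:
  fixes a c :: real
  assumes a: "0 < a" "a < 1" and c: "c > 0"
  shows "(\<integral>\<^sup>+x. ennreal (x powr (- a) / (x\<^sup>2 + c\<^sup>2)) * indicator {0<..} x \<partial>lborel)
         = ennreal (Gamma ((1 - a) / 2) * Gamma ((1 + a) / 2) / 2 * c powr (- a - 1))"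
proof -
  define F where "F = (\<lambda>u x::real. ennreal (x powr (- a) * exp (- (u * x\<^sup>2)) * exp (- (c\<^sup>2 * u))) *
      indicator {0<..} u * indicator {0<..} x)"
  have [measurable]: "case_prod F \<in> borel_measurable (lborel \<Otimes>\<^sub>M lborel)"
    unfolding F_def by measurable
  have "(\<integral>\<^sup>+x. \<integral>\<^sup>+u. F u x \<partial>lborel \<partial>lborel) = 
     (\<integral>\<^sup>+x. ennreal (x powr (- a) / (x\<^sup>2 + c\<^sup>2)) * indicator {0<..} x \<partial>lborel)"
  proof (rule nn_integral_cong)
    fix x :: real
    show "(\<integral>\<^sup>+u. F u x \<partial>lborel) = ennreal (x powr (- a) / (x\<^sup>2 + c\<^sup>2)) * indicator {0<..} x"
    proof (cases "x > 0")
      case True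
      have pos: "x\<^sup>2 + c\<^sup>2 > 0" using c by (simp add: add_nonneg_pos)
      have "(\<integral>\<^sup>+u. F u x \<partial>lborel) = (\<integral>\<^sup>+u. ennreal (x powr (- a)) * (ennreal (u powr (1 - 1) * exp (- ((x\<^sup>2 + c\<^sup>2) * u powr 1))) * indicator {0<..} u) \<partial>lborel)"
        by (rule nn_integral_cong)
           (use True in \<open>auto simp: F_def indicator_def ennreal_mult'[symmetric] ring_distribs exp_add exp_diff exp_minus field_simps\<close>)
      also have "\<dots> = ennreal (x powr (- a)) * ennreal (Gamma (1 / 1) / 1 * (x\<^sup>2 + c\<^sup>2) powr (- 1 / 1))"
        by (subst nn_integral_cmult, measurable) (subst nn_integral_powr_exp, use pos in auto)
      also have "\<dots> = ennreal (x powr (- a) / (x\<^sup>2 + c\<^sup>2))"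
        using pos by (simp add: ennreal_mult'[symmetric] powr_minus divide_inverse)
      finally show ?thesis using True by simp
    qed (simp add: F_def)
  qed
  moreover have "(\<integral>\<^sup>+x. \<integral>\<^sup>+u. F u x \<partial>lborel \<partial>lborel) = (\<integral>\<^sup>+u. \<integral>\<^sup>+x. F u x \<partial>lborel \<partial>lborel)"
    by (rule lborel_pair.Fubini') measurable
  moreover have "(\<integral>\<^sup>+u. \<integral>\<^sup>+x. F u x \<partial>lborel \<partial>lborel)
      = (\<integral>\<^sup>+u. ennreal (Gamma ((1 - a) / 2) / 2) * 
           (ennreal (u powr ((1 + a) / 2 - 1) * exp (- (c\<^sup>2 * u powr 1))) * indicator {0<..} u) \<partial>lborel)"
  proof (rule nn_integral_cong)
    fix u :: real
    show "(\<integral>\<^sup>+x. F u x \<partial>lborel) = ennreal (Gamma ((1 - a) / 2) / 2) * 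
           (ennreal (u powr ((1 + a) / 2 - 1) * exp (- (c\<^sup>2 * u powr 1))) * indicator {0<..} u)"
    proof (cases "u > 0")
      case True
      have "(\<integral>\<^sup>+x. F u x \<partial>lborel) = (\<integral>\<^sup>+x. ennreal (exp (- (c\<^sup>2 * u))) * (ennreal (x powr ((1 - a) - 1) * exp (- (u * x powr 2))) * indicator {0<..} x) \<partial>lborel)"
        by (rule nn_integral_cong)
           (use True in \<open>auto simp: F_def indicator_def ennreal_mult'[symmetric] mult_ac\<close>)
      also have "\<dots> = ennreal (exp (- (c\<^sup>2 * u))) * ennreal (Gamma ((1 - a) / 2) / 2 * u powr (- (1 - a) / 2))"
        by (subst nn_integral_cmult, measurable) (subst nn_integral_powr_exp, use a True in auto)
      also have "- (1 - a) / 2 = (1 + a) / 2 - 1" by (simp add: field_simps)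
      finally show ?thesis using True a
        by (simp add: ennreal_mult'[symmetric] mult_ac Gamma_real_nonneg)
    qed (simp add: F_def)
  qed
  moreover have "\<dots> = ennreal (Gamma ((1 - a) / 2) / 2) * ennreal (Gamma ((1 + a) / 2 / 1) / 1 * (c\<^sup>2) powr (- ((1 + a) / 2) / 1))"
    by (subst nn_integral_cmult, measurable) (subst nn_integral_powr_exp, use a c in auto)
  moreover have "(c\<^sup>2) powr (- ((1 + a) / 2) / 1) = c powr (- a - 1)"
  proof -
    have "c\<^sup>2 = c powr 2" using c by simp
    moreover have "2 * (- ((1 + a) / 2) / 1) = - a - 1" by (simp add: field_simps)
    ultimately show ?thesis by (simp only: powr_powr)
  qed
  ultimately show ?thesis using a
    by (simp add: ennreal_mult'[symmetric] Gamma_real_nonneg mult_ac)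
qed

text \<open>The interval [0, 1] is included (\<open>n = 0\<close>): its error cancels the rational
  term that a summation from 1 leaves behind.\<close>

definition trapezoid_error :: "real \<Rightarrow> nat \<Rightarrow> real" where
  "trapezoid_error a n = (real (Suc n) powr (a + 1) - real n powr (a + 1)) / (a + 1)
     - (real n powr a + real (Suc n) powr a) / 2"

text \<open>Both sides are the integral over x > 0 of
  \<open>x powr (1 - a) * K x / (1 - exp (- x))\<close>. On the left, the power of
  \<open>n + t\<close> is a Mellin integral and the sum over n a geometric series; on the right, the
  integrand is expanded by the partial fractions of the hyperbolic cotangent.\<close>

lemma suminf_trapezoid_error:
  fixes a :: real
  assumes a: "0 < a" "a < 1"
  shows "(\<Sum>n. ennreal (Gamma (2 - a) * (2 * trapezoid_error a n / (a * (1 - a))))) =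
         (\<Sum>n. ennreal (2 * Gamma ((1 - a) / 2) * Gamma ((1 + a) / 2) * (2 * pi * real (Suc n)) powr (- a - 1)))"
proof -
  define F where "F = (\<lambda>n t x::real. ennreal (t * (1 - t) * x powr (1 - a) * exp (- ((real n + t) * x))) *
      indicator {0..1} t * indicator {0<..} x)"
  define K where "K = (\<lambda>x::real. (x * (1 + exp (- x)) - 2 * (1 - exp (- x))) / x ^ 3)"
  have [measurable]: "case_prod (F n) \<in> borel_measurable (lborel \<Otimes>\<^sub>M lborel)" for n
    unfolding F_def by measurable
  have 1: "(\<integral>\<^sup>+t. \<integral>\<^sup>+x. F n t x \<partial>lborel \<partial>lborel) = ennreal (Gamma (2 - a) * (2 * trapezoid_error a n / (a * (1 - a))))" for n
  proof -
    have "(\<integral>\<^sup>+x. F n t x \<partial>lborel) = ennreal (Gamma (2 - a) * (t * (1 - t) * (real n + t) powr (a - 2))) * indicator {0..1} t" for t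
    \<comment> \<open>The point \<open>t = 0\<close> is separated because \<open>n + t\<close>, the
      rate of the exponential, may vanish there; the kernel is 0 at that point.\<close>
    proof (cases "t \<in> {0<..1}")
      case True
      then have c: "real n + t > 0" by auto
      have "(\<integral>\<^sup>+x. F n t x \<partial>lborel) = (\<integral>\<^sup>+x. ennreal (t * (1 - t)) *
          (ennreal (x powr ((2 - a) - 1) * exp (- ((real n + t) * x powr 1))) * indicator {0<..} x) \<partial>lborel)"
        by (rule nn_integral_cong)
           (use True in \<open>auto simp: F_def indicator_def ennreal_mult'[symmetric] mult_ac\<close>)
      also have "\<dots> = ennreal (t * (1 - t)) * ennreal (Gamma ((2 - a) / 1) / 1 * (real n + t) powr (- (2 - a) / 1))"
        by (subst nn_integral_cmult, measurable) (subst nn_integral_powr_exp, use a c in auto)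
      also have "\<dots> = ennreal (Gamma (2 - a) * (t * (1 - t) * (real n + t) powr (a - 2)))"
        using True by (simp add: ennreal_mult'[symmetric] mult_ac)
      finally show ?thesis using True by (simp add: indicator_def)
    next
      case False
      then have "F n t x = 0" for x by (auto simp: F_def indicator_def)
      with False show ?thesis by (auto simp: indicator_def)
    qed
    then have "(\<integral>\<^sup>+t. \<integral>\<^sup>+x. F n t x \<partial>lborel \<partial>lborel) =
       (\<integral>\<^sup>+t. ennreal (Gamma (2 - a) * (t * (1 - t) * (real n + t) powr (a - 2))) * indicator {0..1} t \<partial>lborel)"
      by simp
    also have "\<dots> = ennreal (Gamma (2 - a) * ((2 * (((real n + 1) powr (a + 1) - real n powr (a + 1)) / (a + 1)) - (real n powr a + (real n + 1) powr a))
             / (a * (1 - a))))"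
      using a by (intro nn_integral_has_integral_lebesgue' has_integral_mult_right trapezoid_has_integral)
        (auto simp: Gamma_real_nonneg)
    also have "2 * (((real n + 1) powr (a + 1) - real n powr (a + 1)) / (a + 1)) - (real n powr a + (real n + 1) powr a)
        = 2 * trapezoid_error a n"
    proof -
      have "2 * y - z = 2 * (y - z / 2)" for y z :: real by simp
      then show ?thesis unfolding trapezoid_error_def of_nat_Suc add.commute[of 1] .
    qed
    finally show ?thesis .
  qed
  have K_nonneg: "K x \<ge> 0" if "x > 0" for x
    using has_integral_nonneg[OF trapezoid_exp_has_integral[OF that]] by (simp add: K_def)
  have exp_split: "exp (- ((real n + t) * x)) = exp (- x) ^ n * exp (- (t * x))" for n t x
    by (simp add: exp_of_nat_mult[symmetric] exp_add[symmetric] algebra_simps)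
  have 2: "(\<integral>\<^sup>+t. F n t x \<partial>lborel) = ennreal (x powr (1 - a) * K x * exp (- x) ^ n) * indicator {0<..} x" for n x
  proof (cases "x > 0")
    case True
    have "(\<integral>\<^sup>+t. F n t x \<partial>lborel) = (\<integral>\<^sup>+t. ennreal (x powr (1 - a) * exp (- x) ^ n) *
          (ennreal (t * (1 - t) * exp (- (t * x))) * indicator {0..1} t) \<partial>lborel)"
      by (rule nn_integral_cong)
         (simp only: F_def exp_split, use True in \<open>auto simp: indicator_def ennreal_mult'[symmetric] mult_ac\<close>)
    also have "\<dots> = ennreal (x powr (1 - a) * exp (- x) ^ n) * ennreal (K x)"
      using nn_integral_has_integral_lebesgue'[OF _ trapezoid_exp_has_integral[OF True]]
      by (subst nn_integral_cmult, measurable) (simp add: K_def)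
    finally show ?thesis using True K_nonneg[OF True] by (simp add: ennreal_mult'[symmetric] mult_ac)
  qed (simp add: F_def)
  have 3: "(\<Sum>n. \<integral>\<^sup>+t. F n t x \<partial>lborel) =
     (\<Sum>n. ennreal (4 * (x powr (- a) / (x\<^sup>2 + (2 * pi * real (Suc n))\<^sup>2))) * indicator {0<..} x)" for x
  proof (cases "x > 0")
    case True
    define q where "q = exp (- x)"
    have q: "0 < q" "q < 1" using True by (auto simp: q_def)
    have "(\<lambda>n. x powr (1 - a) * K x * q ^ n) sums (x powr (1 - a) * K x * (1 / (1 - q)))"
      using q by (intro sums_mult geometric_sums) auto
    then have "(\<Sum>n. ennreal (x powr (1 - a) * K x * q ^ n)) = ennreal (x powr (1 - a) * K x * (1 / (1 - q)))"
      using q K_nonneg[OF True] by (intro suminf_ennreal_eq) auto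
    also have "x powr (1 - a) * K x * (1 / (1 - q)) = 2 * x powr (- a - 1) * ((1 + q) / (2 * (1 - q)) - 1 / x)"
    proof -
      have e1: "x powr (1 - a) = x powr (- a - 1) * x\<^sup>2"
        using True by (simp add: powr_diff powr_minus field_simps power2_eq_square)
      have e2: "(1 + q) / (2 * (1 - q)) - 1 / x = (x * (1 + q) - 2 * (1 - q)) / (2 * x * (1 - q))"
        using True q by (simp add: divide_simps)
      have e3: "x * (1 + q) - 2 * (1 - q) = x ^ 3 * K x"
        using True by (simp add: K_def q_def)
      have "2 * Y * (x ^ 3 * k / (2 * x * (1 - q))) = Y * x\<^sup>2 * k * (1 / (1 - q))" for Y k
        using True q by (simp add: divide_simps power2_eq_square power3_eq_cube)
      then show ?thesis unfolding e1 e2 e3 by (rule sym)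
    qed
    also have "ennreal \<dots> = (\<Sum>n. ennreal (2 * x powr (- a - 1) * (2 * x / (x\<^sup>2 + (2 * pi * real (Suc n))\<^sup>2))))"
      using True unfolding q_def
      by (intro suminf_ennreal_eq[symmetric] sums_mult coth_partial_fractions) auto
    finally have "(\<Sum>n. ennreal (x powr (1 - a) * K x * q ^ n)) =
        (\<Sum>n. ennreal (2 * x powr (- a - 1) * (2 * x / (x\<^sup>2 + (2 * pi * real (Suc n))\<^sup>2))))" .
    moreover have "x powr (- a - 1) * x = x powr (- a)"
      using True by (simp add: powr_diff)
    ultimately show ?thesis unfolding 2 using True by (simp add: q_def)
  qed (simp add: F_def)
  have "(\<Sum>n. ennreal (Gamma (2 - a) * (2 * trapezoid_error a n / (a * (1 - a))))) =
    (\<Sum>n. \<integral>\<^sup>+x. \<integral>\<^sup>+t. F n t x \<partial>lborel \<partial>lborel)"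
    unfolding 1[symmetric] by (intro suminf_cong lborel_pair.Fubini'[symmetric]) measurable
  also have "\<dots> = (\<integral>\<^sup>+x. (\<Sum>n. \<integral>\<^sup>+t. F n t x \<partial>lborel) \<partial>lborel)"
    by (rule nn_integral_suminf[symmetric]) measurable
  also have "\<dots> = (\<integral>\<^sup>+x. (\<Sum>n. ennreal (4 * (x powr (- a) / (x\<^sup>2 + (2 * pi * real (Suc n))\<^sup>2))) * indicator {0<..} x) \<partial>lborel)"
    unfolding 3 ..
  also have "\<dots> = (\<Sum>n. \<integral>\<^sup>+x. ennreal (4 * (x powr (- a) / (x\<^sup>2 + (2 * pi * real (Suc n))\<^sup>2))) * indicator {0<..} x \<partial>lborel)"
    by (rule nn_integral_suminf) measurable
  also have "\<dots> = (\<Sum>n. ennreal (2 * Gamma ((1 - a) / 2) * Gamma ((1 + a) / 2) * (2 * pi * real (Suc n)) powr (- a - 1)))"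
  proof (rule suminf_cong)
    fix n
    have "(\<integral>\<^sup>+x. ennreal (4 * (x powr (- a) / (x\<^sup>2 + (2 * pi * real (Suc n))\<^sup>2))) * indicator {0<..} x \<partial>lborel)
      = (\<integral>\<^sup>+x. 4 * (ennreal (x powr (- a) / (x\<^sup>2 + (2 * pi * real (Suc n))\<^sup>2)) * indicator {0<..} x) \<partial>lborel)"
      by (rule nn_integral_cong) (simp only: ennreal_mult' ennreal_numeral mult.assoc)
    also have "\<dots> = 4 * ennreal (Gamma ((1 - a) / 2) * Gamma ((1 + a) / 2) / 2 * (2 * pi * real (Suc n)) powr (- a - 1))"
      by (subst nn_integral_cmult, measurable) (subst nn_integral_powr_over_square, use a in auto)
    also have "\<dots> = ennreal (2 * Gamma ((1 - a) / 2) * Gamma ((1 + a) / 2) * (2 * pi * real (Suc n)) powr (- a - 1))"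
      by (subst ennreal_numeral[symmetric], subst ennreal_mult'[symmetric]) (auto simp: mult_ac simp del: ennreal_numeral)
    finally show "(\<integral>\<^sup>+x. ennreal (4 * (x powr (- a) / (x\<^sup>2 + (2 * pi * real (Suc n))\<^sup>2))) * indicator {0<..} x \<partial>lborel)
      = ennreal (2 * Gamma ((1 - a) / 2) * Gamma ((1 + a) / 2) * (2 * pi * real (Suc n)) powr (- a - 1))" .
  qed
  finally show ?thesis .
qed

section \<open>Trapezoidal errors of complex powers\<close>

text \<open>In this combination of Taylor remainders the powers
  \<open>of_nat (Suc n) powr (- s - 1)\<close> cancel, which leaves \<open>1 - s\<close> times the
  trapezoidal error of x^(-s) on [n + 1, n + 2]. Writing it through \<open>zeta_rem\<close> makes
  \<open>zeta_rem_bound\<close> available, with decay n^(-Re s - 2), so the series converges for Re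
  s > -1.\<close>

definition zeta_err :: "nat \<Rightarrow> complex \<Rightarrow> complex" where
  "zeta_err n s = zeta_rem 2 n s - (1 - s) / 2 * zeta_rem 1 n (s + 1)"

lemma zeta_err_eq:
  "zeta_err n s = of_nat (Suc (Suc n)) powr (1 - s) - of_nat (Suc n) powr (1 - s)
     - (1 - s) * (of_nat (Suc n) powr (- s) + of_nat (Suc (Suc n)) powr (- s)) / 2"
proof -
  have sum2: "(\<Sum>k\<le>2. g k) = g 0 + g 1 + g 2" and sum1: "(\<Sum>k\<le>1. g k) = g 0 + g 1" for g :: "nat \<Rightarrow> complex"
    by (simp_all add: numeral_2_eq_2)
  have exps: "1 - s - of_nat 0 = 1 - s" "1 - s - of_nat 1 = - s" "1 - s - of_nat 2 = - s - 1"
    "1 - (s + 1) = - s" "- s - of_nat 0 = - s" "- s - of_nat 1 = - s - 1"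
    by simp_all
  have fall: "falling 0 s = 1" "falling 1 s = 1 - s" "falling 2 s = (1 - s) * - s"
    "(\<Prod>j<0. - s - of_nat j) = 1" "(\<Prod>j<1. - s - of_nat j) = - s"
    by (simp_all add: numeral_2_eq_2)
  have "fact 0 = (1::complex)" "fact 1 = (1::complex)" "fact 2 = (2::complex)" by simp_all
  then show ?thesis
    unfolding zeta_err_def zeta_rem_def sum1 sum2 exps fall by (simp add: field_simps)
qed

text \<open>The two remainders contribute one half each, from \<open>fact 2\<close> and from the
  factor \<open>(1 - s) / 2\<close>. The cubic polynomial in s returns in the growth estimate
  \<open>zeta_reg_bound\<close>.\<close>

lemma zeta_err_bound:
  assumes "Re s > - 1"
  shows "cmod (zeta_err n s) \<le> (cmod (1 - s) * cmod s * cmod (1 + s)) * real (Suc n) powr (- (Re s + 2))"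
proof -
  have "cmod (zeta_err n s) \<le> cmod (zeta_rem 2 n s) + cmod ((1 - s) / 2 * zeta_rem 1 n (s + 1))"
    unfolding zeta_err_def by (rule norm_triangle_ineq4)
  also have "cmod (zeta_rem 2 n s) \<le> cmod (falling (Suc 2) s) * real (Suc n) powr (- (Re s + real 2)) / fact 2"
    using assms by (intro zeta_rem_bound) auto
  also have "falling (Suc 2) s = (1 - s) * (-s) * (- (1 + s))"
    by (simp add: numeral_2_eq_2 lessThan_Suc algebra_simps)
  also have "cmod ((1 - s) / 2 * zeta_rem 1 n (s + 1)) \<le> 
      cmod ((1 - s) / 2) * (cmod (falling (Suc 1) (s + 1)) * real (Suc n) powr (- (Re (s + 1) + real 1)) / fact 1)"
    unfolding norm_mult using assms by (intro mult_left_mono zeta_rem_bound) auto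
  also have "falling (Suc 1) (s + 1) = (- s) * (- (1 + s))"
    by (simp add: lessThan_Suc algebra_simps)
  also have "cmod ((1 - s) * (-s) * (- (1 + s))) = cmod (1 - s) * cmod s * cmod (1 + s)"
    by (simp only: norm_mult norm_minus_cancel)
  also have "cmod ((- s) * (- (1 + s))) = cmod s * cmod (1 + s)"
    by (simp only: norm_mult norm_minus_cancel)
  finally show ?thesis by (simp add: norm_divide mult_ac add_ac)
qed

subsection \<open>Continuation of zeta and the functional equation\<close>

lemma zeta_err_series:
  obtains R where "R holomorphic_on {s. Re s > - 1}" "\<And>s. Re s > - 1 \<Longrightarrow> (\<lambda>n. zeta_err n s) sums R s"
proof -
  let ?S = "{s. Re s > - 1}"
  have "open ?S" by (rule open_halfspace_Re_gt)
  obtain R where R: "\<forall>s\<in>?S. ((\<lambda>n. zeta_err n s) sums R s) \<and> R field_differentiable (at s)"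
  proof (rule series_differentiable_comparison_complex[OF \<open>open ?S\<close>])
    show "zeta_err n field_differentiable at s" if "s \<in> ?S" for n s
    proof -
      have "(\<lambda>s. zeta_err n s) holomorphic_on UNIV"
        unfolding zeta_err_eq by (intro holomorphic_intros) auto
      then show ?thesis by (simp add: holomorphic_on_def)
    qed
    fix s assume s: "s \<in> ?S"
    \<comment> \<open>In the ball of radius \<open>d\<close> the exponent \<open>Re y + 2\<close>
      stays at least \<open>1 + d\<close>, which makes the majorant summable.\<close>
    define d where "d = (Re s + 1) / 2"
    have d: "d > 0" using s by (simp add: d_def)
    have "continuous_on (cball s d) (\<lambda>s. cmod (1 - s) * cmod s * cmod (1 + s))"
      by (intro continuous_intros)
    then have "bounded ((\<lambda>s. cmod (1 - s) * cmod s * cmod (1 + s)) ` cball s d)"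
      by (intro compact_imp_bounded compact_continuous_image) auto
    then obtain B where B: "B > 0" "\<And>y. y \<in> cball s d \<Longrightarrow> norm (cmod (1 - y) * cmod y * cmod (1 + y)) \<le> B"
      unfolding bounded_pos by blast
    define h where "h = (\<lambda>n. B * real (Suc n) powr (- (1 + d)))"
    have "summable (\<lambda>n. real (Suc n) powr (- (1 + d)))"
      using summable_real_powr_iff[of "- (1 + d)"] d by (subst summable_Suc_iff) simp
    then have "summable h" unfolding h_def by (rule summable_mult)
    have "cmod (zeta_err n y) \<le> h n" if y: "y \<in> ball s d" for n y
    proof -
      have "Re s - Re y \<le> cmod (s - y)" using complex_Re_le_cmod[of "s - y"] by simp
      moreover have "cmod (s - y) < d" using y by (simp add: dist_norm)
      ultimately have Re: "Re y \<ge> - 1 + d" by (simp add: d_def field_simps)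
      have "cmod (zeta_err n y) \<le> (cmod (1 - y) * cmod y * cmod (1 + y)) * real (Suc n) powr (- (Re y + 2))"
        using Re d by (intro zeta_err_bound) auto
      also have "\<dots> \<le> B * real (Suc n) powr (- (1 + d))"
        using B(2)[of y] B(1) y Re by (intro mult_mono powr_mono) auto
      finally show ?thesis by (simp add: h_def)
    qed
    then show "\<exists>d k. 0 < d \<and> summable k \<and> range k \<subseteq> \<real>\<^sub>\<ge>\<^sub>0 \<and>
          (\<forall>\<^sub>F n in sequentially. \<forall>y\<in>ball s d \<inter> ?S. cmod (zeta_err n y) \<le> cmod (k n))"
      using \<open>summable h\<close> B(1) d
      by (intro exI[of _ d] exI[of _ "\<lambda>n. of_real (h n)"] conjI)
         (auto simp: h_def nonneg_Reals_of_real_iff norm_mult intro!: summable_of_real always_eventually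
               simp del: of_nat_Suc)
  qed
  show ?thesis
  proof (rule that)
    show "R holomorphic_on ?S"
      using R by (auto simp: holomorphic_on_def intro: field_differentiable_at_within)
  qed (use R in auto)
qed

lemma zeta_holomorphic: "zeta holomorphic_on - {1}"
  using is_zeta_zeta by (simp add: is_zeta_def)

lemma zeta_sums:
  assumes "Re s > 1"
  shows "(\<lambda>n. of_nat (Suc n) powr (- s)) sums zeta s"
  using is_zeta_zeta assms by (simp add: is_zeta_def powr_minus divide_inverse)

definition zeta_reg :: "complex \<Rightarrow> complex" where
  "zeta_reg s = (if s = 1 then 1 else (s - 1) * zeta s)"

text \<open>For Re s > 1 the sum telescopes to -1 - (1 - s)(2 zeta(s) - 1)/2, and both sides
  continue to Re s > -1. Since every \<open>zeta_err n 1\<close> is 0, the limit function has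
  exactly the value that belongs to \<open>zeta_reg 1 = 1\<close>; the same series therefore shows
  that the singularity there is removable.\<close>

lemma zeta_err_sums: "Re s > - 1 \<Longrightarrow> (\<lambda>n. zeta_err n s) sums (zeta_reg s - (1 + s) / 2)"
    and zeta_reg_holomorphic: "zeta_reg holomorphic_on UNIV"
proof -
  obtain R where R: "R holomorphic_on {s. Re s > - 1}" "\<And>s. Re s > - 1 \<Longrightarrow> (\<lambda>n. zeta_err n s) sums R s"
    using zeta_err_series by blast
  have R1: "R s = (s - 1) * zeta s - (1 + s) / 2" if s: "Re s > 1" for s
  proof -
    have tele: "(\<lambda>n. of_nat (Suc (Suc n)) powr (1 - s) - of_nat (Suc n) powr (1 - s)) sums (0 - of_nat (Suc 0) powr (1 - s))"
    proof (rule telescope_sums)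
      have "(\<lambda>n. of_nat n powr (1 - s)) \<longlonglongrightarrow> 0"
        using s by (intro tendsto_neg_powr_complex_of_nat filterlim_ident) auto
      then show "(\<lambda>n. of_nat (Suc n) powr (1 - s)) \<longlonglongrightarrow> 0" by (rule LIMSEQ_Suc)
    qed
    have z2: "(\<lambda>n. of_nat (Suc (Suc n)) powr (- s)) sums (zeta s - 1)"
      using zeta_sums[OF s] by (subst sums_Suc_iff) simp
    have "(\<lambda>n. zeta_err n s) sums ((0 - of_nat (Suc 0) powr (1 - s)) - (1 - s) * (zeta s + (zeta s - 1)) / 2)"
      unfolding zeta_err_eq by (intro sums_diff tele sums_divide sums_mult sums_add z2 zeta_sums s)
    moreover have "(\<lambda>n. zeta_err n s) sums R s" using R(2) s by simp
    ultimately show ?thesis using sums_unique2 by (fastforce simp: field_simps)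
  qed
  have R2: "R s = (s - 1) * zeta s - (1 + s) / 2" if s: "Re s > - 1" "s \<noteq> 1" for s
  proof (rule analytic_continuation_open[of "{s. Re s > 1}" "{s. Re s > - 1} - {1}" R "\<lambda>s. (s - 1) * zeta s - (1 + s) / 2"])
    show "{s. Re s > 1} \<noteq> {}" by (auto intro!: exI[of _ 2])
    show "connected ({s. Re s > - 1} - {1})"
      by (intro connected_open_delete convex_connected convex_halfspace_Re_gt open_halfspace_Re_gt) simp
    show "(\<lambda>s. (s - 1) * zeta s - (1 + s) / 2) holomorphic_on {s. Re s > - 1} - {1}"
      by (intro holomorphic_intros holomorphic_on_subset[OF zeta_holomorphic]) auto
    show "R holomorphic_on {s. Re s > - 1} - {1}" by (rule holomorphic_on_subset[OF R(1)]) auto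
  qed (use s R1 in \<open>auto intro!: open_halfspace_Re_gt open_Diff\<close>)
  have R3: "R 1 = 0"
  proof -
    have "zeta_err n 1 = 0" for n by (simp add: zeta_err_eq del: of_nat_Suc)
    then have "(\<lambda>n. 0) sums R 1" using R(2)[of 1] by simp
    then show ?thesis by (rule sums_unique2[OF _ sums_zero])
  qed
  have R4: "R s = zeta_reg s - (1 + s) / 2" if "Re s > - 1" for s
    using R2[OF that] R3 by (auto simp: zeta_reg_def)
  show "(\<lambda>n. zeta_err n s) sums (zeta_reg s - (1 + s) / 2)" if "Re s > - 1"
    using R(2)[OF that] R4[OF that] by simp
  have "(\<lambda>s. R s + (1 + s) / 2) holomorphic_on {s. Re s > - 1}" by (intro holomorphic_intros R) auto
  then have "zeta_reg holomorphic_on {s. Re s > - 1}" by (rule holomorphic_transform) (simp add: R4)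
  moreover have "zeta_reg holomorphic_on - {1}"
  proof (rule holomorphic_transform)
    show "(\<lambda>s. (s - 1) * zeta s) holomorphic_on - {1}" by (intro holomorphic_intros zeta_holomorphic)
  qed (simp add: zeta_reg_def)
  ultimately have "zeta_reg holomorphic_on ({s. Re s > - 1} \<union> - {1})"
    by (intro holomorphic_on_Un open_halfspace_Re_gt) auto
  also have "{s. Re s > - 1} \<union> - {1} = (UNIV :: complex set)" by auto
  finally show "zeta_reg holomorphic_on UNIV" .
qed

lemma trapezoid_error_nonneg:
  assumes "0 < a" "a < 1"
  shows "trapezoid_error a n \<ge> 0"
proof -
  have "0 \<le> (2 * (((real n + 1) powr (a + 1) - real n powr (a + 1)) / (a + 1)) - (real n powr a + (real n + 1) powr a))
             / (a * (1 - a))"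
    using assms by (intro has_integral_nonneg[OF trapezoid_has_integral]) auto
  moreover have "2 * (((real n + 1) powr (a + 1) - real n powr (a + 1)) / (a + 1)) - (real n powr a + (real n + 1) powr a)
        = 2 * trapezoid_error a n"
  proof -
    have "2 * y - z = 2 * (y - z / 2)" for y z :: real by simp
    then show ?thesis unfolding trapezoid_error_def of_nat_Suc add.commute[of 1] .
  qed
  ultimately have "0 \<le> 2 * trapezoid_error a n / (a * (1 - a))" by simp
  moreover have "a * (1 - a) > 0" using assms by simp
  ultimately show ?thesis by (simp only: zero_le_divide_iff) linarith
qed

lemma of_nat_powr_of_real: "(of_nat n :: complex) powr of_real x = of_real (real n powr x)"
  using powr_of_real[of "real n" x] by simp

text \<open>At s = -a, \<open>zeta_err n\<close> is \<open>1 + a\<close> times the error on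
  [n + 1, n + 2]. The remaining interval [0, 1] has error (1 - a)/(2 (1 + a)), which is the rational
  term of \<open>zeta_err_sums\<close> after division by \<open>1 + a\<close>.\<close>

lemma trapezoid_error_sums:
  assumes a: "0 < a" "a < 1"
  shows "(\<lambda>n. complex_of_real (trapezoid_error a n)) sums (- zeta (- of_real a))"
proof -
  have "complex_of_real (1 + a) \<noteq> 0" using a by (simp only: of_real_eq_0_iff)
  then have a1: "1 + complex_of_real a \<noteq> 0" by simp
  then have a2: "complex_of_real a \<noteq> - 1" by (simp add: add_eq_0_iff)
  have eq: "zeta_err n (- of_real a) = of_real ((1 + a) * trapezoid_error a (Suc n))" for n
  proof -
    have e: "1 - (- complex_of_real a) = of_real (a + 1)" "- (- complex_of_real a) = of_real a" by simp_all
    have "zeta_err n (- of_real a) = of_real (real (Suc (Suc n)) powr (a + 1) - real (Suc n) powr (a + 1)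
       - (a + 1) * (real (Suc n) powr a + real (Suc (Suc n)) powr a) / 2)"
      unfolding zeta_err_eq e of_nat_powr_of_real
      by (simp only: of_real_diff of_real_mult of_real_add of_real_divide of_real_numeral)
    also have "real (Suc (Suc n)) powr (a + 1) - real (Suc n) powr (a + 1)
       - (a + 1) * (real (Suc n) powr a + real (Suc (Suc n)) powr a) / 2 = (1 + a) * trapezoid_error a (Suc n)"
    proof -
      have "d - (a + 1) * e / 2 = (1 + a) * (d / (a + 1) - e / 2)" for d e
        using a by (simp add: field_simps)
      then show ?thesis unfolding trapezoid_error_def .
    qed
    finally show ?thesis .
  qed
  have "(\<lambda>n. zeta_err n (- of_real a)) sums (zeta_reg (- of_real a) - (1 + - of_real a) / 2)"
    using a by (intro zeta_err_sums) simp
  then have "(\<lambda>n. 1 / (1 + of_real a) * zeta_err n (- of_real a)) sums (1 / (1 + of_real a) * (zeta_reg (- of_real a) - (1 + - of_real a) / 2))"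
    by (rule sums_mult)
  moreover have "1 / (1 + of_real a) * zeta_err n (- of_real a) = complex_of_real (trapezoid_error a (Suc n))" for n
    using a1 by (simp add: eq)
  moreover have "1 / (1 + of_real a) * (zeta_reg (- of_real a) - (1 + - of_real a) / 2) =
      - zeta (- of_real a) - complex_of_real (trapezoid_error a 0)"
  proof -
    have "- complex_of_real a \<noteq> 1" using a2 by (simp add: minus_equation_iff)
    moreover have "2 + complex_of_real a * 2 \<noteq> 0"
    proof -
      have "2 + complex_of_real a * 2 = 2 * (1 + of_real a)" by simp
      then show ?thesis using a1 by (simp only: mult_eq_0_iff) simp
    qed
    ultimately show ?thesis using a1 a2 a
      by (simp add: zeta_reg_def trapezoid_error_def divide_simps) (simp add: algebra_simps)
  qed
  ultimately have "(\<lambda>n. complex_of_real (trapezoid_error a (Suc n))) sums (- zeta (- of_real a) - complex_of_real (trapezoid_error a 0))"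
    by simp
  then show ?thesis
    unfolding sums_Suc_iff[of "\<lambda>n. complex_of_real (trapezoid_error a n)"] by simp
qed

lemma Gamma_duplication_real:
  fixes x :: real
  assumes "x > 0"
  shows "Gamma x * Gamma (x + 1 / 2) = 2 powr (1 - 2 * x) * sqrt pi * Gamma (2 * x)"
proof -
  have np: "complex_of_real y \<notin> \<int>\<^sub>\<le>\<^sub>0" if "y > 0" for y
  proof
    assume "complex_of_real y \<in> \<int>\<^sub>\<le>\<^sub>0"
    then obtain n where "complex_of_real y = of_int n" "n \<le> 0" by (auto elim: nonpos_Ints_cases)
    then have "Re (complex_of_real y) = Re (of_int n)" "n \<le> 0" by simp_all
    then show False using that by simp
  qed
  have dup: "Gamma (complex_of_real x) * Gamma (of_real x + 1 / 2) =
      exp ((1 - 2 * of_real x) * of_real (ln 2)) * of_real (sqrt pi) * Gamma (2 * of_real x)"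
    using np[of x] np[of "x + 1 / 2"] assms by (intro Gamma_legendre_duplication) auto
  have e: "complex_of_real x + 1 / 2 = of_real (x + 1 / 2)" "2 * complex_of_real x = of_real (2 * x)"
    by simp_all
  have e3: "exp ((1 - complex_of_real (2 * x)) * of_real (ln 2)) = of_real (2 powr (1 - 2 * x))"
    by (simp add: powr_def exp_of_real[symmetric])
  show ?thesis
    using dup unfolding e e3 Gamma_complex_of_real of_real_mult[symmetric] of_real_eq_iff .
qed

text \<open>The factor s/2 is absorbed into the Gamma function and the pole of zeta into
  \<open>zeta_reg\<close>, so the expression is regular at 0 and 1 and represents xi for Re s >
  -2.\<close>

definition xi0 :: "complex \<Rightarrow> complex" where
  "xi0 s = of_real pi powr (- s / 2) * Gamma (1 + s / 2) * zeta_reg s"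

lemma xi0_functional_equation_real:
  fixes a :: real
  assumes a: "0 < a" "a < 1"
  shows "xi0 (- of_real a) = xi0 (1 + of_real a)"
proof -
  define T where "T = (\<Sum>n. trapezoid_error a n)"
  define Z where "Z = (\<Sum>n. real (Suc n) powr (- a - 1))"
  have "summable (\<lambda>n. trapezoid_error a n)"
    using sums_summable[OF trapezoid_error_sums[OF a]] by (simp add: summable_of_real_iff)
  then have te: "(\<lambda>n. trapezoid_error a n) sums T" by (simp add: T_def summable_sums)
  have zT: "zeta (- of_real a) = - of_real T"
    using sums_unique2[OF sums_of_real[OF te] trapezoid_error_sums[OF a]] by simp
  have "summable (\<lambda>n. real (Suc n) powr (- a - 1))"
    using summable_real_powr_iff[of "- a - 1"] a by (subst summable_Suc_iff) simp
  then have sZ: "(\<lambda>n. real (Suc n) powr (- a - 1)) sums Z" by (simp add: Z_def summable_sums)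
  have "- (1 + complex_of_real a) = of_real (- a - 1)" by simp
  then have "(\<lambda>n. complex_of_real (real (Suc n) powr (- a - 1))) sums zeta (1 + of_real a)"
    using zeta_sums[of "1 + of_real a"] a by (simp only: of_nat_powr_of_real) simp
  moreover have "(\<lambda>n. complex_of_real (real (Suc n) powr (- a - 1))) sums of_real Z"
    by (intro sums_of_real sZ)
  ultimately have zZ: "zeta (1 + of_real a) = of_real Z" by (rule sums_unique2)
  define c where "c = 2 * Gamma ((1 - a) / 2) * Gamma ((1 + a) / 2) * (2 * pi) powr (- a - 1)"
  have c: "c \<ge> 0" using a by (simp add: c_def Gamma_real_nonneg)
  have u: "(\<lambda>n. Gamma (2 - a) * (2 * trapezoid_error a n / (a * (1 - a)))) sums (Gamma (2 - a) * (2 * T / (a * (1 - a))))"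
    by (intro sums_mult sums_divide te)
  have v: "(\<lambda>n. c * real (Suc n) powr (- a - 1)) sums (c * Z)" by (intro sums_mult sZ)
  have "(\<Sum>n. ennreal (Gamma (2 - a) * (2 * trapezoid_error a n / (a * (1 - a))))) = ennreal (Gamma (2 - a) * (2 * T / (a * (1 - a))))"
    using a by (intro suminf_ennreal_eq u) (auto intro!: mult_nonneg_nonneg divide_nonneg_pos trapezoid_error_nonneg Gamma_real_nonneg)
  moreover have "(\<Sum>n. ennreal (c * real (Suc n) powr (- a - 1))) = ennreal (c * Z)"
    using c by (intro suminf_ennreal_eq v) auto
  moreover have "2 * Gamma ((1 - a) / 2) * Gamma ((1 + a) / 2) * (2 * pi * real (Suc n)) powr (- a - 1)
      = c * real (Suc n) powr (- a - 1)" for n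
    by (simp add: c_def powr_mult del: of_nat_Suc)
  ultimately have "ennreal (Gamma (2 - a) * (2 * T / (a * (1 - a)))) = ennreal (c * Z)"
    using suminf_trapezoid_error[OF a] by simp
  moreover have "T \<ge> 0" unfolding T_def using te a by (intro suminf_nonneg trapezoid_error_nonneg) (auto simp: sums_iff)
  moreover have "Z \<ge> 0" unfolding Z_def using sZ by (intro suminf_nonneg) (auto simp: sums_iff)
  ultimately have eq: "Gamma (2 - a) * (2 * T / (a * (1 - a))) = c * Z"
    using a c by (subst (asm) ennreal_inj) (auto simp: Gamma_real_nonneg)
  have np: "y \<notin> \<int>\<^sub>\<le>\<^sub>0" if "y > 0" for y :: real
    using that by (auto elim!: nonpos_Ints_cases)
  have "2 - a = (1 - a) + 1" by simp
  then have G2: "Gamma (2 - a) = (1 - a) * Gamma (1 - a)"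
    using Gamma_plus1[OF np[of "1 - a"]] a by simp
  \<comment> \<open>The comparison of the two series involves Gamma at 1 - a and at (1 - a)/2,
    whereas xi0 at -a contains Gamma at 1 - a/2; duplication relates the three.\<close>
  have dup: "Gamma ((1 - a) / 2) * Gamma (1 - a / 2) = 2 powr a * sqrt pi * Gamma (1 - a)"
  proof -
    have "(1 - a) / 2 + 1 / 2 = 1 - a / 2" "1 - 2 * ((1 - a) / 2) = a" "2 * ((1 - a) / 2) = 1 - a"
      by (simp_all add: field_simps)
    then show ?thesis using Gamma_duplication_real[of "(1 - a) / 2"] a by (simp only:)
  qed
  have G3: "Gamma (1 + (1 + a) / 2) = (1 + a) / 2 * Gamma ((1 + a) / 2)"
    using Gamma_plus1[OF np[of "(1 + a) / 2"]] a by (simp add: add.commute)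
  have G1: "Gamma (1 - a) > 0" using a by (intro Gamma_real_pos) simp
  have T: "Gamma (1 - a) * T = a * Gamma ((1 - a) / 2) * Gamma ((1 + a) / 2) * (2 * pi) powr (- a - 1) * Z"
  proof -
    have "(1 - a) * Gamma (1 - a) * (2 * T / (a * (1 - a))) = 2 * (Gamma (1 - a) * T) / a"
      using a by simp
    then have "2 * (Gamma (1 - a) * T) / a = c * Z" using eq unfolding G2 by simp
    then have "Gamma (1 - a) * T = a * (c / 2) * Z" using a by (simp add: divide_simps mult_ac)
    then show ?thesis by (simp add: c_def mult_ac)
  qed
  have "Gamma (1 - a) * (pi powr (a / 2) * Gamma (1 - a / 2) * ((1 + a) * T))
      = pi powr (a / 2) * (Gamma ((1 - a) / 2) * Gamma (1 - a / 2)) * (1 + a) * a * Gamma ((1 + a) / 2) * (2 * pi) powr (- a - 1) * Z"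
    using arg_cong[OF T, of "\<lambda>x. pi powr (a / 2) * Gamma (1 - a / 2) * (1 + a) * x"] by (simp add: mult_ac)
  also have "\<dots> = Gamma (1 - a) * ((pi powr (a / 2) * 2 powr a * sqrt pi * (2 * pi) powr (- a - 1)) * (1 + a) * a * Gamma ((1 + a) / 2) * Z)"
    unfolding dup by (simp add: mult_ac)
  also have "pi powr (a / 2) * 2 powr a * sqrt pi * (2 * pi) powr (- a - 1) = pi powr (- (1 + a) / 2) / 2"
  proof -
    have "pi powr (a / 2) * 2 powr a * sqrt pi * (2 * pi) powr (- a - 1) = 
      (2 powr a * 2 powr (- a - 1)) * (pi powr (a / 2) * pi powr (1 / 2) * pi powr (- a - 1))"
      by (simp add: powr_mult powr_half_sqrt mult_ac)
    also have "2 powr a * 2 powr (- a - 1) = (1 / 2 :: real)"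
      unfolding powr_add[symmetric] by (simp add: powr_minus)
    also have "pi powr (a / 2) * pi powr (1 / 2) * pi powr (- a - 1) = pi powr (- (1 + a) / 2)"
      unfolding powr_add[symmetric] by (simp add: field_simps)
    finally show ?thesis by simp
  qed
  finally have main: "pi powr (a / 2) * Gamma (1 - a / 2) * ((1 + a) * T)
     = pi powr (- (1 + a) / 2) * Gamma (1 + (1 + a) / 2) * (a * Z)"
    using G1 unfolding G3 by (simp add: mult_ac)
  have a1: "- complex_of_real a \<noteq> 1"
    using a by (auto simp: complex_eq_iff)
  have "xi0 (- of_real a) = of_real (pi powr (a / 2) * Gamma (1 - a / 2) * ((1 + a) * T))"
  proof -
    have e: "- (- complex_of_real a) / 2 = of_real (a / 2)" "1 + - complex_of_real a / 2 = of_real (1 - a / 2)" by simp_all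
    show ?thesis unfolding xi0_def e zeta_reg_def using a1
      by (simp add: zT powr_of_real Gamma_complex_of_real del: of_real_diff of_real_divide) (simp add: algebra_simps)
  qed
  also have "\<dots> = of_real (pi powr (- (1 + a) / 2) * Gamma (1 + (1 + a) / 2) * (a * Z))" unfolding main ..
  also have "\<dots> = xi0 (1 + of_real a)"
  proof -
    have e: "- (1 + complex_of_real a) / 2 = of_real (- (1 + a) / 2)" "1 + (1 + complex_of_real a) / 2 = of_real (1 + (1 + a) / 2)" by simp_all
    show ?thesis unfolding xi0_def e zeta_reg_def using a
      by (simp add: zZ powr_of_real Gamma_complex_of_real del: of_real_diff of_real_divide of_real_add)
  qed
  finally show ?thesis .
qed

subsection \<open>Bounds for the Gamma function\<close>

lemma Re_pos_not_nonpos_Ints: "Re z > 0 \<Longrightarrow> z \<notin> \<int>\<^sub>\<le>\<^sub>0"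
  by (auto elim!: nonpos_Ints_cases)

lemma Gamma_neq_0_halfplane: "Re z > 0 \<Longrightarrow> Gamma z \<noteq> 0"
  using Re_pos_not_nonpos_Ints by (simp add: Gamma_eq_zero_iff)

text \<open>By Gauss's limit formula the ratio of \<open>cmod (Gamma (Complex a y))\<close> to
  \<open>Gamma a\<close> is a product of factors (a + k)/|a + k + i y|, each increasing in
  a.\<close>

lemma norm_Gamma_ratio_mono:
  assumes a: "0 < a" "a \<le> b"
  shows "cmod (Gamma (Complex a y)) * Gamma b \<le> Gamma a * cmod (Gamma (Complex b y))"
proof -
  have np: "x \<notin> \<int>\<^sub>\<le>\<^sub>0" if "x > 0" for x :: real
    using that by (auto elim!: nonpos_Ints_cases)
  have nG: "cmod (Gamma_series (Complex x y) n) = fact n * exp (x * ln (real n)) / (\<Prod>k\<in>{0..<n+1}. cmod (Complex (x + real k) y))"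
    for x n
  proof -
    have "Complex x y + of_nat k = Complex (x + real k) y" for k by (simp add: complex_eq_iff)
    then show ?thesis
      unfolding Gamma_series_def pochhammer_prod norm_divide norm_mult prod_norm[symmetric] by simp
  qed
  have G: "Gamma_series x n = fact n * exp (x * ln (real n)) / (\<Prod>k\<in>{0..<n+1}. x + real k)" for x :: real and n
    by (simp add: Gamma_series_def pochhammer_prod)
  have le: "cmod (Gamma_series (Complex a y) n) * Gamma_series b n \<le> Gamma_series a n * cmod (Gamma_series (Complex b y) n)" for n
  proof -
    have t: "p * cmod (Complex q y) \<le> q * cmod (Complex p y)" if "0 < p" "p \<le> q" for p q
    proof -
      have "p\<^sup>2 * y\<^sup>2 \<le> q\<^sup>2 * y\<^sup>2" using that power_mono[of p q 2] by (intro mult_right_mono) simp_all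
      then have "(p * cmod (Complex q y))\<^sup>2 \<le> (q * cmod (Complex p y))\<^sup>2"
        unfolding power_mult_distrib cmod_power2 by (simp add: distrib_left mult.commute)
      then show ?thesis by (rule power2_le_imp_le) (use that in simp)
    qed
    define P1 P2 Q1 Q2 where "P1 = (\<Prod>k\<in>{0..<n+1}. cmod (Complex (a + real k) y))"
      and "P2 = (\<Prod>k\<in>{0..<n+1}. cmod (Complex (b + real k) y))"
      and "Q1 = (\<Prod>k\<in>{0..<n+1}. a + real k)" and "Q2 = (\<Prod>k\<in>{0..<n+1}. b + real k)"
    have pos: "P1 > 0" "P2 > 0" "Q1 > 0" "Q2 > 0"
      unfolding P1_def P2_def Q1_def Q2_def by (rule prod_pos, use a in \<open>force simp: complex_eq_iff\<close>)+
    have le: "Q1 * P2 \<le> Q2 * P1"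
      unfolding P1_def P2_def Q1_def Q2_def prod.distrib[symmetric]
      using a by (intro prod_mono) (auto intro!: t)
    define X Y where "X = fact n * exp (a * ln (real n))" and "Y = fact n * exp (b * ln (real n))"
    have XY: "X > 0" "Y > 0" by (simp_all add: X_def Y_def)
    have "(X / P1) * (Y / Q2) = X * Y / (Q2 * P1)" by (simp add: mult_ac)
    also have "\<dots> \<le> X * Y / (Q1 * P2)" using le pos XY by (intro divide_left_mono) auto
    also have "\<dots> = (X / Q1) * (Y / P2)" by simp
    finally show ?thesis unfolding nG G P1_def P2_def Q1_def Q2_def X_def Y_def .
  qed
  show ?thesis
  proof (rule tendsto_le[OF sequentially_bot _ _ always_eventually])
    show "(\<lambda>n. cmod (Gamma_series (Complex a y) n) * Gamma_series b n) \<longlonglongrightarrow> cmod (Gamma (Complex a y)) * Gamma b"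
      by (intro tendsto_mult tendsto_norm Gamma_series_LIMSEQ)
    show "(\<lambda>n. Gamma_series a n * cmod (Gamma_series (Complex b y) n)) \<longlonglongrightarrow> Gamma a * cmod (Gamma (Complex b y))"
      by (intro tendsto_mult tendsto_norm Gamma_series_LIMSEQ)
  qed (use le in blast)
qed

lemma norm_Gamma_le:
  assumes "Re z > 0"
  shows "cmod (Gamma z) \<le> Gamma (Re z)"
proof (rule tendsto_le[OF sequentially_bot _ _ always_eventually])
  show "(\<lambda>n. cmod (Gamma_series z n)) \<longlonglongrightarrow> cmod (Gamma z)" "Gamma_series (Re z) \<longlonglongrightarrow> Gamma (Re z)"
    by (intro tendsto_norm Gamma_series_LIMSEQ)+
  show "\<forall>n. cmod (Gamma_series z n) \<le> Gamma_series (Re z) n"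
  proof
    fix n
    have "(\<Prod>k\<in>{0..<n+1}. Re z + real k) \<le> (\<Prod>k\<in>{0..<n+1}. cmod (z + of_nat k))"
      using assms by (intro prod_mono) (auto intro!: order.trans[OF _ complex_Re_le_cmod])
    moreover have "(\<Prod>k\<in>{0..<n+1}. Re z + real k) > 0"
      using assms by (intro prod_pos) auto
    ultimately show "cmod (Gamma_series z n) \<le> Gamma_series (Re z) n"
      unfolding Gamma_series_def pochhammer_prod norm_divide norm_mult prod_norm[symmetric]
      by (auto intro!: divide_left_mono)
  qed
qed

text \<open>A substitute for Stirling's formula. In the reflection formula for z = 1/4 + i y the
  other factor, Gamma(3/4 - i y), is bounded through \<open>norm_Gamma_ratio_mono\<close> by a
  multiple of Gamma(5/4 - i y), whose modulus is |z Gamma(z)|. This bounds |Gamma(z)|^2 from below.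
  The result falls short of the true order by y^(1/4), which the later power count can
  afford.\<close>

lemma Gamma_quarter_lower_bound:
  obtains c where "c > 0" "\<And>y. y \<ge> 0 \<Longrightarrow> cmod (Gamma (Complex (1 / 4) y)) \<ge> c * exp (- pi * y / 2) / sqrt (1 + y)"
proof -
  define C where "C = Gamma (3 / 4) / Gamma (5 / 4 :: real)"
  have C: "C > 0" by (simp add: C_def Gamma_real_pos)
  have "cmod (Gamma (Complex (1 / 4) y)) \<ge> sqrt (pi / C) * exp (- pi * y / 2) / sqrt (1 + y)" if y: "y \<ge> 0" for y
  proof -
    define z where "z = Complex (1 / 4) y"
    define g where "g = cmod (Gamma z)"
    have cnj: "Complex a (- y) = cnj (Complex a y)" for a by (simp add: complex_eq_iff)
    have "1 - z = Complex (3 / 4) (- y)" by (simp add: z_def complex_eq_iff)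
    then have refl: "Gamma z * Gamma (Complex (3 / 4) (- y)) = of_real pi / sin (of_real pi * z)"
      using Gamma_reflection_complex[of z] by simp
    have "cmod (Gamma (Complex (3 / 4) (- y))) * Gamma (5 / 4) \<le> Gamma (3 / 4) * cmod (Gamma (Complex (5 / 4) (- y)))"
      by (rule norm_Gamma_ratio_mono) auto
    then have "cmod (Gamma (Complex (3 / 4) (- y))) \<le> C * cmod (Gamma (Complex (5 / 4) (- y)))"
      by (simp add: C_def Gamma_real_pos pos_le_divide_eq)
    also have "cmod (Gamma (Complex (5 / 4) (- y))) = cmod (Gamma (Complex (5 / 4) y))"
      unfolding cnj cnj_Gamma[symmetric] by simp
    also have "Complex (5 / 4) y = z + 1" by (simp add: z_def complex_eq_iff)
    also have "Gamma (z + 1) = z * Gamma z"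
      by (intro Gamma_plus1 Re_pos_not_nonpos_Ints) (simp add: z_def)
    also have "cmod (z * Gamma z) = cmod z * g" by (simp add: norm_mult g_def)
    also have "cmod z \<le> 1 + y" using cmod_le[of z] y by (simp add: z_def)
    finally have G34: "cmod (Gamma (Complex (3 / 4) (- y))) \<le> C * ((1 + y) * g)"
      using C by (simp add: g_def mult_left_mono mult_right_mono)
    have "cmod (sin (1 *\<^sub>R (of_real pi * z))) \<le> exp \<bar>Im (of_real pi * z)\<bar>"
      by (rule cmod_sin_le_exp) auto
    then have sin_le: "cmod (sin (of_real pi * z)) \<le> exp (pi * y)" using y by (simp add: z_def)
    have sin0: "sin (of_real pi * z) \<noteq> 0"
    proof
      assume "sin (of_real pi * z) = 0"
      then have "Gamma z * Gamma (Complex (3 / 4) (- y)) = 0" using refl by simp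
      then show False
        using Gamma_neq_0_halfplane[of z] Gamma_neq_0_halfplane[of "Complex (3 / 4) (- y)"] by (simp add: z_def)
    qed
    have "pi * exp (- pi * y) \<le> pi / cmod (sin (of_real pi * z))"
      using sin_le sin0 by (simp add: exp_minus divide_simps)
    also have "\<dots> = g * cmod (Gamma (Complex (3 / 4) (- y)))"
      using arg_cong[OF refl, of cmod] by (simp add: norm_mult norm_divide g_def)
    also have "\<dots> \<le> g * (C * ((1 + y) * g))" using G34 by (intro mult_left_mono) (auto simp: g_def)
    finally have "pi * exp (- pi * y) / (C * (1 + y)) \<le> g\<^sup>2"
      using C y by (simp add: divide_le_eq power2_eq_square mult_ac)
    then have "sqrt (pi * exp (- pi * y) / (C * (1 + y))) \<le> sqrt (g\<^sup>2)" by (rule real_sqrt_le_mono)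
    also have "sqrt (pi * exp (- pi * y) / (C * (1 + y))) = sqrt (pi / C) * sqrt (exp (- pi * y)) / sqrt (1 + y)"
      by (simp add: real_sqrt_mult real_sqrt_divide)
    also have "sqrt (exp (- pi * y)) = exp (- pi * y / 2)"
      by (rule real_sqrt_unique) (simp_all flip: exp_of_nat_mult)
    finally show ?thesis by (simp add: g_def z_def)
  qed
  then show ?thesis using that[of "sqrt (pi / C)"] C by simp
qed

text \<open>Compactness on [1, 2] and the recursion
  \<open>Gamma x = (x - 1) * Gamma (x - 1)\<close>; this crude rate is enough to bound the order of
  xi.\<close>

lemma Gamma_real_growth:
  obtains M where "M > 0" "\<And>x::real. x \<ge> 1 \<Longrightarrow> Gamma x \<le> M * x powr x"
proof -
  have "continuous_on {1..2::real} Gamma"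
    by (intro continuous_on_Gamma) (auto elim!: nonpos_Ints_cases)
  then have "bounded (Gamma ` {1..2::real})"
    by (intro compact_imp_bounded compact_continuous_image) auto
  then obtain M where M: "M > 0" "\<And>x::real. x \<in> {1..2} \<Longrightarrow> norm (Gamma x) \<le> M"
    unfolding bounded_pos by blast
  have "Gamma x \<le> M * x powr x" if "1 \<le> x" "x \<le> real n + 2" for x n
    using that
  proof (induction n arbitrary: x)
    case 0
    then have "Gamma x \<le> M * 1" using M(2)[of x] by simp
    also have "\<dots> \<le> M * x powr x" using 0 M(1) ge_one_powr_ge_zero[of x x] by (intro mult_left_mono) auto
    finally show ?case .
  next
    case (Suc n)
    show ?case
    proof (cases "x \<le> real n + 2")
      case False
      then have x: "x > 2" by simp
      have "x - 1 \<notin> \<int>\<^sub>\<le>\<^sub>0" using x by (auto elim!: nonpos_Ints_cases)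
      then have "Gamma x = (x - 1) * Gamma (x - 1)" using Gamma_plus1[of "x - 1"] by simp
      also have "\<dots> \<le> (x - 1) * (M * (x - 1) powr (x - 1))"
        using x Suc.prems by (intro mult_left_mono Suc.IH) auto
      also have "\<dots> = M * (x - 1) powr x" using x by (simp add: powr_diff)
      also have "\<dots> \<le> M * x powr x" using x M(1) by (intro mult_left_mono powr_mono2) auto
      finally show ?thesis .
    qed (use Suc in auto)
  qed
  note bound = this
  have "Gamma x \<le> M * x powr x" if "x \<ge> 1" for x
  proof (rule bound[OF that, of "nat \<lceil>x\<rceil>"])
    show "x \<le> real (nat \<lceil>x\<rceil>) + 2" by linarith
  qed
  then show ?thesis using that M(1) by blast
qed

subsection \<open>The entire function $\xi$\<close>

lemma xi0_holomorphic: "xi0 holomorphic_on {s. Re s > - 2}"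
proof -
  have "1 + s / 2 \<notin> \<int>\<^sub>\<le>\<^sub>0" if "Re s > - 2" for s
    using that by (intro Re_pos_not_nonpos_Ints) simp
  then show ?thesis
    unfolding xi0_def by (intro holomorphic_intros holomorphic_on_subset[OF zeta_reg_holomorphic]) auto
qed

text \<open>Both sides are holomorphic in this strip and agree on the segment -1 < s < 0, which
  accumulates at its interior point -1/2.\<close>

lemma xi0_functional_equation:
  assumes "- 1 < Re s" "Re s < 2"
  shows "xi0 s = xi0 (1 - s)"
proof -
  define S where "S = {s. - 1 < Re s} \<inter> {s. Re s < 2}"
  define U where "U = (\<lambda>a. - complex_of_real a) ` {0<..<1}"
  have "(\<lambda>s. xi0 s - xi0 (1 - s)) s = 0"
  proof (rule analytic_continuation[of "\<lambda>s. xi0 s - xi0 (1 - s)" S U "- of_real (1 / 2)"])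
    have "(\<lambda>s. xi0 (1 - s)) holomorphic_on S"
      by (rule holomorphic_on_compose_gen[OF _ xi0_holomorphic, unfolded o_def])
         (auto simp: S_def intro!: holomorphic_intros)
    moreover have "xi0 holomorphic_on S" by (rule holomorphic_on_subset[OF xi0_holomorphic]) (auto simp: S_def)
    ultimately show "(\<lambda>s. xi0 s - xi0 (1 - s)) holomorphic_on S" by (intro holomorphic_intros)
    show "open S" by (auto simp: S_def intro!: open_Int open_halfspace_Re_gt open_halfspace_Re_lt)
    show "connected S"
      by (auto simp: S_def intro!: convex_connected convex_Int convex_halfspace_Re_gt convex_halfspace_Re_lt)
    show "U \<subseteq> S" "- complex_of_real (1 / 2) \<in> S" by (auto simp: U_def S_def)
    show "(- complex_of_real (1 / 2)) islimpt U"
    proof -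
      have 1: "(1 / 2 :: real) islimpt {0<..<1}" by (rule open_imp_islimpt) auto
      show ?thesis unfolding islimpt_approachable
      proof safe
        fix e :: real assume "e > 0"
        with 1 have "\<exists>x\<in>{0<..<1}. x \<noteq> (1 / 2 :: real) \<and> dist x (1 / 2) < e"
          by (simp only: islimpt_approachable)
        then obtain x :: real where x: "x \<in> {0<..<1}" "x \<noteq> 1 / 2" "dist x (1 / 2) < e" by blast
        have "- complex_of_real x \<noteq> - complex_of_real (1 / 2)"
          using x(2) by (simp only: neg_equal_iff_equal of_real_eq_iff) simp
        moreover have "dist (- complex_of_real x) (- complex_of_real (1 / 2)) = dist x (1 / 2)"
          by (simp only: dist_minus dist_of_real)
        ultimately show "\<exists>x'\<in>U. x' \<noteq> - complex_of_real (1 / 2) \<and> dist x' (- complex_of_real (1 / 2)) < e"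
          using x unfolding U_def by (metis imageI)
      qed
    qed
    show "xi0 z - xi0 (1 - z) = 0" if "z \<in> U" for z
      using that xi0_functional_equation_real by (auto simp: U_def)
    show "s \<in> S" using assms by (simp add: S_def)
  qed
  then show ?thesis by simp
qed

text \<open>The two branches agree on the strip -1 < Re s < 2, so the seam at Re s = -1 is not a
  singularity.\<close>

definition xi1 :: "complex \<Rightarrow> complex" where
  "xi1 s = (if Re s > - 1 then xi0 s else xi0 (1 - s))"

lemma xi1_symmetric: "xi1 (1 - s) = xi1 s"
  using xi0_functional_equation[of s] by (auto simp: xi1_def)

lemma xi1_holomorphic: "xi1 holomorphic_on UNIV"
proof -
  have "xi1 holomorphic_on {s. Re s > - 1}"
    by (rule holomorphic_transform[OF holomorphic_on_subset[OF xi0_holomorphic]]) (auto simp: xi1_def)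
  moreover have "xi1 holomorphic_on {s. Re s < 2}"
  proof (rule holomorphic_transform)
    show "(\<lambda>s. xi0 (1 - s)) holomorphic_on {s. Re s < 2}"
      by (rule holomorphic_on_compose_gen[OF _ xi0_holomorphic, unfolded o_def])
         (auto intro!: holomorphic_intros)
    show "xi0 (1 - s) = xi1 s" if "s \<in> {s. Re s < 2}" for s
      using that xi0_functional_equation[of s] by (auto simp: xi1_def)
  qed
  ultimately have "xi1 holomorphic_on ({s. Re s > - 1} \<union> {s. Re s < 2})"
    by (intro holomorphic_on_Un open_halfspace_Re_gt open_halfspace_Re_lt)
  also have "{s. Re s > - 1} \<union> {s. Re s < 2} = (UNIV :: complex set)" by auto
  finally show ?thesis .
qed

text \<open>With the reciprocal Gamma function the identity holds on the whole plane, poles of Gamma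
  included. It follows from the half-plane by continuation, and it expresses \<open>zeta\<close> as
  \<open>xi\<close> times a holomorphic factor away from 1.\<close>

lemma rGamma_times_xi1: "rGamma (1 + s / 2) * xi1 s = of_real pi powr (- s / 2) * zeta_reg s"
proof (rule analytic_continuation_open[of "{s. Re s > - 1}" UNIV "\<lambda>s. rGamma (1 + s / 2) * xi1 s"])
  show "{s. Re s > - 1} \<noteq> {}" by (auto intro!: exI[of _ 0])
  show "(\<lambda>s. rGamma (1 + s / 2) * xi1 s) holomorphic_on UNIV"
    by (intro holomorphic_intros xi1_holomorphic) auto
  show "(\<lambda>s. of_real pi powr (- s / 2) * zeta_reg s) holomorphic_on UNIV"
    by (intro holomorphic_intros zeta_reg_holomorphic) auto
  fix z :: complex assume z: "z \<in> {s. Re s > - 1}"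
  have "1 + z / 2 \<notin> \<int>\<^sub>\<le>\<^sub>0"
    using z by (intro Re_pos_not_nonpos_Ints) simp
  then have "rGamma (1 + z / 2) * Gamma (1 + z / 2) = 1"
    by (simp add: rGamma_inverse_Gamma Gamma_eq_zero_iff)
  then show "rGamma (1 + z / 2) * xi1 z = of_real pi powr (- z / 2) * zeta_reg z"
    using z by (simp add: xi1_def xi0_def)
qed (auto intro: open_halfspace_Re_gt)

lemma xi1_eq_completed_zeta:
  assumes "s \<noteq> 1" "s / 2 \<notin> \<int>\<^sub>\<le>\<^sub>0"
  shows "xi1 s = 1 / 2 * afac s * zeta s"
proof -
  have n: "1 + s / 2 \<notin> \<int>\<^sub>\<le>\<^sub>0"
  proof
    assume "1 + s / 2 \<in> \<int>\<^sub>\<le>\<^sub>0"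
    then obtain k where k: "1 + s / 2 = of_int k" "k \<le> 0" by (auto elim: nonpos_Ints_cases)
    have "s / 2 = of_int (k - 1)" using k(1) by (simp add: algebra_simps)
    also have "\<dots> \<in> \<int>\<^sub>\<le>\<^sub>0" using k(2) by (intro nonpos_Ints_of_int) simp
    finally show False using assms(2) by simp
  qed
  have "xi1 s = Gamma (1 + s / 2) * (rGamma (1 + s / 2) * xi1 s)"
    using n by (simp add: rGamma_inverse_Gamma Gamma_eq_zero_iff)
  also have "\<dots> = Gamma (1 + s / 2) * (of_real pi powr (- s / 2) * ((s - 1) * zeta s))"
    unfolding rGamma_times_xi1 using assms by (simp add: zeta_reg_def)
  also have "Gamma (1 + s / 2) = s / 2 * Gamma (s / 2)"
    using Gamma_plus1[OF assms(2)] by (simp add: add.commute)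
  finally show ?thesis by (simp add: afac_def mult_ac)
qed

lemma xi_eq_xi1: "xi = xi1"
proof
  fix z
  \<comment> \<open>The points where the defining product has a singularity or a default value: 1, 0
    and the negative even integers. They are isolated, so the limit that defines \<open>xi\<close>
    can be taken along points where the product equals \<open>xi1\<close>.\<close>
  define B where "B = {s::complex. s = 1 \<or> s / 2 \<in> \<int>\<^sub>\<le>\<^sub>0}"
  have "\<not> z islimpt B"
  proof
    assume "z islimpt B"
    then have "infinite (B \<inter> ball z 1)" by (simp add: islimpt_eq_infinite_ball)
    moreover have "B \<inter> ball z 1 \<subseteq> insert 1 ((\<lambda>k. 2 * of_int k) ` {- \<lceil>cmod z + 1\<rceil>..\<lceil>cmod z + 1\<rceil>})"
    proof
      fix s assume s: "s \<in> B \<inter> ball z 1"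
      show "s \<in> insert 1 ((\<lambda>k. 2 * of_int k) ` {- \<lceil>cmod z + 1\<rceil>..\<lceil>cmod z + 1\<rceil>})"
      proof (cases "s = 1")
        case False
        then obtain k where k: "s / 2 = of_int k" using s by (auto simp: B_def elim: nonpos_Ints_cases)
        have s2: "s = 2 * of_int k" using k by (simp add: field_simps)
        have "cmod s \<le> cmod z + cmod (s - z)" using norm_triangle_sub[of s z] by simp
        also have "cmod (s - z) < 1" using s by (simp add: dist_norm norm_minus_commute)
        finally have "cmod s < cmod z + 1" by simp
        moreover have "cmod s = 2 * \<bar>real_of_int k\<bar>" unfolding s2 norm_mult by simp
        ultimately have "\<bar>real_of_int k\<bar> \<le> cmod z + 1" by linarith
        then have "k \<in> {- \<lceil>cmod z + 1\<rceil>..\<lceil>cmod z + 1\<rceil>}" by (simp add: abs_le_iff) linarith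
        then show ?thesis using s2 by blast
      qed simp
    qed
    ultimately show False by (meson finite_atLeastAtMost_int finite_imageI finite_insert finite_subset)
  qed
  then have "eventually (\<lambda>s. s \<notin> B) (at z)" by (simp add: islimpt_iff_eventually)
  then have ev: "eventually (\<lambda>s. xi1 s = 1 / 2 * afac s * zeta s) (at z)"
  proof eventually_elim
    case (elim s)
    then show ?case using xi1_eq_completed_zeta[of s] by (simp add: B_def)
  qed
  have "isCont xi1 z"
    using holomorphic_on_imp_continuous_on[OF xi1_holomorphic] by (simp add: continuous_on_eq_continuous_at)
  then have "xi1 \<midarrow>z\<rightarrow> xi1 z" by (simp add: isCont_def)
  then have "(\<lambda>s. 1 / 2 * afac s * zeta s) \<midarrow>z\<rightarrow> xi1 z" using ev by (simp add: tendsto_cong)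
  then show "xi z = xi1 z" unfolding xi_def by (rule remove_sings_eqI)
qed

lemma xi_holomorphic: "xi holomorphic_on UNIV"
  unfolding xi_eq_xi1 by (rule xi1_holomorphic)

lemma xi_symmetric: "xi (1 - s) = xi s"
  unfolding xi_eq_xi1 by (rule xi1_symmetric)

lemma xi_eq:
  assumes "Re s > - 1"
  shows "xi s = of_real pi powr (- s / 2) * Gamma (1 + s / 2) * zeta_reg s"
  using assms by (simp add: xi_eq_xi1 xi1_def xi0_def)

lemma xi_eq_0_iff:
  assumes "Re s > - 1"
  shows "xi s = 0 \<longleftrightarrow> s \<noteq> 1 \<and> zeta s = 0"
  using assms Gamma_neq_0_halfplane[of "1 + s / 2"] by (simp add: xi_eq zeta_reg_def)

text \<open>\<open>RH\<close> concerns nonreal zeros, so real ones have to be excluded directly. For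
  0 < x < 1 the trapezoidal errors are compared with a telescoping series, which gives
  \<open>x \<le> Re (zeta_reg x)\<close>.\<close>

lemma zeta_reg_real_pos:
  fixes x :: real
  assumes x: "x > 0"
  shows "zeta_reg (of_real x) \<noteq> 0"
proof -
  consider "x = 1" | "x > 1" | "x < 1" by linarith
  then show ?thesis
  proof cases
    case 1
    then show ?thesis by (simp add: zeta_reg_def)
  next
    case 2
    have "summable (\<lambda>n. real (Suc n) powr (- x))"
      using summable_real_powr_iff[of "- x"] 2 by (subst summable_Suc_iff) simp
    then have "(\<lambda>n. real (Suc n) powr (- x)) sums (\<Sum>n. real (Suc n) powr (- x))" by (rule summable_sums)
    then have "(\<lambda>n. complex_of_real (real (Suc n) powr (- x))) sums of_real (\<Sum>n. real (Suc n) powr (- x))"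
      by (rule sums_of_real)
    moreover have "(\<lambda>n. complex_of_real (real (Suc n) powr (- x))) sums zeta (of_real x)"
      using zeta_sums[of "of_real x"] 2 unfolding of_real_minus[symmetric] of_nat_powr_of_real by simp
    ultimately have "zeta (of_real x) = of_real (\<Sum>n. real (Suc n) powr (- x))" by (rule sums_unique2[symmetric])
    moreover have "(\<Sum>n. real (Suc n) powr (- x)) > 0"
      by (rule suminf_pos) (use \<open>summable _\<close> in auto)
    ultimately show ?thesis using 2 by (simp add: zeta_reg_def)
  next
    case 3
    define e where "e = (\<lambda>n. real (Suc (Suc n)) powr (1 - x) - real (Suc n) powr (1 - x)
       - (1 - x) * (real (Suc n) powr (- x) + real (Suc (Suc n)) powr (- x)) / 2)"
    have "zeta_err n (of_real x) = of_real (e n)" for n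
    proof -
      have r: "1 - complex_of_real x = of_real (1 - x)" "- complex_of_real x = of_real (- x)" by simp_all
      show ?thesis unfolding zeta_err_eq r of_nat_powr_of_real e_def
        by (simp only: of_real_diff of_real_mult of_real_add of_real_divide of_real_numeral)
    qed
    then have "(\<lambda>n. complex_of_real (e n)) sums (zeta_reg (of_real x) - (1 + of_real x) / 2)"
      using zeta_err_sums[of "of_real x"] x by simp
    from sums_Re[OF this] have e: "e sums (Re (zeta_reg (of_real x)) - (1 + x) / 2)" by simp
    \<comment> \<open>The comparison series. By the mean value theorem the difference of the powers
      with exponent \<open>1 - x\<close> is at least \<open>1 - x\<close> times the value of
      \<open>z powr (- x)\<close> at the right endpoint; subtracting the average of the endpoint
      values leaves half the increment.\<close>
    have t: "(\<lambda>n. (1 - x) / 2 * (real (Suc (Suc n)) powr (- x) - real (Suc n) powr (- x))) sums ((1 - x) / 2 * (0 - real (Suc 0) powr (- x)))"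
    proof (intro sums_mult telescope_sums)
      have "(\<lambda>n. real n powr (- x)) \<longlonglongrightarrow> 0"
        using x by (intro tendsto_neg_powr filterlim_real_sequentially) auto
      then show "(\<lambda>n. real (Suc n) powr (- x)) \<longlonglongrightarrow> 0" by (rule LIMSEQ_Suc)
    qed
    have le: "(1 - x) / 2 * (real (Suc (Suc n)) powr (- x) - real (Suc n) powr (- x)) \<le> e n" for n
    proof -
      have "\<exists>z. real (Suc n) < z \<and> z < real (Suc (Suc n)) \<and> real (Suc (Suc n)) powr (1 - x) - real (Suc n) powr (1 - x)
          = (real (Suc (Suc n)) - real (Suc n)) * ((1 - x) * z powr (1 - x - 1))"
      proof (rule MVT2)
        fix z assume "real (Suc n) \<le> z"
        then have "z > 0" by (simp add: add_pos_nonneg[of 1 "real n"])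
        then show "((\<lambda>z. z powr (1 - x)) has_real_derivative (1 - x) * z powr (1 - x - 1)) (at z)"
          by (rule has_real_derivative_powr)
      qed simp
      then obtain z where z: "real (Suc n) < z" "z < real (Suc (Suc n))"
        "real (Suc (Suc n)) powr (1 - x) - real (Suc n) powr (1 - x) = (1 - x) * z powr (- x)"
        by auto
      have "real (Suc (Suc n)) powr (- x) \<le> z powr (- x)"
        using z x by (intro powr_mono2') auto
      then have "(1 - x) * real (Suc (Suc n)) powr (- x) \<le> (1 - x) * z powr (- x)"
        using 3 by (intro mult_left_mono) auto
      moreover have "(1 - x) / 2 * (q - p) = (1 - x) * q - (1 - x) * (p + q) / 2" for p q
        by (simp add: field_simps)
      ultimately show ?thesis unfolding e_def z(3) by (smt (verit))
    qed
    have "(1 - x) / 2 * (0 - real (Suc 0) powr (- x)) \<le> Re (zeta_reg (of_real x)) - (1 + x) / 2"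
      by (rule sums_le[OF le t e])
    then have "x \<le> Re (zeta_reg (of_real x))" by (simp add: field_simps)
    then show ?thesis using x by auto
  qed
qed

lemma xi_real_neq_0: "xi (of_real x) \<noteq> 0"
proof -
  have 1: "xi (of_real y) \<noteq> 0" if "y > 0" for y
    using zeta_reg_real_pos[OF that] Gamma_neq_0_halfplane[of "1 + of_real y / 2"] that
    by (simp add: xi_eq)
  show ?thesis
  proof (cases "x > 0")
    case False
    then have "xi (of_real (1 - x)) \<noteq> 0" by (intro 1) auto
    then show ?thesis using xi_symmetric[of "of_real x"] by simp
  qed (rule 1)
qed

section \<open>Growth of xi and the passage to the variable s^2\<close>

lemma zeta_reg_bound:
  obtains K where "K > 0" "\<And>s. Re s \<ge> 0 \<Longrightarrow> cmod (zeta_reg s) \<le> K * (1 + cmod s) ^ 3"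
proof -
  have "summable (\<lambda>n. real (Suc n) powr (- 2))"
    using summable_real_powr_iff[of "- 2"] by (subst summable_Suc_iff) simp
  note sm = this
  define S where "S = (\<Sum>n. real (Suc n) powr (- 2))"
  have S: "S \<ge> 0" unfolding S_def by (rule suminf_nonneg[OF sm]) auto
  have "cmod (zeta_reg s) \<le> (1 + S) * (1 + cmod s) ^ 3" if s: "Re s \<ge> 0" for s
  proof -
    define r where "r = cmod s"
    have r: "r \<ge> 0" by (simp add: r_def)
    have c: "cmod (1 - s) \<le> 1 + r" "cmod (1 + s) \<le> 1 + r"
      using norm_triangle_ineq4[of 1 s] norm_triangle_ineq[of 1 s] by (simp_all add: r_def)
    have b: "cmod (zeta_err n s) \<le> (1 + r) ^ 3 * real (Suc n) powr (- 2)" for n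
    proof -
      have "cmod (zeta_err n s) \<le> (cmod (1 - s) * cmod s * cmod (1 + s)) * real (Suc n) powr (- (Re s + 2))"
        using s by (intro zeta_err_bound) auto
      also have "\<dots> \<le> ((1 + r) * (1 + r) * (1 + r)) * real (Suc n) powr (- 2)"
        using s r c by (intro mult_mono powr_mono) (auto simp: r_def)
      finally show ?thesis by (simp add: power3_eq_cube)
    qed
    have sums: "(\<lambda>n. zeta_err n s) sums (zeta_reg s - (1 + s) / 2)"
      using s by (intro zeta_err_sums) auto
    have "cmod (zeta_reg s - (1 + s) / 2) \<le> (\<Sum>n. (1 + r) ^ 3 * real (Suc n) powr (- 2))"
      unfolding sums_unique[OF sums] by (intro norm_suminf_le summable_mult sm b)
    also have "\<dots> = (1 + r) ^ 3 * S" unfolding S_def by (rule suminf_mult[OF sm])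
    finally have "cmod (zeta_reg s) \<le> (1 + r) ^ 3 * S + cmod ((1 + s) / 2)"
      using norm_triangle_sub[of "zeta_reg s" "(1 + s) / 2"] by linarith
    moreover have "cmod ((1 + s) / 2) \<le> (1 + r) ^ 3"
    proof -
      have "cmod ((1 + s) / 2) \<le> 1 + r" using c r by (simp add: norm_divide)
      also have "\<dots> \<le> (1 + r) ^ 3" using r by (intro self_le_power) auto
      finally show ?thesis .
    qed
    ultimately show ?thesis by (simp add: algebra_simps r_def)
  qed
  then show ?thesis using that[of "1 + S"] S by auto
qed

text \<open>The logarithm grows like |s| log |s|, hence like the square root of |s^2| up to a
  logarithm. The half-plane Re s \<ge> 0 suffices because it contains 1/2 + \<open>csqrt w\<close>
  for every w.\<close>

lemma xi_growth:
  obtains C where "C > 0" "\<And>s. Re s \<ge> 0 \<Longrightarrow> cmod (xi s) \<le> C * (1 + cmod s) ^ 3 * (1 + cmod s) powr (1 + cmod s)"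
proof -
  obtain K where K: "K > 0" "\<And>s. Re s \<ge> 0 \<Longrightarrow> cmod (zeta_reg s) \<le> K * (1 + cmod s) ^ 3"
    using zeta_reg_bound by blast
  obtain M where M: "M > 0" "\<And>x::real. x \<ge> 1 \<Longrightarrow> Gamma x \<le> M * x powr x"
    using Gamma_real_growth by blast
  have "cmod (xi s) \<le> (M * K) * (1 + cmod s) ^ 3 * (1 + cmod s) powr (1 + cmod s)" if s: "Re s \<ge> 0" for s
  proof -
    have "cmod (of_real pi powr (- s / 2)) = pi powr (- Re s / 2)"
      by (subst norm_powr_real_powr) auto
    also have "\<dots> \<le> pi powr 0" using s pi_gt3 by (intro powr_mono) auto
    finally have 1: "cmod (of_real pi powr (- s / 2)) \<le> 1" by simp
    define x where "x = 1 + Re s / 2"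
    have x: "1 \<le> x" "x \<le> 1 + cmod s" using s complex_Re_le_cmod[of s] by (auto simp: x_def)
    have "cmod (Gamma (1 + s / 2)) \<le> Gamma x"
      using norm_Gamma_le[of "1 + s / 2"] s by (simp add: x_def)
    also have "\<dots> \<le> M * x powr x" using x by (intro M) auto
    also have "x powr x \<le> (1 + cmod s) powr x" using x by (intro powr_mono2) auto
    also have "\<dots> \<le> (1 + cmod s) powr (1 + cmod s)" using x by (intro powr_mono) auto
    finally have 2: "cmod (Gamma (1 + s / 2)) \<le> M * (1 + cmod s) powr (1 + cmod s)"
      using M(1) by simp
    have "cmod (xi s) = cmod (of_real pi powr (- s / 2)) * cmod (Gamma (1 + s / 2)) * cmod (zeta_reg s)"
      using s by (simp add: xi_eq norm_mult)
    also have "\<dots> \<le> 1 * (M * (1 + cmod s) powr (1 + cmod s)) * (K * (1 + cmod s) ^ 3)"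
      using K(1) M(1) s by (intro mult_mono 1 2 K(2)) auto
    finally show ?thesis by (simp add: mult_ac)
  qed
  then show ?thesis using that[of "M * K"] K(1) M(1) by auto
qed

text \<open>The function \<open>xi (1 / 2 + s)\<close> is even; this is its factorisation through \<open>s\<^sup>2\<close>.\<close>
definition xi_sq :: "complex \<Rightarrow> complex" where
  "xi_sq w = xi (1 / 2 + csqrt w)"

lemma xi_even: "xi (1 / 2 - s) = xi (1 / 2 + s)"
  using xi_symmetric[of "1 / 2 + s"] by (simp add: algebra_simps)

lemma xi_sq_eqI:
  assumes "r\<^sup>2 = w"
  shows "xi_sq w = xi (1 / 2 + r)"
proof -
  have "csqrt w = r \<or> csqrt w = - r" unfolding power2_eq_iff[symmetric] using assms by simp
  then show ?thesis using xi_even[of r] by (auto simp: xi_sq_def)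
qed

lemma xi_sq_square: "xi_sq (s\<^sup>2) = xi (1 / 2 + s)"
  by (rule xi_sq_eqI) simp

text \<open>\<open>csqrt\<close> jumps across the negative axis, where the other root
  \<open>\<i> * csqrt (- w)\<close> is holomorphic; that one jumps across the positive axis. Since
  the choice of root does not affect \<open>xi_sq\<close>, the two cover everything but 0, and the
  singularity at 0 is removable by continuity.\<close>

lemma xi_sq_holomorphic: "xi_sq holomorphic_on UNIV"
proof (rule no_isolated_singularity[of _ _ "{0}"])
  have comp: "(\<lambda>w. xi (1 / 2 + r w)) holomorphic_on A" if "r holomorphic_on A" for r A
    by (rule holomorphic_on_compose_gen[OF _ xi_holomorphic, unfolded o_def]) (auto intro!: holomorphic_intros that)
  have 1: "xi_sq holomorphic_on - \<real>\<^sub>\<le>\<^sub>0"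
    unfolding xi_sq_def by (rule comp) (auto intro!: holomorphic_intros)
  have 2: "xi_sq holomorphic_on - (uminus ` \<real>\<^sub>\<le>\<^sub>0)"
  proof (rule holomorphic_transform)
    show "(\<lambda>w. xi (1 / 2 + \<i> * csqrt (- w))) holomorphic_on - (uminus ` \<real>\<^sub>\<le>\<^sub>0)"
    proof (rule comp)
      have "- w \<notin> \<real>\<^sub>\<le>\<^sub>0" if "w \<in> - (uminus ` \<real>\<^sub>\<le>\<^sub>0)" for w :: complex
        using that by (metis ComplD imageI minus_minus)
      then show "(\<lambda>w. \<i> * csqrt (- w)) holomorphic_on - (uminus ` \<real>\<^sub>\<le>\<^sub>0)"
        by (intro holomorphic_intros) auto
    qed
    show "xi (1 / 2 + \<i> * csqrt (- w)) = xi_sq w" for w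
      by (rule xi_sq_eqI[symmetric]) (simp add: power_mult_distrib)
  qed
  have "closed (uminus ` (\<real>\<^sub>\<le>\<^sub>0 :: complex set))"
    by (intro closed_negations closed_nonpos_Reals_complex)
  then have "xi_sq holomorphic_on (- \<real>\<^sub>\<le>\<^sub>0 \<union> - (uminus ` \<real>\<^sub>\<le>\<^sub>0))"
    by (intro holomorphic_on_Un 1 2) (auto intro: closed_nonpos_Reals_complex)
  moreover have "UNIV - {0} \<subseteq> - \<real>\<^sub>\<le>\<^sub>0 \<union> - (uminus ` (\<real>\<^sub>\<le>\<^sub>0 :: complex set))"
    by (auto simp: complex_nonpos_Reals_iff complex_eq_iff)
  ultimately show hol: "xi_sq holomorphic_on UNIV - {0}" by (rule holomorphic_on_subset)
  have "isCont xi_sq w" for w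
  proof (cases "w = 0")
    case False
    have "continuous_on (UNIV - {0}) xi_sq" by (rule holomorphic_on_imp_continuous_on[OF hol])
    moreover have "open (UNIV - {0::complex})" by auto
    ultimately show ?thesis using False continuous_on_eq_continuous_at by blast
  next
    case True
    have "isCont csqrt 0"
    proof -
      have "((\<lambda>w. cmod (csqrt w)) \<longlongrightarrow> sqrt (cmod 0)) (at (0::complex))"
        unfolding norm_csqrt by (intro tendsto_intros)
      then have "((\<lambda>w. cmod (csqrt w)) \<longlongrightarrow> 0) (at 0)" by (simp only: norm_zero real_sqrt_zero)
      then have "(csqrt \<longlongrightarrow> csqrt 0) (at 0)" unfolding csqrt_0 by (rule tendsto_norm_zero_cancel)
      then show ?thesis unfolding isCont_def .
    qed
    then have 1: "isCont (\<lambda>w. 1 / 2 + csqrt w) 0" by (intro isCont_add continuous_const)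
    have 2: "isCont xi z" for z
      using holomorphic_on_imp_continuous_on[OF xi_holomorphic] by (simp add: continuous_on_eq_continuous_at)
    show ?thesis unfolding xi_sq_def True by (rule isCont_o2[OF 1 2])
  qed
  then show "continuous_on UNIV xi_sq" by (simp add: continuous_on_eq_continuous_at)
qed auto

lemma xi_sq_growth:
  assumes e: "e > 0"
  shows "\<exists>R0. \<forall>w. cmod w \<ge> R0 \<longrightarrow> cmod (xi_sq w) \<le> exp (e * cmod w)"
proof -
  obtain C where C: "C > 0" "\<And>s. Re s \<ge> 0 \<Longrightarrow> cmod (xi s) \<le> C * (1 + cmod s) ^ 3 * (1 + cmod s) powr (1 + cmod s)"
    using xi_growth by blast
  \<comment> \<open>Here \<open>2 + sqrt x\<close> bounds \<open>1 + cmod (1 / 2 + csqrt w)\<close>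
    for \<open>cmod w = x\<close>.\<close>
  have "eventually (\<lambda>x. C * (2 + sqrt x) ^ 3 * (2 + sqrt x) powr (2 + sqrt x) \<le> exp (e * x)) at_top"
    using e C(1) by real_asymp
  then obtain R0 where R0: "\<And>x. x \<ge> R0 \<Longrightarrow> C * (2 + sqrt x) ^ 3 * (2 + sqrt x) powr (2 + sqrt x) \<le> exp (e * x)"
    unfolding eventually_at_top_linorder by blast
  have "cmod (xi_sq w) \<le> exp (e * cmod w)" if w: "cmod w \<ge> R0" for w
  proof -
    define s where "s = 1 / 2 + csqrt w"
    have Re: "Re s \<ge> 0" using csqrt_principal[of w] by (auto simp: s_def)
    have s: "1 + cmod s \<le> 2 + sqrt (cmod w)"
      using norm_triangle_ineq[of "1 / 2" "csqrt w"] by (simp add: s_def)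
    have "cmod (xi_sq w) = cmod (xi s)" by (simp add: xi_sq_def s_def)
    also have "\<dots> \<le> C * (1 + cmod s) ^ 3 * (1 + cmod s) powr (1 + cmod s)" by (rule C(2)[OF Re])
    also have "\<dots> \<le> C * (2 + sqrt (cmod w)) ^ 3 * (2 + sqrt (cmod w)) powr (2 + sqrt (cmod w))"
    proof (intro mult_mono power_mono)
      have "(1 + cmod s) powr (1 + cmod s) \<le> (2 + sqrt (cmod w)) powr (1 + cmod s)"
        using s by (intro powr_mono2) auto
      also have "\<dots> \<le> (2 + sqrt (cmod w)) powr (2 + sqrt (cmod w))"
        using s by (intro powr_mono) auto
      finally show "(1 + cmod s) powr (1 + cmod s) \<le> (2 + sqrt (cmod w)) powr (2 + sqrt (cmod w))" .
    qed (use s C(1) in auto)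
    also have "\<dots> \<le> exp (e * cmod w)" by (rule R0[OF w])
    finally show ?thesis .
  qed
  then show ?thesis by blast
qed

subsection \<open>Hadamard factorisation of functions of order less than one\<close>

text \<open>The map v -> v/(2A - v) sends the half-plane Re v < A into the unit disc, so Schwarz's
  lemma applies to its composition with \<open>h\<close>, after rescaling the disc.\<close>

lemma borel_caratheodory:
  assumes hol: "h holomorphic_on ball 0 R" and h0: "h 0 = 0"
    and Re: "\<And>z. cmod z < R \<Longrightarrow> Re (h z) < A" and A: "A > 0" and z: "cmod z < R"
  shows "cmod (h z) \<le> 2 * A * cmod z / (R - cmod z)"
proof -
  have R: "R > 0" using z norm_ge_zero[of z] by linarith
  define g where "g = (\<lambda>u. h (of_real R * u) / (2 * of_real A - h (of_real R * u)))"
  have norm_R: "cmod (of_real R * u) < R" if "cmod u < 1" for u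
    using that R by (simp add: norm_mult)
  have less: "cmod (h u) < cmod (2 * of_real A - h u)" if "cmod u < R" for u
  proof -
    have "(2 * A - Re (h u))\<^sup>2 - (Re (h u))\<^sup>2 = 4 * A * (A - Re (h u))"
      by (simp add: power2_eq_square algebra_simps)
    also have "\<dots> > 0" using Re[OF that] A by simp
    finally have "(cmod (h u))\<^sup>2 < (cmod (2 * of_real A - h u))\<^sup>2"
      by (simp add: cmod_power2)
    then show ?thesis by (rule power2_less_imp_less) simp
  qed
  have holh: "(\<lambda>u. h (of_real R * u)) holomorphic_on ball 0 1"
    by (rule holomorphic_on_compose_gen[OF _ hol, unfolded o_def]) (auto intro!: holomorphic_intros norm_R)
  have ne: "2 * of_real A - h (of_real R * u) \<noteq> 0" if "cmod u < 1" for u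
    using less[OF norm_R[OF that]] by (metis norm_ge_zero norm_zero not_le)
  have g1: "g holomorphic_on ball 0 1"
    unfolding g_def using ne by (intro holomorphic_intros holh) auto
  have g2: "g 0 = 0" by (simp add: g_def h0)
  have g3: "cmod (g u) < 1" if "cmod u < 1" for u
    using less[OF norm_R[OF that]] ne[OF that] by (simp add: g_def norm_divide divide_less_eq)
  define u where "u = z / of_real R"
  have u: "cmod u < 1" "of_real R * u = z" using z R by (auto simp: u_def norm_divide)
  have gu: "cmod (g u) \<le> cmod u" by (rule Schwarz_Lemma(1)[OF g1 g2 g3 u(1)])
  have gh: "g u * (2 * of_real A - h z) = h z"
    using ne[OF u(1)] by (simp add: g_def u(2))
  have "cmod (h z) = cmod (g u) * cmod (2 * of_real A - h z)"
    using arg_cong[OF gh, of cmod] by (simp add: norm_mult)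
  also have "\<dots> \<le> cmod u * (2 * A + cmod (h z))"
    using gu A norm_triangle_ineq4[of "2 * of_real A" "h z"] by (intro mult_mono) (auto simp: norm_mult)
  finally have "cmod (h z) * (1 - cmod u) \<le> cmod u * (2 * A)" by (simp add: algebra_simps)
  then have "cmod (h z) * (R * (1 - cmod u)) \<le> R * cmod u * (2 * A)"
    using R by (simp add: mult.left_commute[of _ R] mult.assoc)
  moreover have "R * cmod u = cmod z" using R by (simp add: u_def norm_divide)
  ultimately have "cmod (h z) * (R - cmod z) \<le> cmod z * (2 * A)" by (simp add: right_diff_distrib)
  then show ?thesis using z by (simp add: pos_le_divide_eq mult_ac)
qed

lemma entire_factor_zero:
  assumes f: "f holomorphic_on UNIV" and z: "f z = 0" and w: "f w \<noteq> 0"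
  obtains n g where "g holomorphic_on UNIV" "g z \<noteq> 0" "n > 0" "\<And>u. f u = (u - z) ^ n * g u"
proof -
  obtain g r n where g: "0 < n" "0 < r" "g holomorphic_on ball z r"
     "\<And>u. u \<in> ball z r \<Longrightarrow> f u = (u - z) ^ n * g u" "\<And>u. u \<in> ball z r \<Longrightarrow> g u \<noteq> 0"
    using holomorphic_factor_zero_nonconstant[OF f open_UNIV connected_UNIV UNIV_I z]
    using z w unfolding constant_on_def by (metis UNIV_I)
  define G where "G = (\<lambda>u. if u \<in> ball z r then g u else f u / (u - z) ^ n)"
  have G: "f u = (u - z) ^ n * G u" for u
    using g by (cases "u = z") (auto simp: G_def z)
  have "G holomorphic_on ball z r"
    using g(3) by (rule holomorphic_transform) (simp add: G_def)
  moreover have "G holomorphic_on - {z}"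
  proof (rule holomorphic_transform)
    show "(\<lambda>u. f u / (u - z) ^ n) holomorphic_on - {z}"
      by (intro holomorphic_intros holomorphic_on_subset[OF f]) auto
    show "f u / (u - z) ^ n = G u" if "u \<in> - {z}" for u
      using G[of u] that by simp
  qed
  ultimately have "G holomorphic_on (ball z r \<union> - {z})"
    by (intro holomorphic_on_Un) auto
  also have "ball z r \<union> - {z} = UNIV" using g(2) by auto
  finally have "G holomorphic_on UNIV" .
  moreover have "G z \<noteq> 0" using g(2,5) by (simp add: G_def)
  ultimately show ?thesis using that g(1) G by blast
qed

text \<open>A list, so that a zero can be repeated according to its multiplicity; the factors are
  normalised at the origin.\<close>

definition zprod :: "complex list \<Rightarrow> complex \<Rightarrow> complex" where
  "zprod zs w = (\<Prod>z\<leftarrow>zs. 1 - w / z)"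

lemma zprod_simps [simp]: "zprod [] w = 1" "zprod (z # zs) w = (1 - w / z) * zprod zs w"
  by (simp_all add: zprod_def)

lemma zprod_append: "zprod (xs @ ys) w = zprod xs w * zprod ys w"
  by (induction xs) auto

lemma zprod_replicate: "zprod (replicate n z) w = (1 - w / z) ^ n"
  by (induction n) auto

lemma zprod_0 [simp]: "zprod zs 0 = 1"
  by (induction zs) auto

text \<open>Zeros are divided out one at a time. The set \<open>K\<close> will be a disc in the
  factorisation theorem and the whole plane in the proof that there are infinitely many
  ordinates.\<close>

lemma entire_factor_finite_zeros:
  assumes "finite Z" "f holomorphic_on UNIV" "f 0 \<noteq> 0" "{z \<in> K. f z = 0} = Z"
  shows "\<exists>zs g. g holomorphic_on UNIV \<and> set zs = Z \<and> (\<forall>w. f w = zprod zs w * g w) \<and> (\<forall>w\<in>K. g w \<noteq> 0)"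
  using assms
proof (induction Z arbitrary: f rule: finite_induct)
  case empty
  then show ?case by (intro exI[of _ "[]"] exI[of _ f]) auto
next
  case (insert z Z)
  have fz: "f z = 0" "z \<in> K" using insert.prems(3) by auto
  have z0: "z \<noteq> 0" using fz insert.prems(2) by auto
  obtain n g where g: "g holomorphic_on UNIV" "g z \<noteq> 0" "n > 0" "\<And>u. f u = (u - z) ^ n * g u"
    using entire_factor_zero[OF insert.prems(1) fz(1) insert.prems(2)] by metis
  have "g 0 \<noteq> 0" using g(4)[of 0] insert.prems(2) by auto
  moreover have "{u \<in> K. g u = 0} = Z"
  proof -
    have "{u \<in> K. g u = 0} = {u \<in> K. f u = 0} - {z}" using g by auto
    then show ?thesis using insert by auto
  qed
  ultimately obtain zs h where h: "h holomorphic_on UNIV" "set zs = Z" "\<And>w. g w = zprod zs w * h w"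
     "\<And>w. w \<in> K \<Longrightarrow> h w \<noteq> 0"
    using insert.IH[OF g(1)] by blast
  show ?case
  \<comment> \<open>The factor \<open>(- z) ^ n\<close> converts \<open>(w - z) ^ n\<close> into the
    normalised \<open>(1 - w / z) ^ n\<close>.\<close>
  proof (intro exI[of _ "replicate n z @ zs"] exI[of _ "\<lambda>w. (- z) ^ n * h w"] conjI allI ballI)
    show "(\<lambda>w. (- z) ^ n * h w) holomorphic_on UNIV" by (intro holomorphic_intros h)
    show "set (replicate n z @ zs) = insert z Z" using g(3) h(2) by auto
    show "f w = zprod (replicate n z @ zs) w * ((- z) ^ n * h w)" for w
    proof -
      have "(w - z) ^ n = (1 - w / z) ^ n * (- z) ^ n"
        using z0 by (simp add: power_mult_distrib[symmetric] field_simps)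
      then show ?thesis by (simp add: g(4) h(3) zprod_append zprod_replicate)
    qed
    show "(- z) ^ n * h w \<noteq> 0" if "w \<in> K" for w using h(4)[OF that] z0 by simp
  qed
qed

lemma norm_zprod_ge_1:
  assumes "\<And>z. z \<in> set zs \<Longrightarrow> 2 * cmod z \<le> cmod w \<and> z \<noteq> 0"
  shows "cmod (zprod zs w) \<ge> 1"
  using assms
proof (induction zs)
  case (Cons z zs)
  have "2 \<le> cmod (w / z)" using Cons.prems[of z] by (simp add: norm_divide pos_le_divide_eq)
  then have "1 \<le> cmod (1 - w / z)" using norm_triangle_ineq2[of "w / z" 1] by (simp add: norm_minus_commute)
  then show ?case using Cons by (simp add: norm_mult mult_ge1_I)
qed simp

text \<open>
  Dividing by the finite product over the zeros in a disc of radius \<open>R\<close> does not increase the modulus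
  on the circle of radius \<open>2 R\<close>, so the quotient has a logarithm on the disc whose real part is
  at most a small multiple of \<open>R\<close>, and Borel-Caratheodory makes it nearly constant near the origin.
\<close>
lemma hadamard_factorization:
  assumes f: "f holomorphic_on UNIV" and f0: "f 0 \<noteq> 0"
    and growth: "\<And>e. e > 0 \<Longrightarrow> \<exists>R0. \<forall>w. cmod w \<ge> R0 \<longrightarrow> cmod (f w) \<le> exp (e * cmod w)"
  obtains zs where "\<And>n. set (zs n) = {z. f z = 0 \<and> cmod z \<le> real n}"
    "\<And>w. (\<lambda>n. f 0 * zprod (zs n) w) \<longlonglongrightarrow> f w"
proof -
  have "\<exists>zs g. g holomorphic_on UNIV \<and> set zs = {z. f z = 0 \<and> cmod z \<le> real n} \<and>
          (\<forall>w. f w = zprod zs w * g w) \<and> (\<forall>w\<in>cball 0 (real n). g w \<noteq> 0)" for n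
  proof -
    have "finite {z \<in> cball 0 (real n). f z = 0}"
    proof (cases "f constant_on UNIV")
      case True
      then have "{z \<in> cball 0 (real n). f z = 0} = {}" using f0 by (auto simp: constant_on_def)
      then show ?thesis by (simp only: finite.emptyI)
    next
      case False
      then show ?thesis using holomorphic_compact_finite_zeros[OF f open_UNIV connected_UNIV compact_cball subset_UNIV] by blast
    qed
    then show ?thesis
      using entire_factor_finite_zeros[OF _ f f0, of "{z \<in> cball 0 (real n). f z = 0}" "cball 0 (real n)"]
      by (auto simp: conj_commute)
  qed
  then obtain zs g where zs: "\<And>n. set (zs n) = {z. f z = 0 \<and> cmod z \<le> real n}"
    and g: "\<And>n. g n holomorphic_on UNIV" "\<And>n w. f w = zprod (zs n) w * g n w"
      "\<And>n w. cmod w \<le> real n \<Longrightarrow> g n w \<noteq> 0"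
    by (metis mem_cball_0)
  have g0: "g n 0 = f 0" for n using g(2)[of 0 n] by simp
  have "(\<lambda>n. g n w / f 0) \<longlonglongrightarrow> 1" for w
  proof -
    have "\<exists>h. eventually (\<lambda>n. g n w / f 0 = exp (h n) \<and> cmod (h n) \<le> e) sequentially" if e: "e > 0" for e
    proof -
      \<comment> \<open>The constant 12 comes from Borel-Caratheodory with real part below
        \<open>3 * d * R\<close> and \<open>R - cmod w\<close> at least
        \<open>R / 2\<close>.\<close>
      define d where "d = e / (12 * (cmod w + 1))"
      have d: "d > 0" using e by (simp add: d_def add_nonneg_pos)
      obtain R0 where R0: "\<And>w. cmod w \<ge> R0 \<Longrightarrow> cmod (f w) \<le> exp (d * cmod w)"
        using growth[OF d] by blast
      define L where "L = \<bar>ln (cmod (f 0))\<bar>"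
      \<comment> \<open>The three conditions on n make the growth bound valid on the circle of
        radius 2R, put the constant \<open>L\<close> below \<open>d * R\<close>, and place
        \<open>w\<close> within R/2 of the origin.\<close>
      have "\<exists>h. g n w / f 0 = exp h \<and> cmod h \<le> e" 
        if n: "real n \<ge> R0" "real n > L / d" "real n \<ge> 2 * (cmod w + 1)" for n
      proof -
        define R where "R = real n"
        have "R > cmod w" using n(3) norm_ge_zero[of w] unfolding R_def by (smt (verit))
        moreover from this have "R > 0" using norm_ge_zero[of w] by linarith
        ultimately have R: "R > 0" "R > cmod w" by simp_all
        have bd: "cmod (g n u) \<le> exp (2 * d * R)" if u: "cmod u \<le> 2 * R" for u
        proof (rule maximum_modulus_frontier[of "g n" "cball 0 (2 * R)"])
          show "g n holomorphic_on interior (cball 0 (2 * R))" "continuous_on (closure (cball 0 (2 * R))) (g n)"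
            using g(1) by (auto intro: holomorphic_on_subset holomorphic_on_imp_continuous_on)
          fix v :: complex assume "v \<in> frontier (cball 0 (2 * R))"
          then have v: "cmod v = 2 * R" using R by simp
          have "cmod (g n v) * 1 \<le> cmod (g n v) * cmod (zprod (zs n) v)"
            by (intro mult_left_mono norm_zprod_ge_1) (use v f0 zs in \<open>auto simp: R_def\<close>)
          also have "\<dots> = cmod (f v)" using g(2)[of v n] by (simp add: norm_mult mult.commute)
          also have "\<dots> \<le> exp (d * cmod v)" using n(1) R v by (intro R0) (simp add: R_def)
          finally show "cmod (g n v) \<le> exp (2 * d * R)" using v by (simp add: mult_ac)
        qed (use u R in auto)
        obtain H where H: "H holomorphic_on ball 0 R" "\<And>u. u \<in> ball 0 R \<Longrightarrow> g n u = exp (H u)"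
        proof (rule holomorphic_logarithm_exists)
          show "g n holomorphic_on ball 0 R" using g(1) by (rule holomorphic_on_subset) simp
          show "g n u \<noteq> 0" if "u \<in> ball 0 R" for u using g(3)[of u n] that by (simp add: R_def)
          show "0 \<in> ball 0 R" using R by simp
        qed (auto simp: eq_commute)
        define h where "h = (\<lambda>u. H u - H 0)"
        have gh: "g n u / f 0 = exp (h u)" if "cmod u < R" for u
          using H(2)[of u] H(2)[of 0] R that by (simp add: h_def exp_diff flip: g0[of n])
        have "cmod (h w) \<le> 2 * (3 * d * R) * cmod w / (R - cmod w)"
        proof (rule borel_caratheodory)
          show "h holomorphic_on ball 0 R" unfolding h_def by (intro holomorphic_intros H)
          fix u assume u: "cmod u < R"
          have "exp (Re (h u)) = cmod (g n u) / cmod (f 0)"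
            using arg_cong[OF gh[OF u], of cmod] by (simp add: norm_divide)
          also have "\<dots> \<le> exp (2 * d * R) / cmod (f 0)"
            using bd[of u] u R by (intro divide_right_mono) auto
          also have "\<dots> = exp (2 * d * R - ln (cmod (f 0)))"
            using f0 by (simp add: exp_diff)
          finally have "Re (h u) \<le> 2 * d * R - ln (cmod (f 0))" by simp
          also have "\<dots> \<le> 2 * d * R + L" unfolding L_def by linarith
          also have "L < d * R" using n(2) d by (simp add: R_def pos_divide_less_eq mult.commute)
          finally show "Re (h u) < 3 * d * R" by (simp add: mult_ac)
        qed (use R d in \<open>auto simp: h_def\<close>)
        also have "\<dots> \<le> 2 * (3 * d * R) * cmod w / (R / 2)"
          using n(3) R d by (intro divide_left_mono) (auto simp: R_def)
        also have "\<dots> = 12 * d * cmod w" using R by simp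
        also have "\<dots> \<le> 12 * d * (cmod w + 1)" using d by (intro mult_left_mono) auto
        also have "\<dots> = e" 
        proof -
          define X where "X = cmod w + 1"
          have "X > 0" by (simp add: X_def add_nonneg_pos)
          then show ?thesis unfolding d_def X_def[symmetric] by simp
        qed
        finally show ?thesis using gh R by blast
      qed
      moreover have "eventually (\<lambda>n. real n \<ge> R0 \<and> real n > L / d \<and> real n \<ge> 2 * (cmod w + 1)) sequentially"
        by (intro eventually_conj filterlim_real_sequentially[unfolded filterlim_at_top, rule_format]
             filterlim_real_sequentially[unfolded filterlim_at_top_dense, rule_format])
      ultimately have "eventually (\<lambda>n. \<exists>h. g n w / f 0 = exp h \<and> cmod h \<le> e) sequentially"
        by (auto elim!: eventually_mono)
      then show ?thesis by (simp add: eventually_ex)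
    qed
    note ev = this
    show ?thesis
    proof (rule tendstoI)
      fix e :: real assume e: "e > 0"
      have "isCont (exp :: complex \<Rightarrow> complex) 0" by simp
      then obtain d where d: "d > 0" "\<And>x. cmod x < d \<Longrightarrow> dist (exp x) (1::complex) < e"
        using e unfolding continuous_at_eps_delta by (auto simp: dist_norm)
      obtain h where h: "eventually (\<lambda>n. g n w / f 0 = exp (h n) \<and> cmod (h n) \<le> d / 2) sequentially"
        using ev[of "d / 2"] d(1) by auto
      then show "eventually (\<lambda>n. dist (g n w / f 0) 1 < e) sequentially"
      proof eventually_elim
        case (elim n)
        then have "dist (exp (h n)) 1 < e" using d by (intro d(2)) linarith
        with elim show ?case by simp
      qed
    qed
  qed
  note lim = this
  have "(\<lambda>n. f 0 * zprod (zs n) w) \<longlonglongrightarrow> f w" for w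
  proof -
    have "(\<lambda>n. f w / (g n w / f 0)) \<longlonglongrightarrow> f w / 1" by (intro tendsto_intros lim) simp
    moreover have "eventually (\<lambda>n. f w / (g n w / f 0) = f 0 * zprod (zs n) w) sequentially"
      using eventually_ge_at_top[of "nat \<lceil>cmod w\<rceil>"]
    proof eventually_elim
      case (elim n)
      then have "cmod w \<le> real n" by linarith
      then have "g n w \<noteq> 0" by (rule g(3))
      then show ?case using g(2)[of w n] f0 by (simp add: field_simps)
    qed
    ultimately show ?thesis by (simp add: tendsto_cong)
  qed
  then show ?thesis using that zs by blast
qed

lemma xi_sq_product:
  obtains zs where "\<And>n. set (zs n) = {z. xi_sq z = 0 \<and> cmod z \<le> real n}"
    "\<And>w. (\<lambda>n. xi (1 / 2) * zprod (zs n) w) \<longlonglongrightarrow> xi_sq w"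
proof -
  have 0: "xi_sq 0 = xi (1 / 2)" by (simp add: xi_sq_def)
  have "xi (of_real (1 / 2)) \<noteq> 0" by (rule xi_real_neq_0)
  then have "xi_sq 0 \<noteq> 0" using 0 by simp
  from hadamard_factorization[OF xi_sq_holomorphic this xi_sq_growth] show ?thesis
    using that 0 by metis
qed

subsection \<open>Consequences of the Riemann hypothesis\<close>

lemma norm_one_plus_divide_ge:
  fixes w :: complex
  assumes g: "g > 0" and w: "Re w \<ge> 0"
  shows "cmod (1 + w / of_real g) \<ge> 1" "cmod (1 + w / of_real g) \<ge> cmod w / g"
proof -
  have "1 \<le> Re (1 + w / of_real g)" using assms by simp
  also have "\<dots> \<le> cmod (1 + w / of_real g)" by (rule complex_Re_le_cmod)
  finally show "cmod (1 + w / of_real g) \<ge> 1" .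
  have "(cmod w / g)\<^sup>2 \<le> (cmod (1 + w / of_real g))\<^sup>2"
    using assms by (simp add: cmod_power2 power_divide power2_sum add_divide_distrib)
  then show "cmod (1 + w / of_real g) \<ge> cmod w / g" by (rule power2_le_imp_le) simp
qed

text \<open>For z = -g with g > 0 and Re w \<ge> 0, the factor 1 + w/g has modulus at least 1 and at
  least |w|/g. One factor can therefore be kept and all others dropped, which turns any single zero
  into a lower bound linear in w.\<close>

lemma norm_zprod_neg_ge:
  assumes "\<And>z. z \<in> set zs \<Longrightarrow> \<exists>g>0. z = - of_real g" and w: "Re w \<ge> 0"
  shows "cmod (zprod zs w) \<ge> 1 \<and> (\<forall>z\<in>set zs. cmod (zprod zs w) \<ge> cmod w / cmod z)"
  using assms(1)
proof (induction zs)
  case (Cons z zs)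
  obtain g where g: "g > 0" "z = - of_real g" using Cons.prems[of z] by auto
  have e: "1 - w / z = 1 + w / of_real g" using g by simp
  have 1: "cmod (1 - w / z) \<ge> 1" "cmod (1 - w / z) \<ge> cmod w / cmod z"
    unfolding e using norm_one_plus_divide_ge[OF g(1) w] g by simp_all
  have IH: "cmod (zprod zs w) \<ge> 1" "\<And>z. z \<in> set zs \<Longrightarrow> cmod (zprod zs w) \<ge> cmod w / cmod z"
    using Cons by auto
  have "cmod (1 - w / z) * cmod (zprod zs w) \<ge> 1" using 1 IH by (intro mult_ge1_I) auto
  moreover have "cmod (1 - w / z) * cmod (zprod zs w) \<ge> cmod w / cmod z"
    using mult_mono[OF 1(2) IH(1)] by simp
  moreover have "cmod (1 - w / z) * cmod (zprod zs w) \<ge> cmod w / cmod y" if "y \<in> set zs" for y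
    using mult_mono[OF 1(1) IH(2)[OF that]] by simp
  ultimately show ?case by (auto simp: norm_mult)
qed simp

text \<open>For z = -g^2 the factor is (s + i g)(s - i g)/g^2, and for fixed imaginary part of s
  both |s + i g| and |s - i g| are smallest on the imaginary axis.\<close>

lemma norm_zprod_mono:
  assumes "\<And>z. z \<in> set zs \<Longrightarrow> \<exists>g>0. z = - of_real (g\<^sup>2)"
  shows "cmod (zprod zs ((\<i> * of_real t)\<^sup>2)) \<le> cmod (zprod zs ((Complex x t)\<^sup>2))"
  using assms
proof (induction zs)
  case (Cons z zs)
  obtain g where g: "g > 0" "z = - of_real (g\<^sup>2)" using Cons.prems[of z] by auto
  have e: "1 - s\<^sup>2 / z = (\<i> * of_real g + s) * (- \<i> * of_real g + s) / of_real (g\<^sup>2)" for s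
    using g by (simp add: field_simps power2_eq_square)
  have im: "Im s = t \<Longrightarrow> \<bar>a + t\<bar> \<le> cmod (\<i> * of_real a + s)" for s a
    using abs_Im_le_cmod[of "\<i> * of_real a + s"] by simp
  have "cmod (\<i> * of_real a + \<i> * of_real t) = \<bar>a + t\<bar>" for a
    by (simp add: norm_mult flip: distrib_left of_real_add)
  then have le: "cmod (\<i> * of_real a + \<i> * of_real t) \<le> cmod (\<i> * of_real a + Complex x t)" for a
    using im[of "Complex x t" a] by simp
  have "cmod (1 - (\<i> * of_real t)\<^sup>2 / z) \<le> cmod (1 - (Complex x t)\<^sup>2 / z)"
    unfolding e norm_divide norm_mult
    using le[of g] le[of "- g"] by (intro divide_right_mono mult_mono) (auto simp: norm_mult)
  then show ?case using Cons by (auto simp: norm_mult intro!: mult_mono)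
qed simp

text \<open>The principal root has non-negative real part, which keeps
  \<open>1 / 2 + csqrt w\<close> away from the trivial zeros; real zeros are excluded by
  \<open>xi_real_neq_0\<close>, so \<open>RH\<close> applies.\<close>

lemma xi_sq_zero:
  assumes "RH" "xi_sq w = 0"
  obtains g where "g \<in> pos_ordinates" "g > 0" "w = - of_real (g\<^sup>2)"
proof -
  define s where "s = csqrt w"
  have pr: "0 < Re s \<or> Re s = 0 \<and> 0 \<le> Im s" unfolding s_def by (rule csqrt_principal)
  have 0: "xi (1 / 2 + s) = 0" using assms(2) by (simp add: xi_sq_def s_def)
  have z: "zeta (1 / 2 + s) = 0" using 0 pr by (subst (asm) xi_eq_0_iff) auto
  have nr: "1 / 2 + s \<notin> \<real>" using 0 xi_real_neq_0 by (auto elim!: Reals_cases)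
  have "Re (1 / 2 + s) = 1 / 2" using assms(1) z nr unfolding RH_def by blast
  then have Re: "Re s = 0" by simp
  have "Im s \<noteq> 0" using nr by (auto simp: complex_is_Real_iff)
  then have g: "Im s > 0" using pr Re by linarith
  have s: "s = \<i> * of_real (Im s)" using Re by (simp add: complex_eq_iff)
  have "w = s\<^sup>2" by (simp add: s_def)
  also have "\<dots> = - of_real ((Im s)\<^sup>2)" by (subst s) (simp add: power_mult_distrib)
  finally have "w = - of_real ((Im s)\<^sup>2)" .
  moreover have "Im s \<in> pos_ordinates"
    unfolding pos_ordinates_def using z g by (intro CollectI exI[of _ "1 / 2 + s"]) simp
  ultimately show ?thesis using that g by blast
qed

lemma pos_ordinates_pos: "g \<in> pos_ordinates \<Longrightarrow> g > 0"
  by (auto simp: pos_ordinates_def)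

lemma pos_ordinates_zeta:
  assumes "RH" "g \<in> pos_ordinates"
  shows "zeta (1 / 2 + \<i> * of_real g) = 0"
proof -
  obtain z where z: "zeta z = 0" "Im z = g" "g > 0" using assms(2) by (auto simp: pos_ordinates_def)
  then have "z \<notin> \<real>" by (auto simp: complex_is_Real_iff)
  then have "Re z = 1 / 2" using assms(1) z unfolding RH_def by blast
  then have "z = 1 / 2 + \<i> * of_real g" using z by (simp add: complex_eq_iff)
  then show ?thesis using z by simp
qed

lemma pos_ordinates_xi:
  assumes "RH" "g \<in> pos_ordinates"
  shows "xi (1 / 2 + \<i> * of_real g) = 0"
  using pos_ordinates_zeta[OF assms] pos_ordinates_pos[OF assms(2)]
  by (subst xi_eq_0_iff) (auto simp: complex_eq_iff)

lemma pos_ordinates_xi_sq: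
  assumes "RH" "g \<in> pos_ordinates"
  shows "xi_sq (- of_real (g\<^sup>2)) = 0"
  using pos_ordinates_xi[OF assms] by (subst xi_sq_eqI[of "\<i> * of_real g"]) (auto simp: power_mult_distrib)

lemma xi_zero_iff:
  assumes "RH"
  shows "xi (1 / 2 + s) = 0 \<longleftrightarrow> (\<exists>g\<in>pos_ordinates. s = \<i> * of_real g \<or> s = - (\<i> * of_real g))"
proof
  assume "xi (1 / 2 + s) = 0"
  then have "xi_sq (s\<^sup>2) = 0" by (simp add: xi_sq_square)
  then obtain g where g: "g \<in> pos_ordinates" "s\<^sup>2 = - of_real (g\<^sup>2)" using xi_sq_zero[OF assms] by blast
  have "s\<^sup>2 = (\<i> * of_real g)\<^sup>2" by (simp add: g power_mult_distrib)
  then show "\<exists>g\<in>pos_ordinates. s = \<i> * of_real g \<or> s = - (\<i> * of_real g)"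
    using g(1) unfolding power2_eq_iff by blast
next
  assume "\<exists>g\<in>pos_ordinates. s = \<i> * of_real g \<or> s = - (\<i> * of_real g)"
  then obtain g where g: "g \<in> pos_ordinates" "s = \<i> * of_real g \<or> s = - (\<i> * of_real g)" by blast
  have "xi (1 / 2 + s) = xi (1 / 2 + \<i> * of_real g)"
    using g(2) xi_even[of "\<i> * of_real g"] by auto
  then show "xi (1 / 2 + s) = 0" using pos_ordinates_xi[OF assms g(1)] by simp
qed

text \<open>The map g -> -g^2 embeds these ordinates into the zeros of \<open>xi_sq\<close> in a
  disc, which are the members of a list.\<close>

lemma finite_pos_ordinates_le:
  assumes "RH"
  shows "finite {g \<in> pos_ordinates. g \<le> T}"
proof -
  obtain zs where zs: "\<And>n. set (zs n) = {z. xi_sq z = 0 \<and> cmod z \<le> real n}"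
    using xi_sq_product by metis
  define n where "n = nat \<lceil>T\<^sup>2\<rceil>"
  have "(\<lambda>g. - complex_of_real (g\<^sup>2)) ` {g \<in> pos_ordinates. g \<le> T} \<subseteq> set (zs n)"
  proof safe
    fix g assume g: "g \<in> pos_ordinates" "g \<le> T"
    have "g\<^sup>2 \<le> T\<^sup>2" using g pos_ordinates_pos[OF g(1)] by (intro power_mono) auto
    also have "\<dots> \<le> real n" unfolding n_def by linarith
    finally show "- complex_of_real (g\<^sup>2) \<in> set (zs n)"
      unfolding zs using pos_ordinates_xi_sq[OF assms g(1)] by (simp add: norm_power)
  qed
  moreover have "inj_on (\<lambda>g. - complex_of_real (g\<^sup>2)) {g \<in> pos_ordinates. g \<le> T}"
  proof (rule inj_onI)
    fix x y assume x: "x \<in> {g \<in> pos_ordinates. g \<le> T}" "y \<in> {g \<in> pos_ordinates. g \<le> T}"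
      and "- complex_of_real (x\<^sup>2) = - complex_of_real (y\<^sup>2)"
    then have "x\<^sup>2 = y\<^sup>2" by (simp only: neg_equal_iff_equal of_real_eq_iff)
    then show "x = y" using x pos_ordinates_pos[of x] pos_ordinates_pos[of y] by (simp add: power2_eq_iff)
  qed
  ultimately show ?thesis by (meson finite_imageD finite_set finite_subset)
qed

lemma xi_monotone:
  assumes "RH"
  shows "cmod (xi (1 / 2 + \<i> * of_real t)) \<le> cmod (xi (1 / 2 + Complex x t))"
proof -
  obtain zs where zs: "\<And>n. set (zs n) = {z. xi_sq z = 0 \<and> cmod z \<le> real n}"
    "\<And>w. (\<lambda>n. xi (1 / 2) * zprod (zs n) w) \<longlonglongrightarrow> xi_sq w"
    using xi_sq_product by blast
  have lim: "(\<lambda>n. cmod (xi (1 / 2)) * cmod (zprod (zs n) (s\<^sup>2))) \<longlonglongrightarrow> cmod (xi (1 / 2 + s))" for s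
    using tendsto_norm[OF zs(2)[of "s\<^sup>2"]] by (simp add: norm_mult xi_sq_square)
  show ?thesis
  proof (rule tendsto_le[OF sequentially_bot lim lim always_eventually], rule allI, rule mult_left_mono)
    show "cmod (zprod (zs n) ((\<i> * of_real t)\<^sup>2)) \<le> cmod (zprod (zs n) ((Complex x t)\<^sup>2))" for n
      using zs(1)[of n] xi_sq_zero[OF assms] by (intro norm_zprod_mono) blast
  qed simp
qed

text \<open>The factor of one ordinate g already contributes |s|^2/g^2, by
  \<open>norm_zprod_neg_ge\<close> with w = s^2. The condition on s^2 describes the double sector
  |Im s| \<le> |Re s|.\<close>

lemma xi_sector_lower_bound:
  assumes "RH" "g \<in> pos_ordinates"
  obtains c where "c > 0" "\<And>s. Re (s\<^sup>2) \<ge> 0 \<Longrightarrow> c * (cmod s)\<^sup>2 \<le> cmod (xi (1 / 2 + s))"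
proof -
  obtain zs where zs: "\<And>n. set (zs n) = {z. xi_sq z = 0 \<and> cmod z \<le> real n}"
    "\<And>w. (\<lambda>n. xi (1 / 2) * zprod (zs n) w) \<longlonglongrightarrow> xi_sq w"
    using xi_sq_product by blast
  have g: "g > 0" using pos_ordinates_pos[OF assms(2)] .
  have xi0: "cmod (xi (1 / 2)) > 0" using xi_real_neq_0[of "1 / 2"] by simp
  have "cmod (xi (1 / 2)) * (cmod (s\<^sup>2) / g\<^sup>2) \<le> cmod (xi (1 / 2 + s))" if s: "Re (s\<^sup>2) \<ge> 0" for s
  proof (rule tendsto_lowerbound)
    show "(\<lambda>n. cmod (xi (1 / 2)) * cmod (zprod (zs n) (s\<^sup>2))) \<longlonglongrightarrow> cmod (xi (1 / 2 + s))"
      using tendsto_norm[OF zs(2)[of "s\<^sup>2"]] by (simp add: norm_mult xi_sq_square)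
    show "eventually (\<lambda>n. cmod (xi (1 / 2)) * (cmod (s\<^sup>2) / g\<^sup>2) \<le> cmod (xi (1 / 2)) * cmod (zprod (zs n) (s\<^sup>2))) sequentially"
      using eventually_ge_at_top[of "nat \<lceil>g\<^sup>2\<rceil>"]
    proof eventually_elim
      case (elim n)
      have "- of_real (g\<^sup>2) \<in> set (zs n)"
        unfolding zs using pos_ordinates_xi_sq[OF assms] elim by (simp add: norm_power)
      moreover have "\<exists>g>0. z = - of_real g" if "z \<in> set (zs n)" for z
      proof -
        have "xi_sq z = 0" using that zs(1) by auto
        then obtain h where "h > 0" "z = - of_real (h\<^sup>2)" using xi_sq_zero[OF assms(1)] by metis
        then show ?thesis by (intro exI[of _ "h\<^sup>2"]) simp
      qed
      ultimately have "cmod (s\<^sup>2) / cmod (- complex_of_real (g\<^sup>2)) \<le> cmod (zprod (zs n) (s\<^sup>2))"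
        using norm_zprod_neg_ge[of "zs n" "s\<^sup>2"] s by blast
      moreover have "cmod (- complex_of_real (g\<^sup>2)) = g\<^sup>2" by (simp add: norm_power)
      ultimately show ?case by (intro mult_left_mono) auto
    qed
  qed simp
  then show ?thesis using that[of "cmod (xi (1 / 2)) / g\<^sup>2"] xi0 g by (simp add: norm_power)
qed

section \<open>Infinitude of the ordinates\<close>

lemma norm_zprod_le:
  "\<exists>C>0. \<forall>w. cmod w \<ge> 1 \<longrightarrow> cmod (zprod zs w) \<le> C * cmod w ^ length zs"
proof (induction zs)
  case Nil
  show ?case by (intro exI[of _ 1]) auto
next
  case (Cons z zs)
  then obtain C where C: "C > 0" "\<And>w. cmod w \<ge> 1 \<Longrightarrow> cmod (zprod zs w) \<le> C * cmod w ^ length zs" by blast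
  define D where "D = 1 + 1 / cmod z"
  have D: "D > 0" by (simp add: D_def add_pos_nonneg)
  have "cmod (zprod (z # zs) w) \<le> (D * C) * cmod w ^ length (z # zs)" if w: "cmod w \<ge> 1" for w
  proof -
    have "cmod (1 - w / z) \<le> 1 + cmod w / cmod z"
      using norm_triangle_ineq4[of 1 "w / z"] by (simp add: norm_divide)
    also have "\<dots> \<le> D * cmod w" using w by (simp add: D_def distrib_right)
    finally have "cmod (zprod (z # zs) w) \<le> (D * cmod w) * (C * cmod w ^ length zs)"
      using C(2)[OF w] D by (simp add: norm_mult mult_mono)
    then show ?thesis by (simp add: mult_ac)
  qed
  then show ?case using C(1) D by (intro exI[of _ "D * C"]) auto
qed

text \<open>At s = 2m the Gamma factor is m! and \<open>zeta_reg\<close> is at least 1. Factorial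
  growth along the even integers is incompatible with polynomial growth of
  \<open>xi_sq\<close>.\<close>

lemma xi_even_nat_ge:
  assumes "m \<ge> 1"
  shows "cmod (xi (of_real (2 * real m))) \<ge> fact m / pi ^ m"
proof -
  define x where "x = 2 * real m"
  have x: "x \<ge> 2" using assms by (simp add: x_def)
  have sm: "summable (\<lambda>n. real (Suc n) powr (- x))"
    using summable_real_powr_iff[of "- x"] x by (subst summable_Suc_iff) simp
  have "(\<lambda>n. complex_of_real (real (Suc n) powr (- x))) sums of_real (\<Sum>n. real (Suc n) powr (- x))"
    using sm by (intro sums_of_real summable_sums)
  moreover have "(\<lambda>n. complex_of_real (real (Suc n) powr (- x))) sums zeta (of_real x)"
    using zeta_sums[of "of_real x"] x unfolding of_real_minus[symmetric] of_nat_powr_of_real by simp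
  ultimately have z: "zeta (of_real x) = of_real (\<Sum>n. real (Suc n) powr (- x))" by (rule sums_unique2[symmetric])
  have "(\<Sum>n<1. real (Suc n) powr (- x)) \<le> (\<Sum>n. real (Suc n) powr (- x))"
    by (rule sum_le_suminf[OF sm]) auto
  then have z1: "cmod (zeta (of_real x)) \<ge> 1" unfolding z by simp
  have "cmod (of_real (x - 1) * zeta (of_real x)) \<ge> 1 * 1"
    unfolding norm_mult norm_of_real using z1 x by (intro mult_mono) auto
  moreover have "zeta_reg (of_real x) = of_real (x - 1) * zeta (of_real x)"
    using x by (simp add: zeta_reg_def)
  ultimately have zr: "cmod (zeta_reg (of_real x)) \<ge> 1" by simp
  have "cmod (of_real pi powr (- of_real x / 2)) = pi powr (- real m)"
    by (subst norm_powr_real_powr) (auto simp: x_def)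
  then have p: "cmod (of_real pi powr (- of_real x / 2)) = 1 / pi ^ m"
    using powr_realpow[of pi m] powr_minus_divide[of pi "real m"] by simp
  have "1 + complex_of_real x / 2 = 1 + of_nat m" by (simp add: x_def)
  then have G: "cmod (Gamma (1 + of_real x / 2)) = fact m" by (simp only: Gamma_fact norm_fact)
  have "cmod (xi (of_real x)) = 1 / pi ^ m * fact m * cmod (zeta_reg (of_real x))"
  proof -
    have "xi (of_real x) = of_real pi powr (- of_real x / 2) * Gamma (1 + of_real x / 2) * zeta_reg (of_real x)"
      using x by (intro xi_eq) simp
    then show ?thesis by (simp only: norm_mult p G)
  qed
  also have "\<dots> \<ge> 1 / pi ^ m * fact m * 1" using zr by (intro mult_left_mono) auto
  finally show ?thesis by (simp add: x_def)
qed

lemma power_le_fact_exp: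
  fixes x :: real
  assumes "x \<ge> 0"
  shows "x ^ m \<le> fact m * exp x"
proof -
  have s: "(\<lambda>n. x ^ n /\<^sub>R fact n) sums exp x" by (rule exp_converges)
  have "(\<Sum>n\<in>{m}. x ^ n /\<^sub>R fact n) \<le> (\<Sum>n. x ^ n /\<^sub>R fact n)"
    using assms s by (intro sum_le_suminf) (auto simp: sums_iff)
  then have "x ^ m /\<^sub>R fact m \<le> exp x" using s by (simp add: sums_iff)
  then show ?thesis by (simp add: field_simps)
qed

text \<open>Required for an enumeration by all natural numbers to exist. With finitely many
  ordinates, \<open>xi_sq\<close> would be a polynomial times a zero-free function of the same
  growth; the latter has an empty Hadamard product and is constant, which contradicts the factorial
  growth of xi.\<close>

lemma infinite_pos_ordinates:
  assumes "RH"
  shows "infinite pos_ordinates"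
proof
  assume fin: "finite pos_ordinates"
  have xi0: "xi_sq 0 \<noteq> 0" using xi_real_neq_0[of "1 / 2"] by (simp add: xi_sq_def)
  have "{w \<in> UNIV. xi_sq w = 0} \<subseteq> (\<lambda>g. - of_real (g\<^sup>2)) ` pos_ordinates"
    using xi_sq_zero[OF assms] by blast
  then have "finite {w \<in> UNIV. xi_sq w = 0}" using fin finite_surj by blast
  from entire_factor_finite_zeros[OF this xi_sq_holomorphic xi0 refl]
  obtain zs G where G: "G holomorphic_on UNIV" "set zs = {w. xi_sq w = 0}"
    "\<And>w. xi_sq w = zprod zs w * G w" "\<And>w. G w \<noteq> 0" by auto
  have z0: "z \<noteq> 0" if "z \<in> set zs" for z using that G(2) xi0 by auto
  obtain B where B: "\<And>z. z \<in> set zs \<Longrightarrow> cmod z \<le> B"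
    using finite_imp_bounded[of "set zs"] unfolding bounded_iff by blast
  have "\<exists>R0. \<forall>w. cmod w \<ge> R0 \<longrightarrow> cmod (G w) \<le> exp (e * cmod w)" if "e > 0" for e
  proof -
    obtain R0 where R0: "\<And>w. cmod w \<ge> R0 \<Longrightarrow> cmod (xi_sq w) \<le> exp (e * cmod w)"
      using xi_sq_growth[OF \<open>e > 0\<close>] by blast
    have "cmod (G w) \<le> exp (e * cmod w)" if w: "cmod w \<ge> max R0 (2 * B)" for w
    proof -
      have "1 \<le> cmod (zprod zs w)"
      proof (rule norm_zprod_ge_1)
        fix z assume z: "z \<in> set zs"
        have "cmod w \<ge> 2 * B" using w by simp
        then show "2 * cmod z \<le> cmod w \<and> z \<noteq> 0" using B[OF z] z0[OF z] by simp
      qed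
      then have "1 * cmod (G w) \<le> cmod (zprod zs w) * cmod (G w)" by (intro mult_right_mono) auto
      also have "\<dots> = cmod (xi_sq w)" by (simp add: G(3) norm_mult)
      also have "\<dots> \<le> exp (e * cmod w)" using w by (intro R0) auto
      finally show ?thesis by simp
    qed
    then show ?thesis by blast
  qed
  from hadamard_factorization[OF G(1) G(4)[of 0] this]
  obtain ys where ys: "\<And>n. set (ys n) = {z. G z = 0 \<and> cmod z \<le> real n}"
    "\<And>w. (\<lambda>n. G 0 * zprod (ys n) w) \<longlonglongrightarrow> G w" by metis
  have "ys n = []" for n using ys(1)[of n] G(4) by auto
  then have Gc: "G w = G 0" for w
    using ys(2)[of w] by (simp add: LIMSEQ_const_iff)
  obtain C where C: "C > 0" "\<And>w. cmod w \<ge> 1 \<Longrightarrow> cmod (zprod zs w) \<le> C * cmod w ^ length zs"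
    using norm_zprod_le[of zs] by blast
  define k where "k = length zs"
  \<comment> \<open>The last factor comes from (e pi)^m \<le> m! exp(e pi), which bounds m!/pi^m
    from below by e^m/exp(e pi); \<open>4 ^ k\<close> comes from (2m)^(2k).\<close>
  define D where "D = C * 4 ^ k * cmod (G 0) * exp (exp 1 * pi)"
  have ineq: "exp (real m) \<le> D * real m ^ (2 * k)" if m: "m \<ge> 1" for m
  proof -
    \<comment> \<open>Chosen so that \<open>1 / 2 + r = 2 * m\<close>.\<close>
    define r where "r = 2 * real m - 1 / 2"
    have r: "1 \<le> r" "r \<le> 2 * real m" using m by (auto simp: r_def)
    have "fact m / pi ^ m \<le> cmod (xi (of_real (2 * real m)))" by (rule xi_even_nat_ge[OF m])
    also have "xi (of_real (2 * real m)) = xi_sq ((of_real r)\<^sup>2)"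
      unfolding xi_sq_square by (simp add: r_def)
    also have "cmod \<dots> = cmod (zprod zs ((of_real r)\<^sup>2)) * cmod (G 0)"
      using G(3)[of "(of_real r)\<^sup>2"] Gc[of "(of_real r)\<^sup>2"] by (simp add: norm_mult)
    also have "\<dots> \<le> C * cmod ((of_real r)\<^sup>2) ^ k * cmod (G 0)"
      unfolding k_def using r by (intro mult_right_mono C(2)) (auto simp: norm_power)
    also have "cmod ((of_real r)\<^sup>2) ^ k = r ^ (2 * k)"
      using r by (simp add: norm_power power_mult)
    also have "C * r ^ (2 * k) * cmod (G 0) \<le> C * (2 * real m) ^ (2 * k) * cmod (G 0)"
      using r C(1) by (intro mult_right_mono mult_left_mono power_mono) auto
    also have "(2 * real m) ^ (2 * k) = 4 ^ k * real m ^ (2 * k)"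
      by (simp add: power_mult_distrib power_mult)
    finally have 1: "fact m / pi ^ m \<le> C * (4 ^ k * real m ^ (2 * k)) * cmod (G 0)" .
    have "(exp 1 * pi) ^ m \<le> fact m * exp (exp 1 * pi)" by (rule power_le_fact_exp) simp
    then have "exp (real m) \<le> fact m / pi ^ m * exp (exp 1 * pi)"
      by (simp add: power_mult_distrib field_simps flip: exp_of_nat_mult)
    also have "\<dots> \<le> C * (4 ^ k * real m ^ (2 * k)) * cmod (G 0) * exp (exp 1 * pi)"
      using 1 by (intro mult_right_mono) auto
    finally show ?thesis by (simp add: D_def mult_ac)
  qed
  have "((\<lambda>x. x ^ (2 * k) / exp x) \<longlongrightarrow> (0::real)) at_top" by (rule tendsto_power_div_exp_0)
  then have "(\<lambda>m. real m ^ (2 * k) / exp (real m)) \<longlonglongrightarrow> 0"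
    by (rule filterlim_compose[OF _ filterlim_real_sequentially])
  then have "(\<lambda>m. D * (real m ^ (2 * k) / exp (real m))) \<longlonglongrightarrow> D * 0" by (rule tendsto_mult_left)
  moreover have "eventually (\<lambda>m. 1 \<le> D * (real m ^ (2 * k) / exp (real m))) sequentially"
    using eventually_ge_at_top[of 1]
  proof eventually_elim
    case (elim m)
    then show ?case using ineq[of m] by (simp add: pos_le_divide_eq)
  qed
  ultimately have "1 \<le> D * 0" by (rule tendsto_lowerbound) simp
  then show False by simp
qed

section \<open>Enumeration of the ordinates and the midpoints between them\<close>

text \<open>The rank \<open>c x\<close>, the number of smaller elements, is a bijection from
  \<open>P\<close> onto the natural numbers. Every increasing enumeration inverts it, whence
  uniqueness; the description that defines \<open>ordinate_enum\<close> thus denotes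
  something.\<close>

lemma ex1_strict_mono_enumeration:
  fixes P :: "real set"
  assumes inf: "infinite P" and fin: "\<And>T. finite {x \<in> P. x \<le> T}"
  shows "\<exists>!g :: nat \<Rightarrow> real. strict_mono g \<and> range g = P"
proof -
  define c where "c = (\<lambda>x. card {y \<in> P. y < x})"
  have fin': "finite {y \<in> P. y < x}" for x by (rule finite_subset[OF _ fin[of x]]) auto
  have c_less: "c x < c y" if "x \<in> P" "x < y" for x y
    unfolding c_def using that by (intro psubset_card_mono[OF fin']) auto
  have c_inj: "x = y" if "x \<in> P" "y \<in> P" "c x = c y" for x y
    using c_less[of x y] c_less[of y x] that by linarith
  have ex: "\<exists>x\<in>P. c x = n" for n
  proof (induction n)
    case 0
    obtain y where y: "y \<in> P" using inf by fastforce
    define m where "m = Min {x \<in> P. x \<le> y}"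
    have m: "m \<in> {x \<in> P. x \<le> y}" unfolding m_def by (rule Min_in[OF fin]) (use y in auto)
    have min: "m \<le> x" if "x \<in> P" "x \<le> y" for x unfolding m_def by (rule Min_le[OF fin]) (use that in auto)
    have "{x \<in> P. x < m} = {}" using m min by force
    then show ?case using m unfolding c_def by (metis (no_types, lifting) card.empty mem_Collect_eq)
  next
    case (Suc n)
    then obtain x where x: "x \<in> P" "c x = n" by blast
    have "\<not> P \<subseteq> {y \<in> P. y \<le> x}" using inf fin[of x] finite_subset by blast
    then obtain y where "y \<in> P" "y \<notin> {y \<in> P. y \<le> x}" by blast
    then have y: "y \<in> P" "y > x" by auto
    define A where "A = {z \<in> P. x < z \<and> z \<le> y}"
    have A: "finite A" unfolding A_def by (rule finite_subset[OF _ fin[of y]]) auto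
    define m where "m = Min A"
    have m: "m \<in> A" unfolding m_def by (rule Min_in[OF A]) (use y in \<open>auto simp: A_def\<close>)
    have min: "m \<le> z" if "z \<in> A" for z unfolding m_def by (rule Min_le[OF A that])
    have "{z \<in> P. z < m} = insert x {z \<in> P. z < x}"
    proof (rule set_eqI)
      fix z
      show "z \<in> {z \<in> P. z < m} \<longleftrightarrow> z \<in> insert x {z \<in> P. z < x}"
        using m x min[of z] by (cases z x rule: linorder_cases) (auto simp: A_def)
    qed
    then have "c m = Suc n" using x(2) fin' by (simp add: c_def)
    then show ?case using m by (auto simp: A_def)
  qed
  then obtain g where g: "\<And>n. g n \<in> P" "\<And>n. c (g n) = n" by metis
  have mono: "strict_mono g"
  proof (rule strict_monoI)
    fix m n :: nat assume "m < n"
    then show "g m < g n" using c_less[of "g n" "g m"] g[of m] g[of n] by (metis less_irrefl linorder_neqE_linordered_idom order_less_asym)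
  qed
  have "range g = P"
  proof
    show "P \<subseteq> range g"
    proof
      fix x assume "x \<in> P"
      then have "x = g (c x)" using c_inj g by metis
      then show "x \<in> range g" by blast
    qed
  qed (use g in auto)
  moreover have "h = g" if h: "strict_mono h" "range h = P" for h
  proof
    fix n
    have "{y \<in> P. y < h n} = h ` {..<n}"
      using h strict_mono_less[OF h(1)] by auto
    then have "c (h n) = n" using strict_mono_imp_inj_on[OF h(1)]
      by (simp add: c_def card_image inj_on_subset)
    then show "h n = g n" using c_inj[of "h n" "g n"] g h by auto
  qed
  ultimately show ?thesis using mono by blast
qed

definition mid_ordinate :: "nat \<Rightarrow> real" where
  "mid_ordinate n = (ordinate_enum n + ordinate_enum (Suc n)) / 2"

context
  assumes RH: "RH"
begin

lemma ordinate_enum: "strict_mono ordinate_enum" "range ordinate_enum = pos_ordinates"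
  using theI'[OF ex1_strict_mono_enumeration[OF infinite_pos_ordinates[OF RH] finite_pos_ordinates_le[OF RH]]]
  unfolding ordinate_enum_def by blast+

lemma ordinate_enum_pos: "ordinate_enum n > 0"
  using ordinate_enum(2) pos_ordinates_pos by blast

lemma filterlim_ordinate_enum: "filterlim ordinate_enum at_top sequentially"
  unfolding filterlim_at_top
proof
  fix T
  have "finite {n. ordinate_enum n \<le> T}"
  proof (rule finite_imageD)
    show "finite (ordinate_enum ` {n. ordinate_enum n \<le> T})"
      by (rule finite_subset[OF _ finite_pos_ordinates_le[OF RH, of T]]) (use ordinate_enum(2) in auto)
    show "inj_on ordinate_enum {n. ordinate_enum n \<le> T}"
      using strict_mono_imp_inj_on[OF ordinate_enum(1)] inj_on_subset by blast
  qed
  then obtain N where N: "\<And>n. ordinate_enum n \<le> T \<Longrightarrow> n < N"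
    unfolding finite_nat_set_iff_bounded by blast
  show "eventually (\<lambda>n. T \<le> ordinate_enum n) sequentially"
    using eventually_ge_at_top[of N]
  proof eventually_elim
    case (elim n)
    then show ?case using N[of n] by linarith
  qed
qed

lemma mid_ordinate_less_iff: "ordinate_enum k < mid_ordinate n \<longleftrightarrow> k \<le> n"
  and mid_ordinate_neq: "ordinate_enum k \<noteq> mid_ordinate n"
proof -
  have lt: "ordinate_enum n < mid_ordinate n" "mid_ordinate n < ordinate_enum (Suc n)"
    using strict_monoD[OF ordinate_enum(1), of n "Suc n"] by (auto simp: mid_ordinate_def)
  have "ordinate_enum k < mid_ordinate n" if "k \<le> n"
    using lt strict_mono_less_eq[OF ordinate_enum(1), of k n] that by linarith
  moreover have "ordinate_enum k > mid_ordinate n" if "k > n"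
    using lt strict_mono_less_eq[OF ordinate_enum(1), of "Suc n" k] that by simp
  ultimately show "ordinate_enum k < mid_ordinate n \<longleftrightarrow> k \<le> n" "ordinate_enum k \<noteq> mid_ordinate n"
    by (metis not_le order_less_asym, metis not_le order_less_irrefl)
qed

lemma filterlim_mid_ordinate: "filterlim mid_ordinate at_top sequentially"
proof (rule filterlim_at_top_mono[OF filterlim_ordinate_enum always_eventually], rule allI)
  show "ordinate_enum n \<le> mid_ordinate n" for n
    using mid_ordinate_less_iff[of n n] by simp
qed

lemma gam_Suc: "gam (int (Suc n)) = ordinate_enum n"
  by (simp add: gam_def nat_add_distrib)

text \<open>\<open>delta' k\<close> is at most the gap d between \<open>gam k\<close> and its
  neighbour on the side of the midpoint, while the midpoint is at distance at least d/2. Equality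
  occurs for the two adjacent ordinates, and \<alpha> < 1/2 supplies the strict inequality.\<close>

lemma x_path_mid_ordinate:
  assumes \<alpha>: "0 < \<alpha>" "\<alpha> < 1 / 2"
  shows "x_path \<alpha> (mid_ordinate n) = 0"
proof -
  have "\<alpha> * delta' k < \<bar>mid_ordinate n - gam k\<bar>" if k: "k \<ge> 1" for k
  proof -
    define j where "j = nat (k - 1)"
    have j: "k = int (Suc j)" using k by (simp add: j_def)
    have mono: "ordinate_enum a \<le> ordinate_enum b" if "a \<le> b" for a b
      using strict_mono_less_eq[OF ordinate_enum(1)] that by blast
    have smono: "ordinate_enum a < ordinate_enum b" if "a < b" for a b
      using strict_mono_less[OF ordinate_enum(1)] that by blast
    have "\<exists>d>0. delta' k \<le> d \<and> d / 2 \<le> \<bar>mid_ordinate n - gam k\<bar>"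
    proof (cases "j \<le> n")
      case True
      define d where "d = ordinate_enum (Suc j) - ordinate_enum j"
      have "next_index k = int (Suc (Suc j))" using j by (simp add: next_index_def)
      then have "gam (next_index k) = ordinate_enum (Suc j)" by (simp only: gam_Suc)
      moreover have gk: "gam k = ordinate_enum j" using j by (simp only: gam_Suc)
      moreover have d: "d > 0" using smono[of j "Suc j"] by (simp add: d_def)
      ultimately have "delta' k \<le> d" by (auto simp: delta'_def delta_def d_def)
      moreover have "d / 2 \<le> \<bar>mid_ordinate n - gam k\<bar>"
      proof (cases "j = n")
        case True
        then show ?thesis using d unfolding gk d_def mid_ordinate_def by (simp add: field_simps)
      next
        case False
        then have "ordinate_enum (Suc j) \<le> ordinate_enum n" using True by (intro mono) simp
        then show ?thesis using d mid_ordinate_less_iff[of n n] unfolding gk d_def by simp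
      qed
      ultimately show ?thesis using d by blast
    next
      case False
      \<comment> \<open>Above the midpoint the index \<open>k\<close> is at least 2, so its
        predecessor is \<open>k - 1\<close> and not the index -1.\<close>
      define i where "i = j - 1"
      have i: "j = Suc i" "n \<le> i" using False by (auto simp: i_def)
      define d where "d = ordinate_enum (Suc i) - ordinate_enum i"
      have "prev_index k = int (Suc i)" using j i by (simp add: prev_index_def)
      then have "gam (prev_index k) = ordinate_enum i" by (simp only: gam_Suc)
      moreover have gk: "gam k = ordinate_enum (Suc i)" using j i by (simp only: gam_Suc)
      moreover have d: "d > 0" using smono[of i "Suc i"] by (simp add: d_def)
      ultimately have "delta' k \<le> d" by (auto simp: delta'_def delta_def d_def)
      moreover have "d / 2 \<le> \<bar>mid_ordinate n - gam k\<bar>"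
      proof (cases "i = n")
        case True
        then show ?thesis using d unfolding gk d_def mid_ordinate_def by (simp add: field_simps)
      next
        case False
        then have "ordinate_enum (Suc n) \<le> ordinate_enum i" using i by (intro mono) simp
        moreover have "mid_ordinate n < ordinate_enum (Suc n)"
          using mid_ordinate_less_iff[of "Suc n" n] mid_ordinate_neq[of "Suc n" n] by simp
        ultimately show ?thesis using d unfolding gk d_def by simp
      qed
      ultimately show ?thesis using d by blast
    qed
    then obtain d where d: "d > 0" "delta' k \<le> d" "d / 2 \<le> \<bar>mid_ordinate n - gam k\<bar>" by blast
    have "\<alpha> * delta' k \<le> \<alpha> * d" using d \<alpha> by (intro mult_left_mono) auto
    also have "\<alpha> * d < 1 / 2 * d" using d \<alpha> by (intro mult_strict_right_mono) auto
    finally show ?thesis using d(3) by simp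
  qed
  then have "\<not> (\<exists>k\<ge>1. \<bar>mid_ordinate n - gam k\<bar> \<le> \<alpha> * delta' k)" by (meson not_le)
  then show ?thesis unfolding x_path_def by (rule if_not_P)
qed

lemma zeta_mid_ordinate_lower_bound:
  assumes \<alpha>: "0 < \<alpha>" "\<alpha> < 1 / 2" and C1: "C1 \<alpha>"
  obtains L where "L > 0"
    "eventually (\<lambda>n. cmod (zeta (1 / 2 + \<i> * of_real (mid_ordinate n))) \<ge> L * mid_ordinate n powr (- (3 / 4))) sequentially"
proof -
  \<comment> \<open>The infimum lies below 3/4, so some admissible exponent does; at heights above 1
    it may then be weakened to 3/4.\<close>
  have "\<exists>\<epsilon>\<in>C1_exponents \<alpha>. \<epsilon> < 3 / 4"
    using C1 cInf_lessD[of "C1_exponents \<alpha>" "3 / 4"] unfolding C1_def eps0_def by blast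
  then obtain \<epsilon> L where L: "\<epsilon> < 3 / 4" "L > 0"
    "\<And>t. t > t1 \<alpha> \<Longrightarrow> cmod (zeta (1 / 2 + s_path \<alpha> t)) > L * t powr (- \<epsilon>)"
    unfolding C1_exponents_def by blast
  have ev: "eventually (\<lambda>n. mid_ordinate n > max 1 (t1 \<alpha>)) sequentially"
    using filterlim_mid_ordinate unfolding filterlim_at_top_dense by blast
  have "eventually (\<lambda>n. cmod (zeta (1 / 2 + \<i> * of_real (mid_ordinate n))) \<ge> L * mid_ordinate n powr (- (3 / 4))) sequentially"
    using ev
  proof eventually_elim
    case (elim n)
    have "s_path \<alpha> (mid_ordinate n) = \<i> * of_real (mid_ordinate n)"
      by (simp add: s_path_def x_path_mid_ordinate[OF \<alpha>] complex_eq_iff)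
    then have "L * mid_ordinate n powr (- \<epsilon>) < cmod (zeta (1 / 2 + \<i> * of_real (mid_ordinate n)))"
      using L(3)[of "mid_ordinate n"] elim by simp
    moreover have "L * mid_ordinate n powr (- (3 / 4)) \<le> L * mid_ordinate n powr (- \<epsilon>)"
      using L elim by (intro mult_left_mono powr_mono) auto
    ultimately show ?case by linarith
  qed
  then show ?thesis using that L(2) by blast
qed

end

subsection \<open>The contour integral\<close>

lemma rectpath_contour_integral_bound:
  fixes a b B :: real
  assumes ab: "a > 0" "b > 0" and B: "B \<ge> 0"
    and f: "continuous_on (path_image (rectpath (Complex (- a) (- b)) (Complex a b))) f"
    and bd: "\<And>z. z \<in> path_image (rectpath (Complex (- a) (- b)) (Complex a b)) \<Longrightarrow> cmod (f z) \<le> B"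
  shows "cmod (contour_integral (rectpath (Complex (- a) (- b)) (Complex a b)) f) \<le> B * (4 * a + 4 * b)"
proof -
  define p1 p2 p3 p4 where "p1 = Complex (- a) (- b)" and "p2 = Complex a (- b)"
    and "p3 = Complex a b" and "p4 = Complex (- a) b"
  define g where "g = rectpath p1 p3"
  have g: "g = linepath p1 p2 +++ linepath p2 p3 +++ linepath p3 p4 +++ linepath p4 p1"
    by (simp add: g_def rectpath_def Let_def p1_def p2_def p3_def p4_def)
  have sub: "path_image (linepath p1 p2) \<subseteq> path_image g" "path_image (linepath p2 p3) \<subseteq> path_image g"
    "path_image (linepath p3 p4) \<subseteq> path_image g" "path_image (linepath p4 p1) \<subseteq> path_image g"
    unfolding g by (auto simp: path_image_join)
  have fg: "continuous_on (path_image g) f" using f by (simp add: g_def p1_def p3_def)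
  have int: "f contour_integrable_on linepath p q" if "path_image (linepath p q) \<subseteq> path_image g" for p q
    using continuous_on_subset[OF fg that] by (intro contour_integrable_continuous_linepath) simp
  have bound: "cmod (contour_integral (linepath p q) f) \<le> B * cmod (q - p)"
    if "path_image (linepath p q) \<subseteq> path_image g" for p q
  proof (rule has_contour_integral_bound_linepath[OF has_contour_integral_integral[OF int[OF that]] B])
    fix x assume "x \<in> closed_segment p q"
    then show "cmod (f x) \<le> B" using that bd[of x] by (auto simp: g_def p1_def p3_def)
  qed
  have "contour_integral g f = contour_integral (linepath p1 p2) f + contour_integral (linepath p2 p3) f
     + contour_integral (linepath p3 p4) f + contour_integral (linepath p4 p1) f"
    unfolding g using int sub by (simp add: contour_integrable_joinI add.assoc)
  also have "cmod \<dots> \<le> B * cmod (p2 - p1) + B * cmod (p3 - p2) + B * cmod (p4 - p3) + B * cmod (p1 - p4)"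
    using bound[OF sub(1)] bound[OF sub(2)] bound[OF sub(3)] bound[OF sub(4)]
    by (intro norm_triangle_le add_mono) auto
  finally have le: "cmod (contour_integral g f) \<le> B * cmod (p2 - p1) + B * cmod (p3 - p2) + B * cmod (p4 - p3) + B * cmod (p1 - p4)" .
  have "cmod (p2 - p1) = 2 * a" "cmod (p3 - p2) = 2 * b" "cmod (p4 - p3) = 2 * a" "cmod (p1 - p4) = 2 * b"
    using ab by (simp_all add: p1_def p2_def p3_def p4_def cmod_def real_sqrt_mult)
  with le show ?thesis by (simp add: g_def p1_def p3_def algebra_simps)
qed

text \<open>The residue theorem for 1/((z - s) n(z)): the pole at \<open>s\<close> contributes
  \<open>1 / n s\<close>, and a simple zero p of n contributes minus the partial fraction term at p.
  The bound is the standard length estimate divided by 2 pi.\<close>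

lemma partial_fraction_rectangle_bound:
  fixes n :: "complex \<Rightarrow> complex" and s :: complex and a b B d :: real
  defines "g \<equiv> rectpath (Complex (- a) (- b)) (Complex a b)"
  assumes n: "n holomorphic_on UNIV"
    and ab: "a > 0" "b > 0"
    and A: "finite A" "\<And>z. \<bar>Re z\<bar> \<le> a \<Longrightarrow> \<bar>Im z\<bar> \<le> b \<Longrightarrow> n z = 0 \<longleftrightarrow> z \<in> A"
      "\<And>z. z \<in> A \<Longrightarrow> \<bar>Re z\<bar> < a \<and> \<bar>Im z\<bar> < b"
    and simple: "\<And>z. z \<in> A \<Longrightarrow> deriv n z \<noteq> 0"
    and s: "\<bar>Re s\<bar> < a" "\<bar>Im s\<bar> < b" "n s \<noteq> 0"
    and B: "B > 0" "\<And>z. z \<in> path_image g \<Longrightarrow> cmod (n z) \<ge> B"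
    and d: "d > 0" "\<And>z. z \<in> path_image g \<Longrightarrow> cmod (z - s) \<ge> d"
  shows "cmod (1 / n s - (\<Sum>z\<in>A. 1 / deriv n z / (s - z))) \<le> (4 * a + 4 * b) / (2 * pi * B * d)"
proof -
  define F where "F = (\<lambda>z. 1 / ((z - s) * n z))"
  have cb: "z \<in> cbox (Complex (- a) (- b)) (Complex a b) \<longleftrightarrow> \<bar>Re z\<bar> \<le> a \<and> \<bar>Im z\<bar> \<le> b" for z
    by (auto simp: in_cbox_complex_iff)
  have bx: "z \<in> box (Complex (- a) (- b)) (Complex a b) \<longleftrightarrow> \<bar>Re z\<bar> < a \<and> \<bar>Im z\<bar> < b" for z
    by (auto simp: in_box_complex_iff)
  have pim: "path_image g = cbox (Complex (- a) (- b)) (Complex a b) - box (Complex (- a) (- b)) (Complex a b)"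
    unfolding g_def using ab by (intro path_image_rectpath_cbox_minus_box) auto
  have nz: "n z \<noteq> 0" if "z \<in> path_image g" for z using B(1) B(2)[OF that] by auto
  \<comment> \<open>The residue theorem needs a domain around the closed rectangle. The enlarged
    rectangle \<open>S\<close> may contain further zeros, but these have winding number 0; the
    compact \<open>K\<close> shows that there are finitely many.\<close>
  define K where "K = cbox (Complex (- (a + 1)) (- (b + 1))) (Complex (a + 1) (b + 1))"
  define S where "S = box (Complex (- (a + 1)) (- (b + 1))) (Complex (a + 1) (b + 1))"
  have fin: "finite {z \<in> K. n z = 0}"
  proof (cases "n constant_on UNIV")
    case True
    then have "{z \<in> K. n z = 0} = {}" using s(3) by (auto simp: constant_on_def)
    then show ?thesis by (simp only: finite.emptyI)
  next
    case False
    then show ?thesis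
      using holomorphic_compact_finite_zeros[OF n open_UNIV connected_UNIV compact_cbox subset_UNIV] by (simp add: K_def)
  qed
  define pts where "pts = insert s {z \<in> S. n z = 0}"
  have SK: "S \<subseteq> K" by (simp add: S_def K_def box_subset_cbox)
  have pts: "finite pts" unfolding pts_def
    by (rule finite.insertI, rule finite_subset[OF _ fin]) (use SK in auto)
  have boxS: "cbox (Complex (- a) (- b)) (Complex a b) \<subseteq> S"
    by (auto simp: S_def in_box_complex_iff in_cbox_complex_iff)
  have sA: "s \<notin> A" using A(2)[of s] s by auto
  have ptsA: "pts \<inter> box (Complex (- a) (- b)) (Complex a b) = insert s A"
    using A(2,3) s boxS box_subset_cbox[of "Complex (- a) (- b)" "Complex a b"]
    unfolding pts_def by (force simp: bx)
  have "contour_integral g F = 2 * pi * \<i> * (\<Sum>p\<in>pts. winding_number g p * residue F p)"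
  proof (rule Residue_theorem[of S pts F g])
    show "open S" "connected S" by (auto simp: S_def intro: convex_connected convex_box)
    show "F holomorphic_on S - pts"
      unfolding F_def by (intro holomorphic_intros holomorphic_on_subset[OF n]) (auto simp: pts_def)
    show "path_image g \<subseteq> S - pts"
      using nz d boxS unfolding pts_def by (force simp: pim)
    show "\<forall>z. z \<notin> S \<longrightarrow> winding_number g z = 0"
      unfolding g_def using boxS ab by (auto intro!: winding_number_rectpath_outside)
  qed (use pts in \<open>auto simp: g_def\<close>)
  also have "(\<Sum>p\<in>pts. winding_number g p * residue F p) = (\<Sum>p\<in>insert s A. residue F p)"
  proof (rule sum.mono_neutral_cong_right[OF pts])
    show "insert s A \<subseteq> pts" using ptsA by blast
    show "\<forall>p\<in>pts - insert s A. winding_number g p * residue F p = 0"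
    proof
      fix p assume p: "p \<in> pts - insert s A"
      then have "p \<notin> box (Complex (- a) (- b)) (Complex a b)" using ptsA by blast
      moreover have "p \<notin> path_image g" using p nz s by (auto simp: pts_def)
      ultimately have "p \<notin> cbox (Complex (- a) (- b)) (Complex a b)" by (auto simp: pim)
      then have "winding_number g p = 0"
        unfolding g_def using ab by (intro winding_number_rectpath_outside) auto
      then show "winding_number g p * residue F p = 0" by simp
    qed
    show "winding_number g p * residue F p = residue F p" if "p \<in> insert s A" for p
    proof -
      have "p \<in> box (Complex (- a) (- b)) (Complex a b)" using that ptsA by blast
      then show ?thesis unfolding g_def by (simp add: winding_number_rectpath)
    qed
  qed
  also have "\<dots> = residue F s + (\<Sum>p\<in>A. residue F p)" using A(1) sA by simp
  finally have cint: "contour_integral g F = 2 * pi * \<i> * (residue F s + (\<Sum>p\<in>A. residue F p))" .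
  \<comment> \<open>One formula serves both kinds of poles: the derivative of the denominator at
    \<open>p\<close> is \<open>n p + (p - s) * deriv n p\<close>.\<close>
  have res: "residue F p = 1 / (n p + (p - s) * deriv n p)"
    if "(p - s) * n p = 0" "n p + (p - s) * deriv n p \<noteq> 0" for p
    unfolding F_def
  proof (rule residue_simple_pole_deriv[where s = UNIV])
    show "(\<lambda>z. (z - s) * n z) holomorphic_on UNIV" by (intro holomorphic_intros n)
    have "(n has_field_derivative deriv n p) (at p)"
      using n by (auto intro: holomorphic_derivI)
    then show "((\<lambda>z. (z - s) * n z) has_field_derivative (n p + (p - s) * deriv n p)) (at p)"
      by (auto intro!: derivative_eq_intros)
  qed (use that in auto)
  have "residue F s = 1 / n s" using res[of s] s by simp
  moreover have "residue F p = - (1 / deriv n p / (s - p))" if "p \<in> A" for p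
  proof -
    have "n p = 0" using A(2,3) that by (metis less_imp_le)
    moreover have "p \<noteq> s" using sA that by auto
    ultimately show ?thesis using res[of p] simple[OF that] by (simp add: divide_simps) (simp add: algebra_simps)
  qed
  ultimately have "contour_integral g F = 2 * pi * \<i> * (1 / n s - (\<Sum>p\<in>A. 1 / deriv n p / (s - p)))"
    unfolding cint by (simp add: sum_negf)
  then have "2 * pi * cmod (1 / n s - (\<Sum>p\<in>A. 1 / deriv n p / (s - p))) = cmod (contour_integral g F)"
    by (simp add: norm_mult)
  also have "\<dots> \<le> 1 / (B * d) * (4 * a + 4 * b)"
    unfolding g_def
  proof (rule rectpath_contour_integral_bound[OF ab])
    show "continuous_on (path_image (rectpath (Complex (- a) (- b)) (Complex a b))) F"
      unfolding F_def using nz d(1) d(2)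
      by (intro continuous_intros continuous_on_subset[OF holomorphic_on_imp_continuous_on[OF n]])
         (force simp: g_def)+
    show "cmod (F z) \<le> 1 / (B * d)" if "z \<in> path_image (rectpath (Complex (- a) (- b)) (Complex a b))" for z
    proof -
      have "B * d \<le> cmod (n z) * cmod (z - s)"
        using B d that by (intro mult_mono) (auto simp: g_def)
      then show ?thesis using B(1) d(1)
        by (simp add: F_def norm_divide norm_mult mult.commute frac_le)
    qed
  qed (use B(1) d(1) in auto)
  finally show ?thesis using B(1) d(1) by (simp add: field_simps)
qed

section \<open>Lower bounds for the sine\<close>

lemma norm_sin_ge_exp:
  assumes "\<bar>Im z\<bar> \<ge> 1"
  shows "cmod (sin z) \<ge> exp \<bar>Im z\<bar> / 4"
proof -
  define E where "E = exp \<bar>Im z\<bar>"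
  have "E \<ge> 1 + \<bar>Im z\<bar>" unfolding E_def by (rule exp_ge_add_one_self)
  then have E: "E \<ge> 2" using assms by simp
  then have E2: "E\<^sup>2 \<ge> 4" using power_mono[of 2 E 2] by simp
  have s: "exp (2 * Im z) + inverse (exp (2 * Im z)) = E\<^sup>2 + inverse (E\<^sup>2)"
  proof -
    have "E\<^sup>2 = exp (2 * \<bar>Im z\<bar>)" by (simp add: E_def exp_double)
    then show ?thesis by (cases "Im z \<ge> 0") (simp_all add: exp_minus)
  qed
  have "(E / 4)\<^sup>2 \<le> (E\<^sup>2 + inverse (E\<^sup>2) - 2) / 4"
  proof -
    have "x / 16 \<le> (x + y - 2) / 4" if "x \<ge> 4" "y \<ge> 0" for x y :: real
      using that by (simp add: field_simps)
    from this[OF E2, of "inverse (E\<^sup>2)"] show ?thesis by (simp add: power_divide)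
  qed
  also have "\<dots> \<le> (cmod (sin z))\<^sup>2"
    unfolding norm_sin_squared s by (intro divide_right_mono diff_left_mono) (auto simp: cos_le_one)
  finally show ?thesis unfolding E_def by (rule power2_le_imp_le) simp
qed

text \<open>On such vertical lines |sin z| equals cosh(Im z).\<close>

lemma norm_sin_ge_1:
  assumes "cos (2 * Re z) = - 1"
  shows "cmod (sin z) \<ge> 1"
proof -
  define E where "E = exp (2 * Im z)"
  have E: "E > 0" by (simp add: E_def)
  have "(E - 1)\<^sup>2 / E \<ge> 0" using E by simp
  also have "(E - 1)\<^sup>2 / E = E + inverse E - 2" using E by (simp add: field_simps power2_eq_square)
  finally have "1\<^sup>2 \<le> (cmod (sin z))\<^sup>2" unfolding norm_sin_squared assms E_def[symmetric] by simp
  then show ?thesis by (rule power2_le_imp_le) simp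
qed

section \<open>Symmetry, zeros and derivatives of nfun\<close>

lemma nfun_holomorphic: "nfun holomorphic_on UNIV"
proof -
  have "(\<lambda>s. xi (1 / 2 + s)) holomorphic_on UNIV"
    by (rule holomorphic_on_compose_gen[OF _ xi_holomorphic, unfolded o_def]) (auto intro!: holomorphic_intros)
  then show ?thesis unfolding nfun_def by (intro holomorphic_intros) auto
qed

lemma nfun_odd: "nfun (- s) = - nfun s"
  using xi_even[of s] by (simp add: nfun_def)

lemma has_field_derivative_nfun:
  "(nfun has_field_derivative (of_real pi / 4 * cos (of_real pi * z / 4) * (2 * xi (1 / 2 + z))
      + sin (of_real pi * z / 4) * (2 * deriv xi (1 / 2 + z)))) (at z)"
proof -
  have "(xi has_field_derivative deriv xi (1 / 2 + z)) (at (1 / 2 + z))"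
    using xi_holomorphic by (intro holomorphic_derivI) auto
  then have "((\<lambda>s. xi (1 / 2 + s)) has_field_derivative deriv xi (1 / 2 + z) * 1) (at z)"
    by (rule DERIV_chain2) (auto intro!: derivative_eq_intros)
  then have 1: "((\<lambda>s. xi (1 / 2 + s)) has_field_derivative deriv xi (1 / 2 + z)) (at z)" by simp
  have "((\<lambda>s. sin (of_real pi * s / 4)) has_field_derivative (of_real pi / 4 * cos (of_real pi * z / 4))) (at z)"
    by (auto intro!: derivative_eq_intros)
  from DERIV_mult[OF this DERIV_cmult[OF 1, of 2]] show ?thesis
    unfolding nfun_def by (simp add: mult_ac)
qed

lemma deriv_nfun_even: "deriv nfun (- z) = deriv nfun z"
proof -
  have "(nfun has_field_derivative deriv nfun z) (at (- (- z)))"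
    unfolding minus_minus using nfun_holomorphic by (intro holomorphic_derivI) auto
  then have "((\<lambda>s. nfun (- s)) has_field_derivative deriv nfun z * - 1) (at (- z))"
    by (rule DERIV_chain2) (auto intro!: derivative_eq_intros)
  from DERIV_minus[OF this] have "((\<lambda>s. - nfun (- s)) has_field_derivative deriv nfun z) (at (- z))" by simp
  then have "(nfun has_field_derivative deriv nfun z) (at (- z))" by (simp add: nfun_odd)
  then show ?thesis by (rule DERIV_imp_deriv)
qed

text \<open>This combines the residues at z and -z into the paired terms of the expansion.\<close>

lemma cfun_even: "cfun (- z) = cfun z"
  by (simp add: cfun_def deriv_nfun_even)

lemma norm_deriv_nfun_real: "cmod (deriv nfun (4 * of_int w)) = pi / 2 * cmod (xi (1 / 2 + 4 * of_int w))"
proof -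
  have a: "of_real pi * (4 * of_int w) / 4 = complex_of_real (of_int w * pi)" by simp
  have s: "sin (complex_of_real (of_int w * pi)) = 0"
    unfolding sin_of_real by (simp add: sin_times_pi_eq_0)
  have c: "cmod (cos (complex_of_real (of_int w * pi))) = 1"
  proof -
    have "(cos (real_of_int w * pi))\<^sup>2 = 1"
      unfolding cos_squared_eq by (simp add: sin_times_pi_eq_0)
    then have "\<bar>cos (real_of_int w * pi)\<bar> = 1" by (auto simp: power2_eq_1_iff)
    then show ?thesis unfolding cos_of_real norm_of_real .
  qed
  have "deriv nfun (4 * of_int w) = of_real pi / 4 * cos (complex_of_real (of_int w * pi)) * (2 * xi (1 / 2 + 4 * of_int w))"
    using DERIV_imp_deriv[OF has_field_derivative_nfun[of "4 * of_int w"]] unfolding a s by simp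
  then show ?thesis by (simp only: norm_mult c norm_divide) simp
qed

text \<open>Away from 1, \<open>zeta\<close> is \<open>xi\<close> times a holomorphic function, by
  the identity with the reciprocal Gamma function, so a multiple zero of xi is one of zeta. The
  contrapositive carries the simplicity granted by (C3) over to \<open>nfun\<close>.\<close>

lemma deriv_xi_zero_imp_deriv_zeta_zero:
  assumes "z \<noteq> 1" "xi z = 0" "deriv xi z = 0"
  shows "deriv zeta z = 0"
proof -
  define K where "K = (\<lambda>s::complex. rGamma (1 + s / 2) / (of_real pi powr (- s / 2) * (s - 1)))"
  have zK: "xi s * K s = zeta s" if "s \<in> - {1}" for s
    using rGamma_times_xi1[of s] that
    by (simp add: K_def xi_eq_xi1 zeta_reg_def divide_simps mult_ac)
  have "K holomorphic_on - {1}"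
    unfolding K_def by (intro holomorphic_intros) auto
  then have "(K has_field_derivative deriv K z) (at z)"
    using assms(1) by (intro holomorphic_derivI) auto
  moreover have "(xi has_field_derivative deriv xi z) (at z)"
    using xi_holomorphic by (intro holomorphic_derivI) auto
  ultimately have "((\<lambda>s. xi s * K s) has_field_derivative 0) (at z)"
    using DERIV_mult[of xi "deriv xi z" z UNIV K "deriv K z"] assms by simp
  then have "(zeta has_field_derivative 0) (at z)"
    by (rule has_field_derivative_transform_within_open[of _ _ _ "- {1}"]) (use assms(1) zK in auto)
  then show ?thesis by (rule DERIV_imp_deriv)
qed

lemma sin_quarter_zero_iff: "sin (of_real pi * z / 4) = (0 :: complex) \<longleftrightarrow> (\<exists>w::int. z = 4 * of_int w)"
proof -
  have "of_real pi * z / 4 = complex_of_real (of_int w * pi) \<longleftrightarrow> z = 4 * of_int w" for w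
  proof -
    have "of_real pi * z / 4 = complex_of_real (of_int w * pi) \<longleftrightarrow> of_real pi * z = of_real pi * (4 * of_int w)"
      by (simp add: field_simps)
    also have "\<dots> \<longleftrightarrow> z = 4 * of_int w" by (subst mult_cancel_left) simp
    finally show ?thesis .
  qed
  then show ?thesis unfolding sin_eq_0 by simp
qed

lemma nfun_zero_iff:
  assumes "RH"
  shows "nfun z = 0 \<longleftrightarrow> (\<exists>w::int. z = 4 * of_int w) \<or> (\<exists>g\<in>pos_ordinates. z = \<i> * of_real g \<or> z = - (\<i> * of_real g))"
  unfolding nfun_def mult_eq_0_iff sin_quarter_zero_iff xi_zero_iff[OF assms] by simp

lemma nfun_neq_0_outside_Z_circ:
  assumes "RH" "s \<notin> Z_circ"
  shows "nfun s \<noteq> 0"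
proof
  assume "nfun s = 0"
  then consider w :: int where "s = 4 * of_int w" | g where "g \<in> pos_ordinates" "s = \<i> * of_real g \<or> s = - (\<i> * of_real g)"
    unfolding nfun_zero_iff[OF assms(1)] by blast
  then show False
  proof cases
    case 1
    then show False using assms(2) by (auto simp: Z_circ_def)
  next
    case 2
    have g: "g > 0" using 2 pos_ordinates_pos by blast
    have "xi (1 / 2 + s) = 0" using 2 xi_zero_iff[OF assms(1)] by blast
    moreover have "Re (1 / 2 + s) > - 1" using 2 by auto
    ultimately have "zeta (1 / 2 + s) = 0" using xi_eq_0_iff by blast
    moreover have "s \<notin> \<real>" using 2 g by (auto simp: complex_is_Real_iff)
    ultimately show False using assms(2) by (auto simp: Z_circ_def Z_i_def)
  qed
qed

text \<open>
  By monotonicity of \<open>|xi (1/2 + x + i t)|\<close> in \<open>|x|\<close>, a lower bound at the single point \<open>1/2 + i t\<close>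
  of the critical line controls \<open>nfun\<close> on the whole horizontal line at height \<open>t\<close>.
\<close>
lemma nfun_horizontal_lower_bound:
  assumes RH: "RH" and \<alpha>: "0 < \<alpha>" "\<alpha> < 1 / 2" and C1: "C1 \<alpha>"
  shows "eventually (\<lambda>n. \<forall>z. \<bar>Im z\<bar> = mid_ordinate n \<longrightarrow> B \<le> cmod (nfun z)) sequentially"
proof -
  obtain L where L: "L > 0"
    "eventually (\<lambda>n. cmod (zeta (1 / 2 + \<i> * of_real (mid_ordinate n))) \<ge> L * mid_ordinate n powr (- (3 / 4))) sequentially"
    using zeta_mid_ordinate_lower_bound[OF RH \<alpha> C1] by blast
  obtain c where c: "c > 0" "\<And>y. y \<ge> 0 \<Longrightarrow> cmod (Gamma (Complex (1 / 4) y)) \<ge> c * exp (- pi * y / 2) / sqrt (1 + y)"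
    using Gamma_quarter_lower_bound by blast
  define D where "D = L * c * pi powr (- 1 / 4) / 4"
  have D: "D > 0" using L(1) c(1) by (simp add: D_def)
  have "filterlim (\<lambda>T. D * (T\<^sup>2 * T powr (- (3 / 4)) / sqrt (1 + T / 2))) at_top at_top"
    using D by real_asymp
  then have "filterlim (\<lambda>n. D * ((mid_ordinate n)\<^sup>2 * mid_ordinate n powr (- (3 / 4)) / sqrt (1 + mid_ordinate n / 2))) at_top sequentially"
    by (rule filterlim_compose[OF _ filterlim_mid_ordinate[OF RH]])
  then have ev1: "eventually (\<lambda>n. B \<le> D * ((mid_ordinate n)\<^sup>2 * mid_ordinate n powr (- (3 / 4)) / sqrt (1 + mid_ordinate n / 2))) sequentially"
    unfolding filterlim_at_top by blast
  have ev2: "eventually (\<lambda>n. 2 \<le> mid_ordinate n) sequentially"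
    using filterlim_mid_ordinate[OF RH] unfolding filterlim_at_top by blast
  from L(2) ev1 ev2 show ?thesis
  proof eventually_elim
    case (elim n)
    define T where "T = mid_ordinate n"
    have T: "T \<ge> 2" "cmod (zeta (1 / 2 + \<i> * of_real T)) \<ge> L * T powr (- (3 / 4))"
      "B \<le> D * (T\<^sup>2 * T powr (- (3 / 4)) / sqrt (1 + T / 2))"
      using elim by (simp_all add: T_def)
    \<comment> \<open>Half of this point has real part 1/4, the abscissa of
      \<open>Gamma_quarter_lower_bound\<close>.\<close>
    define p where "p = 1 / 2 + \<i> * of_real T"
    have p2: "p / 2 = Complex (1 / 4) (T / 2)" by (simp add: p_def complex_eq_iff)
    have "p / 2 \<notin> \<int>\<^sub>\<le>\<^sub>0" by (rule Re_pos_not_nonpos_Ints) (simp add: p2)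
    moreover have "p \<noteq> 1" by (simp add: p_def complex_eq_iff)
    ultimately have xi_p: "xi p = 1 / 2 * afac p * zeta p" unfolding xi_eq_xi1 by (intro xi1_eq_completed_zeta)
    have pi_p: "cmod (of_real pi powr (- p / 2)) = pi powr (- 1 / 4)"
      by (subst norm_powr_real_powr) (auto simp: p_def)
    have n1: "cmod p \<ge> T" "cmod (p - 1) \<ge> T"
      using abs_Im_le_cmod[of p] abs_Im_le_cmod[of "p - 1"] T by (simp_all add: p_def)
    have G: "cmod (Gamma (p / 2)) \<ge> c * exp (- (pi * T / 4)) / sqrt (1 + T / 2)"
      using c(2)[of "T / 2"] T by (simp add: p2)
    \<comment> \<open>The exponential decay of the Gamma factor. The sine at this height is at least
      1/(4E), so \<open>E\<close> cancels in the product.\<close>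
    define E where "E = exp (- (pi * T / 4))"
    have E: "E > 0" by (simp add: E_def)
    have "cmod (xi p) = 1 / 2 * (pi powr (- 1 / 4) * cmod p * cmod (Gamma (p / 2)) * cmod (p - 1)) * cmod (zeta p)"
      unfolding xi_p afac_def norm_mult pi_p by simp
    also have "\<dots> \<ge> 1 / 2 * (pi powr (- 1 / 4) * T * (c * E / sqrt (1 + T / 2)) * T) * (L * T powr (- (3 / 4)))"
      using T n1 G c(1) L(1) E unfolding p_def[symmetric] E_def[symmetric] by (intro mult_mono) auto
    finally have xi_ge: "1 / 2 * (pi powr (- 1 / 4) * T * (c * E / sqrt (1 + T / 2)) * T) * (L * T powr (- (3 / 4))) \<le> cmod (xi p)" .
    show ?case
    proof (intro allI impI)
      fix z assume z: "\<bar>Im z\<bar> = mid_ordinate n"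
      have zT: "Im z = T \<or> Im z = - T" using z by (auto simp: T_def)
      have "cmod (xi p) \<le> cmod (xi (1 / 2 + z))"
        using zT
      proof
        assume "Im z = T"
        then have "z = Complex (Re z) T" by (simp add: complex_eq_iff)
        then show ?thesis using xi_monotone[OF RH, of T "Re z"] by (simp add: p_def)
      next
        assume "Im z = - T"
        then have e: "1 / 2 - z = 1 / 2 + Complex (- Re z) T" by (simp add: complex_eq_iff)
        show ?thesis using xi_monotone[OF RH, of T "- Re z"] xi_even[of z] unfolding e by (simp add: p_def)
      qed
      moreover have "cmod (sin (of_real pi * z / 4)) \<ge> 1 / (4 * E)"
      proof -
        have im: "\<bar>Im (of_real pi * z / 4)\<bar> = pi * T / 4" using zT T by (auto simp: abs_mult)
        have "pi * T / 4 \<ge> 1" using mult_mono[of 3 pi 2 T] pi_gt3 T by simp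
        then have "exp (pi * T / 4) / 4 \<le> cmod (sin (of_real pi * z / 4))"
          using norm_sin_ge_exp[of "of_real pi * z / 4"] unfolding im by simp
        then show ?thesis by (simp add: E_def exp_minus divide_simps)
      qed
      ultimately have "1 / (4 * E) * (2 * (1 / 2 * (pi powr (- 1 / 4) * T * (c * E / sqrt (1 + T / 2)) * T) * (L * T powr (- (3 / 4))))) \<le> cmod (nfun z)"
        unfolding nfun_def norm_mult using xi_ge E T c(1) L(1) by (intro mult_mono) (auto intro: order.trans)
      also have "1 / (4 * E) * (2 * (1 / 2 * (pi powr (- 1 / 4) * T * (c * E / sqrt (1 + T / 2)) * T) * (L * T powr (- (3 / 4)))))
         = D * (T\<^sup>2 * T powr (- (3 / 4)) / sqrt (1 + T / 2))"
        using E by (simp add: D_def power2_eq_square)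
      finally show "B \<le> cmod (nfun z)" using T(3) by linarith
    qed
  qed
qed

text \<open>At 4w the sine vanishes, its derivative does not, and xi has no real zeros. At i g it is
  xi that vanishes, simply, while the sine is nonzero off the real axis; evenness of the derivative
  covers -i g.\<close>

lemma deriv_nfun_neq_0:
  assumes RH: "RH" and simple: "\<And>g. g \<in> pos_ordinates \<Longrightarrow> deriv zeta (1 / 2 + \<i> * of_real g) \<noteq> 0"
    and z: "nfun z = 0"
  shows "deriv nfun z \<noteq> 0"
proof -
  have ord: "deriv nfun (\<i> * of_real g) \<noteq> 0" if g: "g \<in> pos_ordinates" for g
  proof -
    have g0: "g > 0" by (rule pos_ordinates_pos[OF g])
    have xi0: "xi (1 / 2 + \<i> * of_real g) = 0" by (rule pos_ordinates_xi[OF RH g])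
    have "1 / 2 + \<i> * of_real g \<noteq> 1" by (simp add: complex_eq_iff)
    then have "deriv xi (1 / 2 + \<i> * of_real g) \<noteq> 0"
      using deriv_xi_zero_imp_deriv_zeta_zero xi0 simple[OF g] by blast
    moreover have "sin (of_real pi * (\<i> * of_real g) / 4) \<noteq> 0"
    proof
      assume "sin (of_real pi * (\<i> * of_real g) / 4) = 0"
      then obtain w :: int where "\<i> * of_real g = 4 * complex_of_int w" unfolding sin_quarter_zero_iff by blast
      then have "Im (\<i> * of_real g) = Im (4 * complex_of_int w)" by simp
      then show False using g0 by simp
    qed
    ultimately show ?thesis
      unfolding DERIV_imp_deriv[OF has_field_derivative_nfun] xi0 by simp
  qed
  consider w :: int where "z = 4 * of_int w" | g where "g \<in> pos_ordinates" "z = \<i> * of_real g \<or> z = - (\<i> * of_real g)"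
    using z unfolding nfun_zero_iff[OF RH] by blast
  then show ?thesis
  proof cases
    case 1
    have "complex_of_real (1 / 2 + 4 * of_int w) = 1 / 2 + 4 * of_int w" by simp
    then have "xi (1 / 2 + 4 * of_int w) \<noteq> 0" using xi_real_neq_0[of "1 / 2 + 4 * of_int w"] by (simp only:) simp
    then have "cmod (deriv nfun z) > 0" unfolding 1 norm_deriv_nfun_real by simp
    then show ?thesis by simp
  next
    case 2
    then show ?thesis using ord[OF 2(1)] deriv_nfun_even[of "\<i> * of_real g"] by auto
  qed
qed

section \<open>Assembling the expansion\<close>

text \<open>The real axis lies in the sector of the lower bound, so \<open>cfun\<close> at 4w is
  O(1/w^2). That this series converges on its own is what later isolates the sum over the
  ordinates.\<close>

lemma summable_p_r_term:
  assumes c: "c > 0" "\<And>s. Re (s\<^sup>2) \<ge> 0 \<Longrightarrow> c * (cmod s)\<^sup>2 \<le> cmod (xi (1 / 2 + s))"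
  shows "summable (\<lambda>w. p_r_term s (Suc w))"
proof (rule summable_comparison_test_ev)
  have "summable (\<lambda>n. 1 / real (Suc n) ^ 2)"
    using inverse_power_summable[of 2, where ?'a = real] by (subst summable_Suc_iff) (simp add: field_simps)
  then show "summable (\<lambda>n. 2 / c * (1 / real (Suc n) ^ 2))" by (rule summable_mult)
  show "eventually (\<lambda>n. norm (p_r_term s (Suc n)) \<le> 2 / c * (1 / real (Suc n) ^ 2)) sequentially"
    using eventually_ge_at_top[of "nat \<lceil>cmod s + 1\<rceil>"]
  proof eventually_elim
    case (elim n)
    define u where "u = (4 * of_nat (Suc n) :: complex)"
    have u: "u = 4 * of_int (int (Suc n))" by (simp add: u_def)
    have nu: "cmod u = 4 * real (Suc n)" unfolding u_def norm_mult norm_of_nat by simp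
    have "cmod s + 1 \<le> real n" using elim by linarith
    then have "cmod u \<ge> cmod s + 1" unfolding nu by simp
    then have d: "cmod (s - u) \<ge> 1" "cmod (s + u) \<ge> 1"
      using norm_triangle_ineq2[of u s] norm_triangle_ineq2[of u "- s"] by (simp_all add: norm_minus_commute add.commute)
    have "u\<^sup>2 = of_real ((4 * real (Suc n))\<^sup>2)" by (simp add: u_def)
    then have "Re (u\<^sup>2) \<ge> 0" by (simp only: Re_complex_of_real) simp
    from c(2)[OF this] have "c * (4 * real (Suc n))\<^sup>2 \<le> cmod (xi (1 / 2 + u))" unfolding nu .
    moreover have "c * real (Suc n) ^ 2 \<le> c * (4 * real (Suc n))\<^sup>2" using c(1) by (simp add: power_mult_distrib)
    ultimately have x: "c * real (Suc n) ^ 2 \<le> cmod (xi (1 / 2 + u))" by (rule order.trans[rotated])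
    have "1 * cmod (xi (1 / 2 + u)) \<le> pi / 2 * cmod (xi (1 / 2 + u))" using pi_gt3 by (intro mult_right_mono) auto
    with x have x': "c * real (Suc n) ^ 2 \<le> cmod (deriv nfun u)"
      unfolding u norm_deriv_nfun_real by simp
    have pos: "c * real (Suc n) ^ 2 > 0" using c(1) by simp
    have "cmod (cfun u) \<le> 1 / (c * real (Suc n) ^ 2)"
      unfolding cfun_def norm_divide norm_one using x' pos by (intro frac_le) auto
    moreover have "cmod (1 / (s - u) + 1 / (s + u)) \<le> 1 + 1"
    proof (intro order.trans[OF norm_triangle_ineq] add_mono)
      show "cmod (1 / (s - u)) \<le> 1" "cmod (1 / (s + u)) \<le> 1" using d by (simp_all add: norm_divide divide_le_eq_1)
    qed
    ultimately have "cmod (cfun u * (1 / (s - u) + 1 / (s + u))) \<le> 1 / (c * real (Suc n) ^ 2) * 2"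
      unfolding norm_mult using pos by (intro mult_mono) auto
    then show ?case by (simp add: p_r_term_def u_def)
  qed
qed

text \<open>The origin and the four families of points on the half-axes are pairwise disjoint, so
  the sum splits; evenness of \<open>h\<close> then pairs z with -z.\<close>

lemma sum_residues_symmetric:
  fixes h :: "complex \<Rightarrow> complex" and e :: "nat \<Rightarrow> real"
  assumes e: "strict_mono e" "\<And>k. e k > 0" and even: "\<And>z. h (- z) = h z"
  assumes A_def: "A = insert 0 (((\<lambda>w. 4 * of_nat (Suc w)) ` {..<N} \<union> (\<lambda>w. - (4 * of_nat (Suc w))) ` {..<N}) \<union>
     ((\<lambda>k. \<i> * of_real (e k)) ` {..n} \<union> (\<lambda>k. - (\<i> * of_real (e k))) ` {..n}))"
  shows "(\<Sum>z\<in>A. h z / (s - z)) = h 0 / s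
     + (\<Sum>w<N. h (4 * of_nat (Suc w)) * (1 / (s - 4 * of_nat (Suc w)) + 1 / (s + 4 * of_nat (Suc w))))
     + (\<Sum>k\<le>n. h (\<i> * of_real (e k)) * (1 / (s - \<i> * of_real (e k)) + 1 / (s + \<i> * of_real (e k))))"
proof -
  define f where "f = (\<lambda>z. h z / (s - z))"
  define r where "r = (\<lambda>w. 4 * of_nat (Suc w) :: complex)"
  define u where "u = (\<lambda>k. \<i> * complex_of_real (e k))"
  have Re_r: "Re (r w) > 0" "Im (r w) = 0" for w by (simp_all add: r_def)
  have Im_u: "Re (u k) = 0" "Im (u k) > 0" for k using e(2) by (simp_all add: u_def)
  have inj: "inj_on r X" "inj_on (\<lambda>w. - r w) X" for X
    by (auto simp: inj_on_def r_def simp del: of_nat_Suc)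
  have inju: "inj_on u Y" "inj_on (\<lambda>k. - u k) Y" for Y
    using strict_mono_eq[OF e(1)] by (auto simp: inj_on_def u_def)
  have A: "A = insert 0 ((r ` {..<N} \<union> (\<lambda>w. - r w) ` {..<N}) \<union> (u ` {..n} \<union> (\<lambda>k. - u k) ` {..n}))"
    by (simp add: A_def r_def u_def)
  have neqs: "r w \<noteq> 0" "u k \<noteq> 0" "r w \<noteq> - r w'" "u k \<noteq> - u k'" "r w \<noteq> u k" "r w \<noteq> - u k" "- r w \<noteq> u k" "- r w \<noteq> - u k"
    for w w' k k'
    using Re_r[of w] Re_r[of w'] Im_u[of k] Im_u[of k'] by (auto simp: complex_eq_iff)
  have "sum f A = f 0 + ((sum f (r ` {..<N}) + sum f ((\<lambda>w. - r w) ` {..<N})) + (sum f (u ` {..n}) + sum f ((\<lambda>k. - u k) ` {..n})))"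
  proof -
    have d1: "r ` {..<N} \<inter> (\<lambda>w. - r w) ` {..<N} = {}" using neqs by blast
    have d2: "u ` {..n} \<inter> (\<lambda>k. - u k) ` {..n} = {}" using neqs by blast
    have d3: "(r ` {..<N} \<union> (\<lambda>w. - r w) ` {..<N}) \<inter> (u ` {..n} \<union> (\<lambda>k. - u k) ` {..n}) = {}"
      using neqs by blast
    have d4: "0 \<notin> (r ` {..<N} \<union> (\<lambda>w. - r w) ` {..<N}) \<union> (u ` {..n} \<union> (\<lambda>k. - u k) ` {..n})"
      using neqs(1,2) by (auto simp: eq_commute[of 0])
    show ?thesis unfolding A
      by (subst sum.insert[OF _ d4], simp, subst sum.union_disjoint[OF _ _ d3], simp, simp,
          subst sum.union_disjoint[OF _ _ d1], simp, simp, subst sum.union_disjoint[OF _ _ d2], simp_all)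
  qed
  also have "sum f (r ` {..<N}) + sum f ((\<lambda>w. - r w) ` {..<N}) = (\<Sum>w<N. h (r w) * (1 / (s - r w) + 1 / (s + r w)))"
    unfolding sum.reindex[OF inj(1)] sum.reindex[OF inj(2)] sum.distrib[symmetric]
    by (intro sum.cong) (simp_all add: f_def even distrib_left)
  also have "sum f (u ` {..n}) + sum f ((\<lambda>k. - u k) ` {..n}) = (\<Sum>k\<le>n. h (u k) * (1 / (s - u k) + 1 / (s + u k)))"
    unfolding sum.reindex[OF inju(1)] sum.reindex[OF inju(2)] sum.distrib[symmetric]
    by (intro sum.cong) (simp_all add: f_def even distrib_left)
  finally show ?thesis by (simp add: f_def r_def u_def)
qed

theorem mainTheorem1:
  fixes s :: complex
  assumes "hypothesis_C"
    and "s \<notin> Z_circ"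
  shows "summable (\<lambda>w. p_r_term s (Suc w)) \<and> summable (\<lambda>k. p_i_term s (Suc k)) \<and> ffun s = pfun s"
proof -
  obtain \<alpha> where \<alpha>: "0 < \<alpha>" "\<alpha> < 1 / 2" and RH: "RH" and C1: "C1 \<alpha>" and C3: "C3"
    using assms(1) unfolding hypothesis_C_def by blast
  note enum = ordinate_enum[OF RH] ordinate_enum_pos[OF RH]
  \<comment> \<open>The lower bound for zeta' in (C3) is positive; the value 1 taken for \<sigma> is
    arbitrary.\<close>
  have simple: "deriv zeta (1 / 2 + \<i> * of_real g) \<noteq> 0" if g: "g \<in> pos_ordinates" for g
  proof -
    obtain n where n: "g = ordinate_enum n" using g enum(2) by blast
    obtain \<epsilon> where "admissible_exponent zeta_deriv_abs \<epsilon>" using C3 unfolding C3_def by blast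
    then obtain K where K: "K > 0" "\<And>k. k \<ge> 1 \<Longrightarrow> zeta_deriv_abs k > K * gam k powr (- (\<epsilon> + 1))"
      unfolding admissible_exponent_def using zero_less_one by blast
    have "zeta_deriv_abs (int (Suc n)) > K * gam (int (Suc n)) powr (- (\<epsilon> + 1))" by (rule K(2)) simp
    moreover have "K * gam (int (Suc n)) powr (- (\<epsilon> + 1)) \<ge> 0" using K(1) by simp
    ultimately have "zeta_deriv_abs (int (Suc n)) > 0" by linarith
    then show ?thesis unfolding zeta_deriv_abs_def gam_Suc[OF RH] n by simp
  qed
  obtain c where c: "c > 0" "\<And>s. Re (s\<^sup>2) \<ge> 0 \<Longrightarrow> c * (cmod s)\<^sup>2 \<le> cmod (xi (1 / 2 + s))"
    using xi_sector_lower_bound[OF RH, of "ordinate_enum 0"] enum(2) by (metis rangeI)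
  have pr: "summable (\<lambda>w. p_r_term s (Suc w))" by (rule summable_p_r_term[OF c])
  have ns: "nfun s \<noteq> 0" by (rule nfun_neq_0_outside_Z_circ[OF RH assms(2)])
  define b where "b = mid_ordinate"
  \<comment> \<open>With half-width \<open>a = 4 * N n + 2\<close> one has
    \<open>b n + 2 \<le> a \<le> b n + 6\<close>: wide enough for the vertical sides to lie in the
    sector |Im z| \<le> |Re z|, narrow enough for the perimeter to stay comparable with
    \<open>b n\<close>.\<close>
  define N where "N = (\<lambda>n. nat \<lceil>b n / 4\<rceil>)"
  define E where "E = (\<lambda>n. ffun s - (cfun 0 / s + (\<Sum>w<N n. p_r_term s (Suc w)) + (\<Sum>k\<le>n. p_i_term s (Suc k))))"
  have blim: "filterlim b at_top sequentially" unfolding b_def by (rule filterlim_mid_ordinate[OF RH])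
  have Ebound: "eventually (\<lambda>n. cmod (E n) \<le> 4 / B) sequentially" if B: "B > 0" for B
  proof -
    \<comment> \<open>The threshold 6 gives \<open>a \<le> 2 * b n\<close>, the second keeps the
      contour at distance at least \<open>b n / 2\<close> from \<open>s\<close>, and the third makes
      \<open>cmod (nfun z) \<ge> B\<close> on the vertical sides.\<close>
    have "eventually (\<lambda>n. b n \<ge> max (max 6 (2 * cmod s + 1)) (B / (2 * c) + 1)) sequentially"
      using blim unfolding filterlim_at_top by blast
    then show ?thesis
      using nfun_horizontal_lower_bound[OF RH \<alpha> C1, of B]
    proof eventually_elim
      case (elim n)
      have bn: "b n \<ge> 6" "b n \<ge> 2 * cmod s + 1" "b n \<ge> B / (2 * c) + 1" using elim(1) by auto
      define a where "a = 4 * real (N n) + 2"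
      have a: "b n + 2 \<le> a" "a \<le> b n + 6" unfolding a_def N_def using bn by linarith+
      define A where "A = insert 0 (((\<lambda>w. 4 * of_nat (Suc w)) ` {..<N n} \<union> (\<lambda>w. - (4 * of_nat (Suc w))) ` {..<N n}) \<union>
         ((\<lambda>k. \<i> * complex_of_real (ordinate_enum k)) ` {..n} \<union> (\<lambda>k. - (\<i> * complex_of_real (ordinate_enum k))) ` {..n}))"
      have boundary: "(\<bar>Re z\<bar> = a \<and> \<bar>Im z\<bar> \<le> b n) \<or> (\<bar>Re z\<bar> \<le> a \<and> \<bar>Im z\<bar> = b n)"
        if "z \<in> path_image (rectpath (Complex (- a) (- b n)) (Complex a (b n)))" for z
      proof -
        have "z \<in> cbox (Complex (- a) (- b n)) (Complex a (b n)) - box (Complex (- a) (- b n)) (Complex a (b n))"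
          using that a bn by (subst (asm) path_image_rectpath_cbox_minus_box) auto
        then show ?thesis by (auto simp: in_cbox_complex_iff in_box_complex_iff)
      qed
      have "cmod (1 / nfun s - (\<Sum>z\<in>A. 1 / deriv nfun z / (s - z))) \<le> (4 * a + 4 * b n) / (2 * pi * B * (b n / 2))"
      proof (rule partial_fraction_rectangle_bound)
        show "nfun holomorphic_on UNIV" by (rule nfun_holomorphic)
        show "a > 0" "b n > 0" "B > 0" "b n / 2 > 0" using a bn B by auto
        show "finite A" by (simp add: A_def)
        show "\<bar>Re z\<bar> < a \<and> \<bar>Im z\<bar> < b n" if "z \<in> A" for z
        proof -
          have "4 * real (Suc w) < a" if "w < N n" for w using that by (simp add: a_def)
          moreover have "ordinate_enum k < b n" if "k \<le> n" for k
            using that mid_ordinate_less_iff[OF RH] by (simp add: b_def)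
          ultimately show ?thesis using that a bn enum(3) by (auto simp: A_def abs_of_pos simp del: of_nat_Suc)
        qed
        show "nfun z = 0 \<longleftrightarrow> z \<in> A" if z: "\<bar>Re z\<bar> \<le> a" "\<bar>Im z\<bar> \<le> b n" for z
        proof
          assume "nfun z = 0"
          then consider w :: int where "z = 4 * of_int w" | g where "g \<in> pos_ordinates" "z = \<i> * of_real g \<or> z = - (\<i> * of_real g)"
            unfolding nfun_zero_iff[OF RH] by blast
          then show "z \<in> A"
          proof cases
            case 1
            \<comment> \<open>From 4 |w| \<le> 4 N + 2, since w is an integer.\<close>
            have w: "\<bar>w\<bar> \<le> int (N n)" using z(1) unfolding 1 a_def by (simp add: abs_mult)
            consider "w = 0" | m where "w = int (Suc m)" | m where "w = - int (Suc m)"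
              by (cases w rule: int_cases; metis of_nat_0 not0_implies_Suc)
            then show ?thesis
            proof cases
              case 2
              then have "m < N n" "z = 4 * of_nat (Suc m)" using w 1 by auto
              then show ?thesis unfolding A_def by blast
            next
              case 3
              then have "m < N n" "z = - (4 * of_nat (Suc m))" using w 1 by auto
              then show ?thesis unfolding A_def by blast
            qed (simp add: 1 A_def)
          next
            case 2
            obtain k where k: "g = ordinate_enum k" using 2 enum(2) by blast
            have "g \<le> b n" using z(2) 2 pos_ordinates_pos[OF 2(1)] by auto
            then have "k \<le> n" using mid_ordinate_less_iff[OF RH, of k n] mid_ordinate_neq[OF RH, of k n] k by (simp add: b_def)
            then show ?thesis using 2 k unfolding A_def by blast
          qed
        next
          assume "z \<in> A"
          moreover have "ordinate_enum k \<in> pos_ordinates" for k using enum(2) by blast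
          moreover have "\<exists>w::int. (4 * of_nat m :: complex) = 4 * of_int w" for m by (intro exI[of _ "int m"]) simp
          moreover have "\<exists>w::int. (- (4 * of_nat m) :: complex) = 4 * of_int w" for m by (intro exI[of _ "- int m"]) simp
          moreover have "\<exists>w::int. (0 :: complex) = 4 * of_int w" by (intro exI[of _ 0]) simp
          ultimately show "nfun z = 0" unfolding nfun_zero_iff[OF RH] A_def by blast
        qed
        then show "deriv nfun z \<noteq> 0" if "z \<in> A" for z
          using deriv_nfun_neq_0[OF RH simple] that \<open>\<And>z. z \<in> A \<Longrightarrow> \<bar>Re z\<bar> < a \<and> \<bar>Im z\<bar> < b n\<close> less_imp_le by metis
        show "\<bar>Re s\<bar> < a" "\<bar>Im s\<bar> < b n"
          using abs_Re_le_cmod[of s] abs_Im_le_cmod[of s] norm_ge_zero[of s] bn a by linarith+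
        show "nfun s \<noteq> 0" by (rule ns)
        fix z assume z: "z \<in> path_image (rectpath (Complex (- a) (- b n)) (Complex a (b n)))"
        have "cmod z \<ge> b n"
          using boundary[OF z] abs_Re_le_cmod[of z] abs_Im_le_cmod[of z] a by auto
        then show "b n / 2 \<le> cmod (z - s)"
          using norm_triangle_ineq2[of z s] bn by simp
        show "B \<le> cmod (nfun z)"
        proof (cases "\<bar>Im z\<bar> = b n")
          case True
          then show ?thesis using elim(2) by (simp add: b_def)
        next
          case False
          then have Re: "\<bar>Re z\<bar> = a" and Im: "\<bar>Im z\<bar> \<le> b n" using boundary[OF z] by auto
          have "\<bar>Im z\<bar>\<^sup>2 \<le> \<bar>Re z\<bar>\<^sup>2" using Re Im a by (intro power_mono) auto
          then have "Re (z\<^sup>2) \<ge> 0" by (simp add: Re_power2)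
          then have "c * (cmod z)\<^sup>2 \<le> cmod (xi (1 / 2 + z))" by (rule c(2))
          moreover have "b n \<le> (cmod z)\<^sup>2"
          proof -
            have "1 * b n \<le> b n * b n" using bn by (intro mult_right_mono) auto
            also have "\<dots> \<le> cmod z * cmod z" using \<open>cmod z \<ge> b n\<close> bn by (intro mult_mono) auto
            finally show ?thesis by (simp add: power2_eq_square)
          qed
          then have "c * b n \<le> c * (cmod z)\<^sup>2" using c(1) by (intro mult_left_mono) auto
          moreover have "B / 2 \<le> c * b n"
          proof -
            have "B / (2 * c) \<le> b n" using bn by simp
            then show ?thesis using c(1) by (simp add: field_simps)
          qed
          ultimately have x: "B \<le> 2 * cmod (xi (1 / 2 + z))" by linarith
          \<comment> \<open>The vertical sides lie halfway between multiples of 4, where pi Re z / 2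
            is an odd multiple of pi.\<close>
          have "cos (2 * Re (of_real pi * z / 4)) = - 1"
          proof -
            have "2 * Re (of_real pi * z / 4) = pi * Re z / 2" by simp
            also have "cos (pi * Re z / 2) = cos (pi * a / 2)" using Re by (auto simp: abs_if split: if_splits)
            also have "pi * a / 2 = 2 * real (N n) * pi + pi" by (simp add: a_def field_simps)
            also have "cos \<dots> = - 1" by (simp only: cos_periodic_pi cos_2npi)
            finally show ?thesis .
          qed
          then have "1 \<le> cmod (sin (of_real pi * z / 4))" by (rule norm_sin_ge_1)
          then have "1 * B \<le> cmod (sin (of_real pi * z / 4)) * (2 * cmod (xi (1 / 2 + z)))"
            using x B by (intro mult_mono) auto
          then show ?thesis by (simp add: nfun_def norm_mult)
        qed
      qed
      also have "(\<Sum>z\<in>A. 1 / deriv nfun z / (s - z)) = (\<Sum>z\<in>A. cfun z / (s - z))"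
        by (simp add: cfun_def)
      also have "\<dots> = cfun 0 / s + (\<Sum>w<N n. p_r_term s (Suc w)) + (\<Sum>k\<le>n. p_i_term s (Suc k))"
        unfolding p_r_term_def p_i_term_def gam_Suc[OF RH]
        by (rule sum_residues_symmetric[where e = ordinate_enum and h = cfun, OF enum(1,3) cfun_even A_def])
      also have "(4 * a + 4 * b n) / (2 * pi * B * (b n / 2)) \<le> 4 / B"
      proof -
        have "(4 * a + 4 * b n) \<le> 12 * b n" using a bn by simp
        also have "\<dots> \<le> 4 * pi * b n" using pi_gt3 bn by (intro mult_right_mono) auto
        finally show ?thesis using B bn by (simp add: divide_simps mult_ac)
      qed
      finally show ?case by (simp add: E_def ffun_def)
    qed
  qed
  have Elim: "E \<longlonglongrightarrow> 0"
  proof (rule tendstoI)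
    fix e :: real assume e: "e > 0"
    \<comment> \<open>With B = 8/e the bound 4/B is e/2.\<close>
    have "eventually (\<lambda>n. cmod (E n) \<le> 4 / (8 / e)) sequentially" using e by (intro Ebound) simp
    then show "eventually (\<lambda>n. dist (E n) 0 < e) sequentially"
      by eventually_elim (use e in auto)
  qed
  have Nlim: "filterlim N at_top sequentially"
  proof -
    have "eventually (\<lambda>n. m \<le> N n) sequentially" for m
    proof -
      have "eventually (\<lambda>n. b n \<ge> 4 * real m) sequentially" using blim unfolding filterlim_at_top by blast
      then show ?thesis by eventually_elim (simp add: N_def le_nat_iff le_ceiling_iff)
    qed
    then show ?thesis unfolding filterlim_at_top by blast
  qed
  have "(\<lambda>n. \<Sum>w<n. p_r_term s (Suc w)) \<longlonglongrightarrow> (\<Sum>w. p_r_term s (Suc w))"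
    by (rule summable_LIMSEQ[OF pr])
  then have "(\<lambda>n. \<Sum>w<N n. p_r_term s (Suc w)) \<longlonglongrightarrow> (\<Sum>w. p_r_term s (Suc w))"
    by (rule filterlim_compose[OF _ Nlim])
  \<comment> \<open>Passing from n to n + 1 takes in exactly one more positive ordinate and its
    negative, so the limit is taken along all partial sums over the ordinates and not along a
    subsequence. Subtracting the convergent sum over the real poles leaves precisely these partial
    sums.\<close>
  then have "(\<lambda>n. ffun s - E n - cfun 0 / s - (\<Sum>w<N n. p_r_term s (Suc w))) \<longlonglongrightarrow> ffun s - 0 - cfun 0 / s - (\<Sum>w. p_r_term s (Suc w))"
    by (intro tendsto_diff tendsto_const Elim)
  then have "(\<lambda>n. \<Sum>k\<le>n. p_i_term s (Suc k)) \<longlonglongrightarrow> ffun s - p_r s"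
    by (simp add: E_def p_r_def diff_diff_eq)
  then have "(\<lambda>k. p_i_term s (Suc k)) sums (ffun s - p_r s)" by (simp add: sums_def_le)
  then show ?thesis using pr by (simp add: sums_iff pfun_def p_i_def)
qed

end
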